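(* Let $\mathbf{M}=(M;\cdot,1)$ be a topological monoid and let $G=\{x\in M\mid \exists y\in M:\ xy=yx=1\}$ be the group of its units. Then the following are equivalent. (1) $\mathbf{M}$ is topologically isomorphic to the endomorphism monoid of a countable $\omega$-categorical structure. (2) There is a topological isomorphism $\xi$ between $\mathbf{M}$ and a closed submonoid of $\mathbb{N}^{\mathbb{N}}$ such that $\xi(G)$ is oligomorphic. (3) $\mathbf{M}$ is separable and there exists a compatible $G$-finitely generated complete left non-expansive ultrametric $d$ on $M$ such that the left action of $G$ on $(M,d)$, $(g,x)\mapsto gx$, is approximately oligomorphic. (4) $\mathbf{M}$ is Hausdorff and there exists a left invariant equivalence relation $V$ of countable index on $M$ such that (a) the uniformity generated by $\big\{\{(x,y)\in M^2\mid \forall g\in F:\ (xg,yg)\in V\}\ \big|\ F\subseteq G \text{ finite}\big\}$ is compatible and complete, and (b) for each $n\in\mathbb{N}$, the equivalence relation $$V_n:=\{(x,y)\in M^n\times M^n\mid \exists g\in G\ \forall i\in\{1,\dots,n\}:\ (x_i,gy_i)\in V\}$$ has finite index.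
   Context: $\mathbb{N}=\{1,2,\dots\}$. A topological monoid is a monoid with a topology for which multiplication is continuous. For a set $X$, $X^X$ is the monoid of all functions $X\to X$ under composition, with the topology of pointwise convergence (product topology, $X$ discrete); in particular this defines the topological monoid $\mathbb{N}^{\mathbb{N}}$. The endomorphism monoid of a structure with domain $X$ carries the subspace topology from $X^X$. A topological isomorphism is a monoid isomorphism that is a homeomorphism. A countable structure is $\omega$-categorical if its first-order theory has only one countable model up to isomorphism. A permutation group on a set $X$ is oligomorphic if for every $n\in\mathbb{N}$ its componentwise action on $X^n$ has only finitely many orbits. A metric on $M$ is compatible if it induces the topology of $\mathbf{M}$; it is complete if every Cauchy sequence converges; it is left non-expansive if $d(gf,gf')\le d(f,f')$ for all $g,f,f'\in M$; it is an ultrametric if $d(x,z)\le\max(d(x,y),d(y,z))$ for all $x,y,z\in M$. For a left non-expansive compatible metric $d$, the left action of $G$ on $(M,d)$ is isometric. A metric $d$ on $M$ is $G$-finitely generated if for every $\varepsilon>0$ there is a finite $F\subseteq G$ such that for all $x,y\in M$: $\max_{g\in F}d(xg,yg)<1/2$ implies $d(x,y)<\varepsilon$. An isometric action of a group $G$ on a metric space $(X,d)$ is approximately oligomorphic if for all $n\ge1$ and $\varepsilon>0$ there is a finite $F\subseteq X^n$ such that for every $x\in X^n$ there is $y\in F$ with $d_{G,n}(x,y)<\varepsilon$, where $d_{G,n}(x,y):=\inf_{g\in G}\max_{1\le i\le n}d(x_i,gy_i)$. An equivalence relation $V$ on $M$ is left invariant if $(y,z)\in V$ implies $(xy,xz)\in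 V$ for all $x,y,z\in M$. The index of an equivalence relation is the cardinality of its set of classes. A uniformity $\mathcal{U}$ on $X$ is a nonempty collection of reflexive binary relations on $X$, closed under supersets in $X^2$, inverses and finite intersections, and such that for each $U\in\mathcal{U}$ there is $V\in\mathcal{U}$ with $V\circ V\subseteq U$. It is generated by a base $\mathcal{B}\subseteq\mathcal{U}$ if each element of $\mathcal{U}$ contains an element of $\mathcal{B}$. It is compatible with a topology if the open sets are exactly those $O$ such that for every $x\in O$ there is $U\in\mathcal{U}$ with $\{y\mid(x,y)\in U\}\subseteq O$. A filter $\mathcal{F}$ on $X$ is Cauchy if for every $U\in\mathcal{U}$ there is $A\in\mathcal{F}$ with $A\times A\subseteq U$, and converges to $x$ if $\{y\mid(x,y)\in U\}\in\mathcal{F}$ for all $U\in\mathcal{U}$; $\mathcal{U}$ is complete if every Cauchy filter converges.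
   Formalization: "Countable" means countably infinite throughout ("separable": a countably infinite dense set; "countable index": exactly ℵ0 classes), and structures have countable signatures; otherwise finite discrete monoids satisfy (3) but not (2). *)

theory Defs
  imports
    "HOL-Analysis.Analysis"
    "HOL-Algebra.Group_Action"
    "HOL-Library.NList"
begin

section \<open>Countability\<close>

text \<open>
  "Countable" means "countably infinite" throughout, also where it is hidden in
  "\<omega>-categorical", "separable" and "countable index".
  The convention matters only for finite monoids. A finite discrete monoid is the endomorphism
  monoid of a finite structure and has a finite dense subset and an equivalence relation of finite
  index with all the required properties, but a finite group never acts oligomorphically on the
  infinite set of natural numbers.
\<close>

definition denumerable :: "'a set \<Rightarrow> bool" where
  "denumerable X \<longleftrightarrow> countable X \<and> infinite X"

definition denumerably_separable :: "'a topology \<Rightarrow> bool" where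
  "denumerably_separable T \<longleftrightarrow>
     (\<exists>D. denumerable D \<and> D \<subseteq> topspace T \<and> T closure_of D = topspace T)"

lemma denumerably_separable_iff:
  "denumerably_separable T \<longleftrightarrow> separable_space T \<and> infinite (topspace T)"
proof
  assume "denumerably_separable T"
  then show "separable_space T \<and> infinite (topspace T)"
    unfolding denumerably_separable_def denumerable_def separable_space_def
    by (meson finite_subset)
next
  assume *: "separable_space T \<and> infinite (topspace T)"
  then obtain C where C: "countable C" "C \<subseteq> topspace T" "T closure_of C = topspace T"
    by (auto simp: separable_space_def)
  obtain E where E: "countable E" "infinite E" "E \<subseteq> topspace T"
    using * infinite_countable_subset' by meson
  have "topspace T \<subseteq> T closure_of (C \<union> E)"
    using C(3) closure_of_mono[of C "C \<union> E" T] by simp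
  with C E have "denumerable (C \<union> E) \<and> C \<union> E \<subseteq> topspace T \<and> T closure_of (C \<union> E) = topspace T"
    by (auto simp: denumerable_def intro: closure_of_subset_topspace[THEN subsetD])
  then show "denumerably_separable T"
    unfolding denumerably_separable_def by blast
qed

definition all_equivalent :: "bool list \<Rightarrow> bool" where
  "all_equivalent Ps \<longleftrightarrow> (\<forall>P\<in>set Ps. \<forall>Q\<in>set Ps. P \<longleftrightarrow> Q)"


section \<open>Topological monoids\<close>

locale topological_monoid = monoid M for M (structure) +
  fixes T :: "'a topology"
  assumes topspace_eq: "topspace T = carrier M"
    and continuous_mult: "continuous_map (prod_topology T T) T (\<lambda>(x, y). x \<otimes> y)"

text \<open>A bijective homomorphism of semigroups between monoids preserves the neutral element.\<close>

definition topological_iso ::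
  "('a, 'm) monoid_scheme \<Rightarrow> 'a topology \<Rightarrow> ('b, 'n) monoid_scheme \<Rightarrow> 'b topology \<Rightarrow> ('a \<Rightarrow> 'b) \<Rightarrow> bool"
  where "topological_iso M T N S \<xi> \<longleftrightarrow> \<xi> \<in> iso M N \<and> homeomorphic_map T S \<xi>"

text \<open>
  As in \<^const>\<open>BijGroup\<close>, a function on \<open>X\<close> is represented by its extensional version.
  For \<open>X = UNIV\<close> the carrier is \<open>UNIV\<close> and the multiplication is the usual composition.
\<close>

definition transformation_monoid :: "'x set \<Rightarrow> ('x \<Rightarrow> 'x) monoid" where
  "transformation_monoid X =
     \<lparr>carrier = X \<rightarrow>\<^sub>E X, mult = (\<lambda>g f. compose X g f), one = (\<lambda>x\<in>X. x)\<rparr>"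

definition pointwise_topology :: "'x set \<Rightarrow> ('x \<Rightarrow> 'x) topology" where
  "pointwise_topology X = product_topology (\<lambda>_. discrete_topology X) X"

definition oligomorphic :: "'x set \<Rightarrow> ('x \<Rightarrow> 'x) set \<Rightarrow> bool" where
  "oligomorphic X P \<longleftrightarrow> subgroup P (BijGroup X) \<and>
     (\<forall>n\<ge>1. finite (orbits (BijGroup X\<lparr>carrier := P\<rparr>) (nlists n X) map))"


section \<open>First-order structures\<close>

text \<open>
  A symbol of a signature is a name together with its arity; constants are function symbols of
  arity 0. Values of the interpretations on lists of the wrong length, or outside the domain,
  are irrelevant.
\<close>

record ('f, 'r) signature =
  funs :: "('f \<times> nat) set"
  rels :: "('r \<times> nat) set"

record ('f, 'r, 'x) fo_struct =
  Dom :: "'x set"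
  fun_int :: "'f \<times> nat \<Rightarrow> 'x list \<Rightarrow> 'x"
  rel_int :: "'r \<times> nat \<Rightarrow> 'x list set"

definition is_struct :: "('f, 'r) signature \<Rightarrow> ('f, 'r, 'x) fo_struct \<Rightarrow> bool" where
  "is_struct S A \<longleftrightarrow> Dom A \<noteq> {} \<and>
     (\<forall>(f, n)\<in>funs S. \<forall>xs\<in>nlists n (Dom A). fun_int A (f, n) xs \<in> Dom A)"

definition struct_hom ::
  "('f, 'r) signature \<Rightarrow> ('f, 'r, 'x) fo_struct \<Rightarrow> ('f, 'r, 'y) fo_struct \<Rightarrow> ('x \<Rightarrow> 'y) \<Rightarrow> bool" where
  "struct_hom S A B h \<longleftrightarrow> h \<in> Dom A \<rightarrow> Dom B \<and>
     (\<forall>(f, n)\<in>funs S. \<forall>xs\<in>nlists n (Dom A).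
        h (fun_int A (f, n) xs) = fun_int B (f, n) (map h xs)) \<and>
     (\<forall>(r, n)\<in>rels S. \<forall>xs\<in>nlists n (Dom A).
        xs \<in> rel_int A (r, n) \<longrightarrow> map h xs \<in> rel_int B (r, n))"

definition struct_iso ::
  "('f, 'r) signature \<Rightarrow> ('f, 'r, 'x) fo_struct \<Rightarrow> ('f, 'r, 'y) fo_struct \<Rightarrow> ('x \<Rightarrow> 'y) \<Rightarrow> bool" where
  "struct_iso S A B h \<longleftrightarrow> struct_hom S A B h \<and> bij_betw h (Dom A) (Dom B) \<and>
     (\<forall>(r, n)\<in>rels S. \<forall>xs\<in>nlists n (Dom A).
        map h xs \<in> rel_int B (r, n) \<longrightarrow> xs \<in> rel_int A (r, n))"

definition Endo :: "('f, 'r) signature \<Rightarrow> ('f, 'r, 'x) fo_struct \<Rightarrow> ('x \<Rightarrow> 'x) set" where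
  "Endo S A = {h \<in> Dom A \<rightarrow>\<^sub>E Dom A. struct_hom S A A h}"

definition endo_monoid :: "('f, 'r) signature \<Rightarrow> ('f, 'r, 'x) fo_struct \<Rightarrow> ('x \<Rightarrow> 'x) monoid" where
  "endo_monoid S A = transformation_monoid (Dom A)\<lparr>carrier := Endo S A\<rparr>"

definition endo_topology :: "('f, 'r) signature \<Rightarrow> ('f, 'r, 'x) fo_struct \<Rightarrow> ('x \<Rightarrow> 'x) topology" where
  "endo_topology S A = subtopology (pointwise_topology (Dom A)) (Endo S A)"


section \<open>First-order logic with equality\<close>

datatype 'f tm = Var nat | Fun 'f "'f tm list"

datatype ('f, 'r) fm =
    Eq "'f tm" "'f tm"
  | Rel 'r "'f tm list"
  | Neg "('f, 'r) fm"
  | Conj "('f, 'r) fm" "('f, 'r) fm"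
  | Exists nat "('f, 'r) fm"

primrec tm_vars :: "'f tm \<Rightarrow> nat set" where
  "tm_vars (Var v) = {v}"
| "tm_vars (Fun f ts) = \<Union>(set (map tm_vars ts))"

primrec free_vars :: "('f, 'r) fm \<Rightarrow> nat set" where
  "free_vars (Eq s t) = tm_vars s \<union> tm_vars t"
| "free_vars (Rel r ts) = \<Union>(set (map tm_vars ts))"
| "free_vars (Neg \<phi>) = free_vars \<phi>"
| "free_vars (Conj \<phi> \<psi>) = free_vars \<phi> \<union> free_vars \<psi>"
| "free_vars (Exists v \<phi>) = free_vars \<phi> - {v}"

primrec wf_tm :: "('f, 'r) signature \<Rightarrow> 'f tm \<Rightarrow> bool" where
  "wf_tm S (Var v) \<longleftrightarrow> True"
| "wf_tm S (Fun f ts) \<longleftrightarrow> (f, length ts) \<in> funs S \<and> list_all id (map (wf_tm S) ts)"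

primrec wf_fm :: "('f, 'r) signature \<Rightarrow> ('f, 'r) fm \<Rightarrow> bool" where
  "wf_fm S (Eq s t) \<longleftrightarrow> wf_tm S s \<and> wf_tm S t"
| "wf_fm S (Rel r ts) \<longleftrightarrow> (r, length ts) \<in> rels S \<and> list_all (wf_tm S) ts"
| "wf_fm S (Neg \<phi>) \<longleftrightarrow> wf_fm S \<phi>"
| "wf_fm S (Conj \<phi> \<psi>) \<longleftrightarrow> wf_fm S \<phi> \<and> wf_fm S \<psi>"
| "wf_fm S (Exists v \<phi>) \<longleftrightarrow> wf_fm S \<phi>"

primrec tm_val :: "('f, 'r, 'x) fo_struct \<Rightarrow> (nat \<Rightarrow> 'x) \<Rightarrow> 'f tm \<Rightarrow> 'x" where
  "tm_val A e (Var v) = e v"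
| "tm_val A e (Fun f ts) = fun_int A (f, length ts) (map (tm_val A e) ts)"

primrec sat :: "('f, 'r, 'x) fo_struct \<Rightarrow> (nat \<Rightarrow> 'x) \<Rightarrow> ('f, 'r) fm \<Rightarrow> bool" where
  "sat A e (Eq s t) \<longleftrightarrow> tm_val A e s = tm_val A e t"
| "sat A e (Rel r ts) \<longleftrightarrow> map (tm_val A e) ts \<in> rel_int A (r, length ts)"
| "sat A e (Neg \<phi>) \<longleftrightarrow> \<not> sat A e \<phi>"
| "sat A e (Conj \<phi> \<psi>) \<longleftrightarrow> sat A e \<phi> \<and> sat A e \<psi>"
| "sat A e (Exists v \<phi>) \<longleftrightarrow> (\<exists>a\<in>Dom A. sat A (e(v := a)) \<phi>)"

definition holds_in :: "('f, 'r, 'x) fo_struct \<Rightarrow> ('f, 'r) fm \<Rightarrow> bool" where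
  "holds_in A \<phi> \<longleftrightarrow> (\<forall>e. range e \<subseteq> Dom A \<longrightarrow> sat A e \<phi>)"

definition Th :: "('f, 'r) signature \<Rightarrow> ('f, 'r, 'x) fo_struct \<Rightarrow> ('f, 'r) fm set" where
  "Th S A = {\<phi>. wf_fm S \<phi> \<and> free_vars \<phi> = {} \<and> holds_in A \<phi>}"

definition is_model :: "('f, 'r) signature \<Rightarrow> ('f, 'r) fm set \<Rightarrow> ('f, 'r, 'x) fo_struct \<Rightarrow> bool" where
  "is_model S \<Gamma> B \<longleftrightarrow> is_struct S B \<and> (\<forall>\<phi>\<in>\<Gamma>. holds_in B \<phi>)"

text \<open>
  Signatures are countable, as always for \<omega>-categoricity. (The set of natural numbers with names
  for all relations on it is the only countable model of its theory up to isomorphism, but its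
  automorphism group is trivial.) Countability is expressed by drawing the names from \<^typ>\<open>nat\<close>. Likewise, every
  countable structure has an isomorphic copy with domain in \<^typ>\<open>nat\<close>.
\<close>

definition countable_structure ::
  "(nat, nat) signature \<Rightarrow> (nat, nat, nat) fo_struct \<Rightarrow> bool" where
  "countable_structure S A \<longleftrightarrow> is_struct S A \<and> denumerable (Dom A)"

definition omega_categorical ::
  "(nat, nat) signature \<Rightarrow> (nat, nat, nat) fo_struct \<Rightarrow> bool" where
  "omega_categorical S A \<longleftrightarrow>
     (\<forall>B C. countable_structure S B \<and> is_model S (Th S A) B \<and>
            countable_structure S C \<and> is_model S (Th S A) C \<longrightarrow> (\<exists>h. struct_iso S B C h))"


section \<open>Metrics on a topological monoid\<close>

definition compatible_metric :: "'a topology \<Rightarrow> ('a \<Rightarrow> 'a \<Rightarrow> real) \<Rightarrow> bool" where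
  "compatible_metric T d \<longleftrightarrow> Metric_space (topspace T) d \<and>
     Metric_space.mtopology (topspace T) d = T"

definition ultrametric_on :: "'a set \<Rightarrow> ('a \<Rightarrow> 'a \<Rightarrow> real) \<Rightarrow> bool" where
  "ultrametric_on X d \<longleftrightarrow> Metric_space X d \<and>
     (\<forall>x\<in>X. \<forall>y\<in>X. \<forall>z\<in>X. d x z \<le> max (d x y) (d y z))"

definition left_nonexpansive :: "('a, 'm) monoid_scheme \<Rightarrow> ('a \<Rightarrow> 'a \<Rightarrow> real) \<Rightarrow> bool" where
  "left_nonexpansive M d \<longleftrightarrow>
     (\<forall>g\<in>carrier M. \<forall>f\<in>carrier M. \<forall>f'\<in>carrier M. d (g \<otimes>\<^bsub>M\<^esub> f) (g \<otimes>\<^bsub>M\<^esub> f') \<le> d f f')"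

text \<open>That a maximum over a finite \<open>F\<close> is below \<open>1/2\<close> is stated pointwise, which includes \<open>F = {}\<close>.\<close>

definition finitely_generated_metric ::
  "('a, 'm) monoid_scheme \<Rightarrow> 'a set \<Rightarrow> ('a \<Rightarrow> 'a \<Rightarrow> real) \<Rightarrow> bool" where
  "finitely_generated_metric M G d \<longleftrightarrow>
     (\<forall>\<epsilon>>0. \<exists>F. finite F \<and> F \<subseteq> G \<and>
        (\<forall>x\<in>carrier M. \<forall>y\<in>carrier M.
           (\<forall>g\<in>F. d (x \<otimes>\<^bsub>M\<^esub> g) (y \<otimes>\<^bsub>M\<^esub> g) < 1/2) \<longrightarrow> d x y < \<epsilon>))"

definition orbit_dist ::
  "'g set \<Rightarrow> ('g \<Rightarrow> 'x \<Rightarrow> 'x) \<Rightarrow> ('x \<Rightarrow> 'x \<Rightarrow> real) \<Rightarrow> nat \<Rightarrow> 'x list \<Rightarrow> 'x list \<Rightarrow> real" where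
  "orbit_dist G act d n x y = (INF g\<in>G. Max ((\<lambda>i. d (x ! i) (act g (y ! i))) ` {..<n}))"

definition approximately_oligomorphic ::
  "'g set \<Rightarrow> ('g \<Rightarrow> 'x \<Rightarrow> 'x) \<Rightarrow> 'x set \<Rightarrow> ('x \<Rightarrow> 'x \<Rightarrow> real) \<Rightarrow> bool" where
  "approximately_oligomorphic G act X d \<longleftrightarrow>
     (\<forall>n\<ge>1. \<forall>\<epsilon>>0. \<exists>F. finite F \<and> F \<subseteq> nlists n X \<and>
        (\<forall>x\<in>nlists n X. \<exists>y\<in>F. orbit_dist G act d n x y < \<epsilon>))"


section \<open>Uniformities\<close>

definition is_uniformity :: "'a set \<Rightarrow> 'a rel set \<Rightarrow> bool" where
  "is_uniformity X \<U> \<longleftrightarrow> \<U> \<noteq> {} \<and>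
     (\<forall>U\<in>\<U>. U \<subseteq> X \<times> X \<and> Id_on X \<subseteq> U) \<and>
     (\<forall>U\<in>\<U>. \<forall>W. U \<subseteq> W \<and> W \<subseteq> X \<times> X \<longrightarrow> W \<in> \<U>) \<and>
     (\<forall>U\<in>\<U>. U\<inverse> \<in> \<U>) \<and>
     (\<forall>U\<in>\<U>. \<forall>W\<in>\<U>. U \<inter> W \<in> \<U>) \<and>
     (\<forall>U\<in>\<U>. \<exists>W\<in>\<U>. W O W \<subseteq> U)"

definition uniformity_base :: "'a rel set \<Rightarrow> 'a rel set \<Rightarrow> bool" where
  "uniformity_base \<B> \<U> \<longleftrightarrow> \<B> \<subseteq> \<U> \<and> (\<forall>U\<in>\<U>. \<exists>B\<in>\<B>. B \<subseteq> U)"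

definition compatible_uniformity :: "'a topology \<Rightarrow> 'a rel set \<Rightarrow> bool" where
  "compatible_uniformity T \<U> \<longleftrightarrow>
     (\<forall>W. openin T W \<longleftrightarrow> W \<subseteq> topspace T \<and> (\<forall>x\<in>W. \<exists>U\<in>\<U>. U `` {x} \<subseteq> W))"

text \<open>Filters on \<open>X\<close> are the proper filters \<open>F\<close> with \<open>F \<le> principal X\<close>.\<close>

definition complete_uniformity :: "'a set \<Rightarrow> 'a rel set \<Rightarrow> bool" where
  "complete_uniformity X \<U> \<longleftrightarrow>
     (\<forall>F. F \<noteq> bot \<and> F \<le> principal X \<and>
          (\<forall>U\<in>\<U>. \<exists>A. eventually (\<lambda>x. x \<in> A) F \<and> A \<times> A \<subseteq> U) \<longrightarrow>
          (\<exists>x\<in>X. \<forall>U\<in>\<U>. eventually (\<lambda>y. (x, y) \<in> U) F))"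

definition left_invariant :: "('a, 'm) monoid_scheme \<Rightarrow> 'a rel \<Rightarrow> bool" where
  "left_invariant M V \<longleftrightarrow>
     (\<forall>x\<in>carrier M. \<forall>y\<in>carrier M. \<forall>z\<in>carrier M.
        (y, z) \<in> V \<longrightarrow> (x \<otimes>\<^bsub>M\<^esub> y, x \<otimes>\<^bsub>M\<^esub> z) \<in> V)"

end

theory Submission
  imports Defs
begin

text \<open>
  All four conditions are compared with one condition on actions: \<open>M\<close> acts faithfully on the
  natural numbers in such a way that its topology becomes the topology of pointwise convergence, the
  set of maps arising from \<open>M\<close> is closed, and the units act oligomorphically (locale
  \<open>faithful_representation\<close>). Condition (2) says this in terms of an isomorphism.

  Given such an action, take one relation \<open>R\<^sub>t = {x t | x \<in> M}\<close> for each finite tuple \<open>t\<close> of natural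
  numbers. A map preserving all of them agrees on every finite tuple with an element of \<open>M\<close>, so it
  comes from \<open>M\<close> by closedness. The units are automorphisms, hence for every \<open>n\<close> only finitely many
  complete types of \<open>n\<close>-tuples are realised, and this makes the structure \<open>\<omega>\<close>-categorical: every type
  is isolated by a formula, so that a back-and-forth construction (\<open>iso_extending\<close>) applies to any
  two countable models.

  The way back from \<open>\<omega>\<close>-categorical structures is the theorem of Ryll-Nardzewski. The countable
  models that it needs are obtained from a filter on the set of assignments \<open>nat \<Rightarrow> Dom A\<close>: the
  elements are the variables, identified if their values agree along the filter, and a formula holds
  if it holds along the filter (\<open>sat_gen_model\<close>). So the model is a countable elementary part of a
  reduced power; all that is asked of the filter is that it decides every formula and provides
  witnesses among the variables. Such filters are built by meeting countably many dense requirements,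
  which leaves room for two further wishes. Omitting a type that is not isolated shows that, by
  \<open>\<omega>\<close>-categoricity, all types realised in \<open>A\<close> are isolated (\<open>types_isolated\<close>). If infinitely many
  types of \<open>n\<close>-tuples were realised, a filter consisting of sets that realise infinitely many of them
  would produce a tuple whose type is not isolated (\<open>finitely_many_types\<close>). Finally,
  tuples of the same type are conjugate under automorphisms, again by back and forth, and the
  automorphisms are the units of the endomorphism monoid.

  For the metric, \<open>d x y\<close> decreases with the first place where the actions of \<open>x\<close> and \<open>y\<close> differ, but
  it takes its largest value on all places in an initial segment \<open>{..<r}\<close> that meets all orbits of
  the units. Since every number is the image of some \<open>p < r\<close> under a unit, right translates by
  units recover \<open>d\<close> from the relation \<open>d x y < 1/2\<close>. Conversely this relation is the equivalence
  relation \<open>V\<close> in (4). From \<open>V\<close> the action is regained as left multiplication on the set of classes.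
  It has the right topology because that topology is determined by the classes of \<open>x \<otimes> g\<close> for the
  units \<open>g\<close>, it is closed by completeness, and it is oligomorphic because the relations \<open>V\<^sub>n\<close> have
  finite index.
\<close>

section \<open>First-order formulas under isomorphisms and renamings\<close>

text \<open>
  As a rewrite rule, this fact leaves the length of the list to be guessed, and on explicit lists the
  search does not end.
\<close>

declare nlistsE_length [simp del]

abbreviation assignments :: "('f, 'r, 'x) fo_struct \<Rightarrow> (nat \<Rightarrow> 'x) set" where
  "assignments A \<equiv> {e. range e \<subseteq> Dom A}"

text \<open>
  The recursive equations again: as declared by default, they let \<open>simp\<close> unfold the composition in
  assignments of the form \<open>e \<circ> \<sigma>\<close>, which have to stay intact below.
\<close>

lemma tm_val_simps [simp]:
  "tm_val A e (Var v) = e v"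
  "tm_val A e (Fun f ts) = fun_int A (f, length ts) (map (tm_val A e) ts)"
  by (simp_all only: tm_val.simps)

lemma sat_simps [simp]:
  "sat A e (Eq s t) \<longleftrightarrow> tm_val A e s = tm_val A e t"
  "sat A e (Rel r ts) \<longleftrightarrow> map (tm_val A e) ts \<in> rel_int A (r, length ts)"
  "sat A e (Neg \<phi>) \<longleftrightarrow> \<not> sat A e \<phi>"
  "sat A e (Conj \<phi> \<psi>) \<longleftrightarrow> sat A e \<phi> \<and> sat A e \<psi>"
  "sat A e (Exists v \<phi>) \<longleftrightarrow> (\<exists>a\<in>Dom A. sat A (e(v := a)) \<phi>)"
  by (simp_all only: sat.simps)

declare tm_val.simps [simp del] sat.simps [simp del]

lemma finite_tm_vars: "finite (tm_vars t)"
  by (induction t) auto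

lemma finite_free_vars: "finite (free_vars \<phi>)"
  by (induction \<phi>) (auto simp: finite_tm_vars)

lemma tm_val_cong:
  "(\<And>v. v \<in> tm_vars t \<Longrightarrow> e v = e' v) \<Longrightarrow> tm_val A e t = tm_val A e' t"
proof (induction t)
  case (Fun f ts)
  then have "map (tm_val A e) ts = map (tm_val A e') ts" by auto
  then show ?case by (simp only: tm_val_simps)
qed simp

lemma sat_cong:
  "(\<And>v. v \<in> free_vars \<phi> \<Longrightarrow> e v = e' v) \<Longrightarrow> sat A e \<phi> \<longleftrightarrow> sat A e' \<phi>"
proof (induction \<phi> arbitrary: e e')
  case (Eq s t)
  then show ?case using tm_val_cong[of s e e' A] tm_val_cong[of t e e' A] by simp
next
  case (Rel r ts)
  then have "map (tm_val A e) ts = map (tm_val A e') ts" by (auto intro: tm_val_cong)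
  then show ?case by (simp only: sat_simps)
next
  case (Neg \<phi>)
  from Neg.IH[of e e'] Neg.prems show ?case by simp
next
  case (Conj \<phi> \<psi>)
  from Conj.IH[of e e'] Conj.prems show ?case by simp
next
  case (Exists v \<phi>)
  have "sat A (e(v := a)) \<phi> \<longleftrightarrow> sat A (e'(v := a)) \<phi>" for a
    using Exists.prems by (intro Exists.IH) auto
  then show ?case by simp
qed

lemma is_structD:
  assumes "is_struct S A" "(f, length xs) \<in> funs S" "set xs \<subseteq> Dom A"
  shows "fun_int A (f, length xs) xs \<in> Dom A"
  using assms nlistsI[OF refl assms(3)] unfolding is_struct_def by fast

lemma struct_homD:
  assumes "struct_hom S A B h" "set xs \<subseteq> Dom A"
  shows "(f, length xs) \<in> funs S \<Longrightarrow> h (fun_int A (f, length xs) xs) = fun_int B (f, length xs) (map h xs)"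
    and "(r, length xs) \<in> rels S \<Longrightarrow> xs \<in> rel_int A (r, length xs) \<Longrightarrow>
      map h xs \<in> rel_int B (r, length xs)"
    and "x \<in> Dom A \<Longrightarrow> h x \<in> Dom B"
  using assms(1) nlistsI[OF refl assms(2)] unfolding struct_hom_def by fast+

lemma struct_isoD:
  assumes "struct_iso S A B h"
  shows "struct_hom S A B h" "bij_betw h (Dom A) (Dom B)"
    and "set xs \<subseteq> Dom A \<Longrightarrow> (r, length xs) \<in> rels S \<Longrightarrow>
      map h xs \<in> rel_int B (r, length xs) \<longleftrightarrow> xs \<in> rel_int A (r, length xs)"
proof -
  show hom: "struct_hom S A B h" and "bij_betw h (Dom A) (Dom B)"
    using assms by (auto simp: struct_iso_def)
  show "map h xs \<in> rel_int B (r, length xs) \<longleftrightarrow> xs \<in> rel_int A (r, length xs)"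
    if "set xs \<subseteq> Dom A" "(r, length xs) \<in> rels S"
    using assms nlistsI[OF refl that(1)] that struct_homD(2)[OF hom that(1)]
    unfolding struct_iso_def by fast
qed

lemma tm_val_in_Dom:
  assumes "is_struct S A" "e \<in> assignments A"
  shows "wf_tm S t \<Longrightarrow> tm_val A e t \<in> Dom A"
proof (induction t)
  case (Var v)
  then show ?case using assms by auto
next
  case (Fun f ts)
  then have "set (map (tm_val A e) ts) \<subseteq> Dom A" by (auto simp: list_all_iff)
  with Fun.prems is_structD[OF assms(1), of f "map (tm_val A e) ts"] show ?case by simp
qed

lemma tm_val_hom:
  assumes "is_struct S A" "struct_hom S A B h" "e \<in> assignments A"
  shows "wf_tm S t \<Longrightarrow> tm_val B (h \<circ> e) t = h (tm_val A e t)"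
proof (induction t)
  case (Fun f ts)
  then have wf: "\<And>t. t \<in> set ts \<Longrightarrow> wf_tm S t" and f: "(f, length ts) \<in> funs S"
    by (auto simp: list_all_iff)
  have "set (map (tm_val A e) ts) \<subseteq> Dom A"
    using tm_val_in_Dom[OF assms(1,3)] wf by auto
  with f struct_homD(1)[OF assms(2), of "map (tm_val A e) ts"]
  have "h (fun_int A (f, length ts) (map (tm_val A e) ts)) =
      fun_int B (f, length ts) (map h (map (tm_val A e) ts))"
    by simp
  moreover have "map h (map (tm_val A e) ts) = map (tm_val B (h \<circ> e)) ts"
    using Fun.IH wf by (simp add: o_def)
  ultimately show ?case by (simp only: tm_val_simps)
qed simp

lemma sat_iso:
  assumes "is_struct S A" "struct_iso S A B h"
  shows "wf_fm S \<phi> \<Longrightarrow> e \<in> assignments A \<Longrightarrow> sat B (h \<circ> e) \<phi> \<longleftrightarrow> sat A e \<phi>"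
proof (induction \<phi> arbitrary: e)
  have hom: "struct_hom S A B h" and bij: "bij_betw h (Dom A) (Dom B)"
    using struct_isoD[OF assms(2)] by auto
  {
    case (Eq s t)
    then show ?case
      using tm_val_hom[OF assms(1) hom Eq.prems(2)] tm_val_in_Dom[OF assms(1) Eq.prems(2)]
        bij_betw_imp_inj_on[OF bij] by (simp only: sat_simps wf_fm.simps inj_on_eq_iff)
  next
    case (Rel r ts)
    then have wf: "\<And>t. t \<in> set ts \<Longrightarrow> wf_tm S t" and r: "(r, length ts) \<in> rels S"
      by (auto simp: list_all_iff)
    let ?xs = "map (tm_val A e) ts"
    have xs: "set ?xs \<subseteq> Dom A"
      using tm_val_in_Dom[OF assms(1) Rel.prems(2)] wf by auto
    have eq: "map (tm_val B (h \<circ> e)) ts = map h ?xs"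
      using tm_val_hom[OF assms(1) hom Rel.prems(2)] wf by auto
    have "map h ?xs \<in> rel_int B (r, length ts) \<longleftrightarrow> ?xs \<in> rel_int A (r, length ts)"
      using r struct_isoD(3)[OF assms(2) xs, of r] by simp
    then show ?case by (simp only: sat_simps eq)
  next
    case (Exists v \<phi>)
    have "(h \<circ> e)(v := h a) = h \<circ> e(v := a)" for a by auto
    moreover have "e(v := a) \<in> assignments A" if "a \<in> Dom A" for a
      using that Exists.prems by auto
    ultimately have "sat B ((h \<circ> e)(v := h a)) \<phi> \<longleftrightarrow> sat A (e(v := a)) \<phi>" if "a \<in> Dom A" for a
      using that Exists.IH[of "e(v := a)"] Exists.prems by (simp only: wf_fm.simps)
    moreover have "Dom B = h ` Dom A" using bij by (simp add: bij_betw_def)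
    ultimately show ?case by (simp add: o_def)
  }
qed auto

primrec rename_tm :: "(nat \<Rightarrow> nat) \<Rightarrow> 'f tm \<Rightarrow> 'f tm" where
  "rename_tm \<sigma> (Var v) = Var (\<sigma> v)"
| "rename_tm \<sigma> (Fun f ts) = Fun f (map (rename_tm \<sigma>) ts)"

text \<open>
  Simultaneous renaming of the free variables; a bound variable is moved above all variables that
  become free in its scope, so that nothing is captured.
\<close>
primrec rename :: "('f, 'r) fm \<Rightarrow> (nat \<Rightarrow> nat) \<Rightarrow> ('f, 'r) fm" where
  "rename (Eq s t) \<sigma> = Eq (rename_tm \<sigma> s) (rename_tm \<sigma> t)"
| "rename (Rel r ts) \<sigma> = Rel r (map (rename_tm \<sigma>) ts)"
| "rename (Neg \<phi>) \<sigma> = Neg (rename \<phi> \<sigma>)"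
| "rename (Conj \<phi> \<psi>) \<sigma> = Conj (rename \<phi> \<sigma>) (rename \<psi> \<sigma>)"
| "rename (Exists v \<phi>) \<sigma> =
     (let w = Suc (Max (insert 0 (\<sigma> ` (free_vars \<phi> - {v})))) in Exists w (rename \<phi> (\<sigma>(v := w))))"

lemma wf_rename_tm: "wf_tm S t \<Longrightarrow> wf_tm S (rename_tm \<sigma> t)"
  by (induction t) (auto simp: list_all_iff)

lemma wf_rename: "wf_fm S \<phi> \<Longrightarrow> wf_fm S (rename \<phi> \<sigma>)"
  by (induction \<phi> arbitrary: \<sigma>) (auto simp: list_all_iff wf_rename_tm Let_def)

lemma tm_vars_rename_tm: "tm_vars (rename_tm \<sigma> t) = \<sigma> ` tm_vars t"
  by (induction t) auto

lemma free_vars_rename: "free_vars (rename \<phi> \<sigma>) \<subseteq> \<sigma> ` free_vars \<phi>"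
proof (induction \<phi> arbitrary: \<sigma>)
  case (Conj \<phi> \<psi>)
  from Conj[of \<sigma>] show ?case by (simp only: rename.simps free_vars.simps image_Un) blast
next
  case (Exists v \<phi>)
  define w where "w = Suc (Max (insert 0 (\<sigma> ` (free_vars \<phi> - {v}))))"
  have "free_vars (rename \<phi> (\<sigma>(v := w))) \<subseteq> \<sigma>(v := w) ` free_vars \<phi>" by (rule Exists)
  then show ?case by (auto simp: Let_def simp flip: w_def split: if_splits)
qed (simp_all add: tm_vars_rename_tm image_Un image_UN)

lemma tm_val_rename_tm: "tm_val A e (rename_tm \<sigma> t) = tm_val A (e \<circ> \<sigma>) t"
proof (induction t)
  case (Fun f ts)
  then have "map (tm_val A e) (map (rename_tm \<sigma>) ts) = map (tm_val A (e \<circ> \<sigma>)) ts"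
    by (simp add: o_def)
  then show ?case by (simp only: rename_tm.simps tm_val_simps length_map)
qed simp

lemma sat_rename: "sat A e (rename \<phi> \<sigma>) \<longleftrightarrow> sat A (e \<circ> \<sigma>) \<phi>"
proof (induction \<phi> arbitrary: e \<sigma>)
  case (Rel r ts)
  have "map (tm_val A e) (map (rename_tm \<sigma>) ts) = map (tm_val A (e \<circ> \<sigma>)) ts"
    by (auto simp: tm_val_rename_tm)
  then show ?case by (simp only: rename.simps sat_simps length_map)
next
  case (Exists v \<phi>)
  define w where "w = Suc (Max (insert 0 (\<sigma> ` (free_vars \<phi> - {v}))))"
  have "\<sigma> u \<noteq> w" if "u \<in> free_vars \<phi>" "u \<noteq> v" for u
  proof -
    have "\<sigma> u \<le> Max (insert 0 (\<sigma> ` (free_vars \<phi> - {v})))"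
      using that by (intro Max_ge) (auto simp: finite_free_vars)
    then show ?thesis by (simp add: w_def)
  qed
  then have "sat A (e(w := a) \<circ> \<sigma>(v := w)) \<phi> \<longleftrightarrow> sat A ((e \<circ> \<sigma>)(v := a)) \<phi>" for a
    by (intro sat_cong) auto
  then show ?case
    by (simp only: rename.simps Let_def sat_simps Exists.IH flip: w_def)
qed (auto simp: tm_val_rename_tm)

text \<open>The obvious choice \<open>Eq (Var 0) (Var 0)\<close> would have a free variable.\<close>
definition truth :: "('f, 'r) fm" where
  "truth = Neg (Exists 0 (Neg (Eq (Var 0) (Var 0))))"

lemma truth_simps [simp]: "sat A e truth" "wf_fm S truth" "free_vars truth = {}"
  by (auto simp: truth_def)

definition conjs :: "('f, 'r) fm list \<Rightarrow> ('f, 'r) fm" where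
  "conjs \<phi>s = foldr Conj \<phi>s truth"

lemma conjs_simps [simp]:
  "sat A e (conjs \<phi>s) \<longleftrightarrow> (\<forall>\<phi>\<in>set \<phi>s. sat A e \<phi>)"
  "wf_fm S (conjs \<phi>s) \<longleftrightarrow> (\<forall>\<phi>\<in>set \<phi>s. wf_fm S \<phi>)"
  "free_vars (conjs \<phi>s) = (\<Union>\<phi>\<in>set \<phi>s. free_vars \<phi>)"
  by (induction \<phi>s) (auto simp: conjs_def)

definition exs :: "nat list \<Rightarrow> ('f, 'r) fm \<Rightarrow> ('f, 'r) fm" where
  "exs vs \<phi> = foldr Exists vs \<phi>"

lemma wf_exs [simp]: "wf_fm S (exs vs \<phi>) \<longleftrightarrow> wf_fm S \<phi>"
  by (induction vs) (auto simp: exs_def)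

lemma free_vars_exs [simp]: "free_vars (exs vs \<phi>) = free_vars \<phi> - set vs"
  by (induction vs) (auto simp: exs_def)

lemma sat_exs:
  "e \<in> assignments A \<Longrightarrow>
   sat A e (exs vs \<phi>) \<longleftrightarrow> (\<exists>e'\<in>assignments A. (\<forall>v. v \<notin> set vs \<longrightarrow> e' v = e v) \<and> sat A e' \<phi>)"
proof (induction vs arbitrary: e)
  case Nil
  have "e' = e" if "\<forall>v. e' v = e v" for e' using that by auto
  with Nil show ?case by (auto simp: exs_def)
next
  case (Cons u vs)
  have "sat A e (exs (u # vs) \<phi>) \<longleftrightarrow>
     (\<exists>a\<in>Dom A. \<exists>e'\<in>assignments A. (\<forall>v. v \<notin> set vs \<longrightarrow> e' v = (e(u := a)) v) \<and> sat A e' \<phi>)"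
  proof -
    have "e(u := a) \<in> assignments A" if "a \<in> Dom A" for a
      using Cons.prems that by auto
    then show ?thesis using Cons.IH by (simp add: exs_def)
  qed
  also have "\<dots> \<longleftrightarrow> (\<exists>e'\<in>assignments A. (\<forall>v. v \<notin> set (u # vs) \<longrightarrow> e' v = e v) \<and> sat A e' \<phi>)"
    (is "?L \<longleftrightarrow> ?R")
  proof
    assume ?R
    then obtain e' where e': "e' \<in> assignments A" "\<forall>v. v \<notin> set (u # vs) \<longrightarrow> e' v = e v" "sat A e' \<phi>"
      by blast
    have "e' u \<in> Dom A" using e'(1) by auto
    moreover have "\<forall>v. v \<notin> set vs \<longrightarrow> e' v = (e(u := e' u)) v" using e'(2) by auto
    ultimately show ?L using e'(1,3) by blast
  next
    assume ?L
    then obtain a e' where "e' \<in> assignments A" "\<forall>v. v \<notin> set vs \<longrightarrow> e' v = (e(u := a)) v" "sat A e' \<phi>"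
      by blast
    then show ?R by (intro bexI[of _ e']) auto
  qed
  finally show ?case .
qed

text \<open>The theory consists of sentences only; this passes to the universal closure.\<close>
lemma theorem_transfer:
  assumes "is_model S (Th S A) B" "wf_fm S \<phi>" "holds_in A \<phi>"
  shows "holds_in B \<phi>"
proof -
  obtain vs where vs: "set vs = free_vars \<phi>" using finite_list[OF finite_free_vars] by blast
  define \<psi> where "\<psi> = Neg (exs vs (Neg \<phi>))"
  have "holds_in A \<psi>"
    using assms(3) by (auto simp: holds_in_def \<psi>_def sat_exs)
  then have "\<psi> \<in> Th S A" using assms(2) vs by (auto simp: Th_def \<psi>_def)
  then have "holds_in B \<psi>" using assms(1) by (auto simp: is_model_def)
  then show ?thesis
    unfolding holds_in_def \<psi>_def
    by (metis (mono_tags, lifting) mem_Collect_eq sat_simps(3) sat_exs)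
qed

section \<open>Models from filters of assignments\<close>
instance tm :: (countable) countable by countable_datatype
instance fm :: (countable, countable) countable by countable_datatype

text \<open>
  The lemma of Rasiowa and Sikorski: below each condition there is one that satisfies the next
  requirement, and the conditions chosen along the way generate the filter.
\<close>
lemma filter_meeting_dense_sets:
  fixes C :: "'b set set"
  assumes "X0 \<in> C" and nonempty: "{} \<notin> C" and "countable \<D>"
    and dense: "\<And>D X. D \<in> \<D> \<Longrightarrow> X \<in> C \<Longrightarrow> \<exists>Y\<in>C. Y \<subseteq> X \<and> D Y"
  shows "\<exists>F. F \<noteq> bot \<and> (\<forall>P. eventually P F \<longrightarrow> (\<exists>X\<in>C. \<forall>x\<in>X. P x)) \<and>
    (\<forall>D\<in>\<D>. \<exists>X\<in>C. D X \<and> eventually (\<lambda>x. x \<in> X) F)"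
proof -
  define E where "E k = (if \<D> = {} then (\<lambda>X. True) else from_nat_into \<D> k)" for k
  have step: "\<exists>Y. Y \<in> C \<and> Y \<subseteq> X \<and> E k Y" if "X \<in> C" for X k
  proof (cases "\<D> = {}")
    case False
    then have "E k \<in> \<D>" by (simp add: E_def from_nat_into)
    then show ?thesis using dense[OF _ that] by blast
  qed (use that in \<open>auto simp: E_def\<close>)
  obtain Xs where Xs: "\<And>k. Xs k \<in> C" "\<And>k. Xs (Suc k) \<subseteq> Xs k \<and> E k (Xs (Suc k))"
    using dependent_nat_choice[where P = "\<lambda>_ X. X \<in> C" and Q = "\<lambda>k X Y. Y \<subseteq> X \<and> E k Y"]
      \<open>X0 \<in> C\<close> step by blast
  have anti: "Xs n \<subseteq> Xs m" if "m \<le> n" for m n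
    using Xs(2) by (intro lift_Suc_antimono_le[OF _ that]) auto
  define F where "F = (INF k. principal (Xs k))"
  have ev: "eventually P F \<longleftrightarrow> (\<exists>k. \<forall>x\<in>Xs k. P x)" for P
  proof -
    have "\<exists>k. principal (Xs k) \<le> inf (principal (Xs i)) (principal (Xs j))" for i j
      using anti[of i "max i j"] anti[of j "max i j"] by (intro exI[of _ "max i j"]) auto
    then show ?thesis
      unfolding F_def by (subst eventually_INF_base) (auto simp: eventually_principal)
  qed
  show ?thesis
  proof (intro exI[of _ F] conjI allI impI ballI)
    show "F \<noteq> bot"
    proof
      assume "F = bot"
      then obtain k where "Xs k = {}" using ev[of "\<lambda>_. False"] by auto
      then show False using nonempty Xs(1)[of k] by simp
    qed
    show "\<exists>X\<in>C. \<forall>x\<in>X. P x" if "eventually P F" for P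
      using that Xs(1) ev by blast
    show "\<exists>X\<in>C. D X \<and> eventually (\<lambda>x. x \<in> X) F" if "D \<in> \<D>" for D
    proof -
      obtain k where "from_nat_into \<D> k = D"
        using from_nat_into_surj[of \<D> D] \<open>countable \<D>\<close> \<open>D \<in> \<D>\<close> by blast
      then have "E k = D" using that by (auto simp: E_def)
      then have "D (Xs (Suc k))" using Xs(2)[of k] by simp
      moreover have "eventually (\<lambda>x. x \<in> Xs (Suc k)) F" using ev by blast
      ultimately show ?thesis using Xs(1) by blast
    qed
  qed
qed

text \<open>
  The assumptions \<open>decides\<close> and \<open>witness\<close> are what the inductive proof of Los's theorem
  needs for negation and for quantifiers, if the only elements of the reduced power that are
  kept are the classes of the coordinate functions \<open>\<lambda>e. e i\<close>.
\<close>
locale generic_filter =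
  fixes S :: "('f, 'r) signature" and A :: "('f, 'r, 'x) fo_struct" and F :: "(nat \<Rightarrow> 'x) filter"
  assumes struct: "is_struct S A"
    and nontrivial: "F \<noteq> bot"
    and on_assignments: "eventually (\<lambda>e. e \<in> assignments A) F"
    and decides: "wf_fm S \<phi> \<Longrightarrow>
      eventually (\<lambda>e. sat A e \<phi>) F \<or> eventually (\<lambda>e. \<not> sat A e \<phi>) F"
    and witness: "wf_fm S \<phi> \<Longrightarrow> eventually (\<lambda>e. sat A e (Exists v \<phi>)) F \<Longrightarrow>
      \<exists>w. eventually (\<lambda>e. sat A (e(v := e w)) \<phi>) F"
begin

lemma decides_not: "wf_fm S \<phi> \<Longrightarrow>
  (\<not> eventually (\<lambda>e. sat A (e \<circ> \<sigma>) \<phi>) F) \<longleftrightarrow> eventually (\<lambda>e. \<not> sat A (e \<circ> \<sigma>) \<phi>) F"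
proof -
  assume "wf_fm S \<phi>"
  from decides[OF wf_rename[OF this], of \<sigma>]
  have *: "eventually (\<lambda>e. sat A (e \<circ> \<sigma>) \<phi>) F \<or> eventually (\<lambda>e. \<not> sat A (e \<circ> \<sigma>) \<phi>) F"
    by (simp only: sat_rename)
  have False if "eventually (\<lambda>e. sat A (e \<circ> \<sigma>) \<phi>) F" "eventually (\<lambda>e. \<not> sat A (e \<circ> \<sigma>) \<phi>) F"
  proof -
    from that have "eventually (\<lambda>e. False) F" by eventually_elim blast
    then show False using nontrivial by simp
  qed
  with * show ?thesis by blast
qed

text \<open>
  The quantified variable is first replaced by a fresh one, because the value \<open>e w\<close> has to be plugged
  in for \<open>v\<close> only, and not for other variables that \<open>\<sigma>\<close> maps to the same place.
\<close>
lemma witness_renamed: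
  assumes "wf_fm S \<phi>" "eventually (\<lambda>e. sat A (e \<circ> \<sigma>) (Exists v \<phi>)) F"
  shows "\<exists>w. eventually (\<lambda>e. sat A (e \<circ> \<sigma>(v := w)) \<phi>) F"
proof -
  obtain u where u: "u \<notin> \<sigma> ` free_vars \<phi>"
    using finite_free_vars[of \<phi>] by (meson ex_new_if_finite finite_imageI infinite_UNIV_nat)
  have fresh: "sat A (e(u := a) \<circ> \<sigma>(v := u)) \<phi> \<longleftrightarrow> sat A ((e \<circ> \<sigma>)(v := a)) \<phi>" for e a
    using u by (intro sat_cong) auto
  then have "eventually (\<lambda>e. sat A e (Exists u (rename \<phi> (\<sigma>(v := u))))) F"
    using assms(2) by (simp add: sat_rename)
  then obtain w where "eventually (\<lambda>e. sat A (e(u := e w)) (rename \<phi> (\<sigma>(v := u)))) F"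
    using witness wf_rename assms(1) by blast
  moreover have "(e \<circ> \<sigma>)(v := e w) = e \<circ> \<sigma>(v := w)" for e :: "nat \<Rightarrow> 'x"
    by auto
  ultimately show ?thesis by (auto simp: sat_rename fresh)
qed

text \<open>
  The coordinate functions are represented by their numbers, and a class of coordinates that agree
  along the filter by its least element. This keeps the domain inside \<^typ>\<open>nat\<close>.
\<close>
definition rep :: "nat \<Rightarrow> nat" where
  "rep i = (LEAST j. eventually (\<lambda>e. e j = e i) F)"

definition gen_model :: "('f, 'r, nat) fo_struct" where
  "gen_model = \<lparr>Dom = range rep,
     fun_int = (\<lambda>(f, n) xs. rep (SOME w. eventually (\<lambda>e. e w = fun_int A (f, n) (map e xs)) F)),
     rel_int = (\<lambda>(r, n). {xs. eventually (\<lambda>e. map e xs \<in> rel_int A (r, n)) F})\<rparr>"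

lemma rep: "eventually (\<lambda>e. e (rep i) = e i) F"
  unfolding rep_def by (rule LeastI[of _ i]) simp

lemma rep_eq_iff: "rep i = rep j \<longleftrightarrow> eventually (\<lambda>e. e i = e j) F"
proof
  assume "rep i = rep j"
  then show "eventually (\<lambda>e. e i = e j) F"
    using eventually_conj[OF rep[of i] rep[of j]] by (auto elim: eventually_mono)
next
  assume "eventually (\<lambda>e. e i = e j) F"
  then have "eventually (\<lambda>e. e k = e i) F \<longleftrightarrow> eventually (\<lambda>e. e k = e j) F" for k
    by (intro eventually_subst) (auto elim: eventually_mono)
  then show "rep i = rep j" by (simp add: rep_def)
qed

lemma rep_rep [simp]: "rep (rep i) = rep i"
  by (simp add: rep_eq_iff rep)

lemma Dom_gen_model: "Dom gen_model = range rep"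
  by (simp add: gen_model_def)

lemma eventually_all_list:
  "(\<And>x. x \<in> set xs \<Longrightarrow> eventually (P x) F) \<Longrightarrow> eventually (\<lambda>e. \<forall>x\<in>set xs. P x e) F"
  by (rule eventually_ball_finite) auto

text \<open>
  The domain is closed under functions since \<open>f(xs)\<close> is a witness for \<open>\<exists>v. v = f(xs)\<close>.
\<close>
lemma fun_gen_model:
  assumes "(f, length xs) \<in> funs S"
  shows "eventually (\<lambda>e. e (fun_int gen_model (f, length xs) xs) =
    fun_int A (f, length xs) (map e xs)) F"
proof -
  obtain v where v: "v \<notin> set xs" by (meson ex_new_if_finite infinite_UNIV_nat List.finite_set)
  define \<phi> :: "('f, 'r) fm" where "\<phi> = Eq (Var v) (Fun f (map Var xs))"
  have tms: "map (tm_val A (e(v := a)) \<circ> Var) xs = map e xs" for e a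
    using v by auto
  have wf: "wf_fm S \<phi>" using assms by (auto simp: \<phi>_def list_all_iff)
  have "sat A e (Exists v \<phi>)" if "e \<in> assignments A" for e
  proof -
    have "set (map e xs) \<subseteq> Dom A" using that by auto
    with assms is_structD[OF struct, of f "map e xs"]
    have "fun_int A (f, length xs) (map e xs) \<in> Dom A" by simp
    then show ?thesis by (simp add: \<phi>_def tms)
  qed
  then have "eventually (\<lambda>e. sat A e (Exists v \<phi>)) F"
    using on_assignments by (rule eventually_mono[rotated])
  from witness[OF wf this] obtain w where
    "eventually (\<lambda>e. e w = fun_int A (f, length xs) (map e xs)) F"
    by (auto simp: \<phi>_def tms)
  then have "eventually (\<lambda>e. e (SOME w. eventually (\<lambda>e. e w = fun_int A (f, length xs) (map e xs)) F)
     = fun_int A (f, length xs) (map e xs)) F" (is "eventually (\<lambda>e. e ?w = _) F")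
    by (rule someI)
  then show ?thesis
    using rep[of ?w] by eventually_elim (simp add: gen_model_def)
qed

lemma is_struct_gen_model: "is_struct S gen_model"
  by (auto simp: is_struct_def gen_model_def)

lemma tm_val_gen_model:
  "wf_tm S t \<Longrightarrow> eventually (\<lambda>e. e (tm_val gen_model (rep \<circ> \<sigma>) t) = tm_val A (e \<circ> \<sigma>) t) F"
proof (induction t)
  case (Var v)
  then show ?case using rep by simp
next
  case (Fun f ts)
  let ?xs = "map (tm_val gen_model (rep \<circ> \<sigma>)) ts"
  have "eventually (\<lambda>e. \<forall>t\<in>set ts. e (tm_val gen_model (rep \<circ> \<sigma>) t) = tm_val A (e \<circ> \<sigma>) t) F"
    using Fun.prems by (intro eventually_all_list Fun.IH) (auto simp: list_all_iff)
  moreover have "eventually (\<lambda>e. e (fun_int gen_model (f, length ?xs) ?xs) =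
      fun_int A (f, length ?xs) (map e ?xs)) F"
    using Fun.prems by (intro fun_gen_model) simp
  ultimately show ?case
  proof eventually_elim
    case (elim e)
    then have "map e ?xs = map (tm_val A (e \<circ> \<sigma>)) ts" by auto
    with elim(2) show ?case by (simp only: tm_val_simps length_map)
  qed
qed

lemma rep_assignment: "rep \<circ> \<sigma> \<in> assignments gen_model"
  by (auto simp: Dom_gen_model)

text \<open>Los's theorem for the substructure of coordinate functions.\<close>
lemma sat_gen_model:
  "wf_fm S \<phi> \<Longrightarrow> sat gen_model (rep \<circ> \<sigma>) \<phi> \<longleftrightarrow> eventually (\<lambda>e. sat A (e \<circ> \<sigma>) \<phi>) F"
proof (induction \<phi> arbitrary: \<sigma>)
  case (Eq s t)
  let ?v = "tm_val gen_model (rep \<circ> \<sigma>)"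
  have "?v s \<in> range rep" "?v t \<in> range rep"
    using tm_val_in_Dom[OF is_struct_gen_model rep_assignment[of \<sigma>]] Eq
    by (auto simp: Dom_gen_model)
  then have "rep (?v s) = ?v s" "rep (?v t) = ?v t" by auto
  then have "?v s = ?v t \<longleftrightarrow> eventually (\<lambda>e. e (?v s) = e (?v t)) F"
    using rep_eq_iff[of "?v s" "?v t"] by simp
  also have "\<dots> \<longleftrightarrow> eventually (\<lambda>e. tm_val A (e \<circ> \<sigma>) s = tm_val A (e \<circ> \<sigma>) t) F"
  proof (rule eventually_subst)
    show "\<forall>\<^sub>F e in F. (e (?v s) = e (?v t)) = (tm_val A (e \<circ> \<sigma>) s = tm_val A (e \<circ> \<sigma>) t)"
      using tm_val_gen_model[of s \<sigma>] tm_val_gen_model[of t \<sigma>] Eq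
      by (auto elim: eventually_elim2)
  qed
  finally show ?case by (simp only: sat_simps)
next
  case (Rel r ts)
  let ?v = "tm_val gen_model (rep \<circ> \<sigma>)"
  have "eventually (\<lambda>e. \<forall>t\<in>set ts. e (?v t) = tm_val A (e \<circ> \<sigma>) t) F"
    using Rel by (intro eventually_all_list tm_val_gen_model) (auto simp: list_all_iff)
  then have "\<forall>\<^sub>F e in F. map e (map ?v ts) = map (tm_val A (e \<circ> \<sigma>)) ts"
    by eventually_elim auto
  then have "eventually (\<lambda>e. map e (map ?v ts) \<in> rel_int A (r, length ts)) F \<longleftrightarrow>
      eventually (\<lambda>e. map (tm_val A (e \<circ> \<sigma>)) ts \<in> rel_int A (r, length ts)) F"
    by (intro eventually_subst) (auto elim!: eventually_mono simp del: map_map)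
  then show ?case
    by (simp only: sat_simps gen_model_def fo_struct.simps prod.case mem_Collect_eq length_map)
next
  case (Neg \<phi>)
  then show ?case using decides_not[of \<phi> \<sigma>] by (simp only: sat_simps wf_fm.simps simp_thms)
next
  case (Conj \<phi> \<psi>)
  then show ?case by (simp add: eventually_conj_iff)
next
  case (Exists v \<phi>)
  have upd: "(rep \<circ> \<sigma>)(v := rep w) = rep \<circ> \<sigma>(v := w)" for w by auto
  have "sat gen_model (rep \<circ> \<sigma>) (Exists v \<phi>) \<longleftrightarrow>
      (\<exists>w. eventually (\<lambda>e. sat A (e \<circ> \<sigma>(v := w)) \<phi>) F)"
    using Exists.IH Exists.prems
    by (simp only: sat_simps wf_fm.simps Dom_gen_model bex_simps upd simp_thms)
  also have "\<dots> \<longleftrightarrow> eventually (\<lambda>e. sat A (e \<circ> \<sigma>) (Exists v \<phi>)) F"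
  proof
    assume "\<exists>w. eventually (\<lambda>e. sat A (e \<circ> \<sigma>(v := w)) \<phi>) F"
    then obtain w where "eventually (\<lambda>e. sat A (e \<circ> \<sigma>(v := w)) \<phi>) F" ..
    then show "eventually (\<lambda>e. sat A (e \<circ> \<sigma>) (Exists v \<phi>)) F"
      using on_assignments
    proof eventually_elim
      case (elim e)
      have "(e \<circ> \<sigma>)(v := e w) = e \<circ> \<sigma>(v := w)" by auto
      then show ?case using elim by (auto intro!: bexI[of _ "e w"])
    qed
  qed (use witness_renamed[of \<phi> \<sigma> v] Exists.prems in simp)
  finally show ?case .
qed

lemma is_model_gen_model: "is_model S (Th S A) gen_model"
proof -
  have "holds_in gen_model \<phi>" if "\<phi> \<in> Th S A" for \<phi>
    unfolding holds_in_def
  proof safe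
    fix e :: "nat \<Rightarrow> nat" assume "range e \<subseteq> Dom gen_model"
    have "rep (e j) = e j" for j
    proof -
      have "e j \<in> range rep" using \<open>range e \<subseteq> Dom gen_model\<close> by (auto simp: Dom_gen_model)
      then show ?thesis by (metis rangeE rep_rep)
    qed
    then have "rep \<circ> e = e" by auto
    have "sat A (e' \<circ> e) \<phi>" if "e' \<in> assignments A" for e'
    proof -
      have "range (e' \<circ> e) \<subseteq> Dom A" using that by auto
      then show ?thesis using \<open>\<phi> \<in> Th S A\<close> unfolding Th_def holds_in_def by blast
    qed
    with on_assignments have "\<forall>\<^sub>F e' in F. sat A (e' \<circ> e) \<phi>" by (rule eventually_mono)
    then show "sat gen_model e \<phi>"
      using sat_gen_model[of \<phi> e] that \<open>rep \<circ> e = e\<close> by (auto simp: Th_def)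
  qed
  then show ?thesis by (simp add: is_model_def is_struct_gen_model)
qed

text \<open>Along the filter, finitely many coordinates never exhaust the infinite set \<open>Dom A\<close>, so the
  witness property yields another class.\<close>
lemma infinite_gen_model:
  assumes "infinite (Dom A)"
  shows "infinite (Dom gen_model)"
proof
  assume "finite (Dom gen_model)"
  then obtain xs where xs: "set xs = Dom gen_model" using finite_list by blast
  obtain v where v: "v \<notin> set xs" by (meson ex_new_if_finite infinite_UNIV_nat List.finite_set)
  define \<phi> :: "('f, 'r) fm" where "\<phi> = conjs (map (\<lambda>x. Neg (Eq (Var v) (Var x))) xs)"
  have "sat A e (Exists v \<phi>)" for e
  proof -
    obtain a where "a \<in> Dom A" "a \<notin> e ` set xs"
      using assms by (meson List.finite_set finite_imageI finite_subset subsetI)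
    then show ?thesis using v by (auto simp: \<phi>_def)
  qed
  then obtain w where "eventually (\<lambda>e. sat A (e(v := e w)) \<phi>) F"
    using witness[of \<phi> v] by (auto simp: \<phi>_def)
  moreover have "rep w \<in> set xs" using xs by (auto simp: Dom_gen_model)
  moreover have "e (rep w) \<noteq> e w" if "sat A (e(v := e w)) \<phi>" for e
  proof -
    have "e w \<noteq> (e(v := e w)) (rep w)" using that \<open>rep w \<in> set xs\<close> by (auto simp: \<phi>_def)
    moreover have "rep w \<noteq> v" using \<open>rep w \<in> set xs\<close> v by auto
    ultimately show ?thesis by auto
  qed
  ultimately have "eventually (\<lambda>e. e (rep w) \<noteq> e w) F" by (auto elim: eventually_mono)
  with rep[of w] have "eventually (\<lambda>e. False) F" by eventually_elim simp
  with nontrivial show False by simp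
qed

end

text \<open>
  There are only countably many formulas, so deciding them and providing witnesses amounts to
  countably many requirements. They are dense if the system of conditions \<open>C\<close> is rich
  enough, and further requirements \<open>\<D>\<close> can be met at the same time. The members of \<open>C\<close> are what
  remains known about the filter, see the second part of the conclusion.
\<close>
lemma generic_filter_exists:
  fixes S :: "('f :: countable, 'r :: countable) signature" and A :: "('f, 'r, 'x) fo_struct"
  assumes "is_struct S A" "X0 \<in> C"
    and C: "\<And>X. X \<in> C \<Longrightarrow> X \<noteq> {} \<and> X \<subseteq> assignments A"
    and decide: "\<And>X \<phi>. X \<in> C \<Longrightarrow> wf_fm S \<phi> \<Longrightarrow>
      {e\<in>X. sat A e \<phi>} \<in> C \<or> {e\<in>X. \<not> sat A e \<phi>} \<in> C"
    and wit: "\<And>X \<phi> v. X \<in> C \<Longrightarrow> wf_fm S \<phi> \<Longrightarrow> \<forall>e\<in>X. sat A e (Exists v \<phi>) \<Longrightarrow>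
      \<exists>w. {e\<in>X. sat A (e(v := e w)) \<phi>} \<in> C"
    and "countable \<D>" and dense: "\<And>D X. D \<in> \<D> \<Longrightarrow> X \<in> C \<Longrightarrow> \<exists>Y\<in>C. Y \<subseteq> X \<and> D Y"
  shows "\<exists>F. generic_filter S A F \<and> (\<forall>P. eventually P F \<longrightarrow> (\<exists>X\<in>C. \<forall>e\<in>X. P e)) \<and>
    (\<forall>D\<in>\<D>. \<exists>X\<in>C. D X \<and> eventually (\<lambda>e. e \<in> X) F)"
proof -
  define D1 where "D1 \<phi> X \<longleftrightarrow> (\<forall>e\<in>X. sat A e \<phi>) \<or> (\<forall>e\<in>X. \<not> sat A e \<phi>)" for \<phi> X
  define D2 where "D2 = (\<lambda>(v, \<phi>) X. (\<exists>w. \<forall>e\<in>X. sat A (e(v := e w)) \<phi>) \<or>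
    (\<forall>e\<in>X. \<not> sat A e (Exists v \<phi>)))"
  let ?\<D> = "D1 ` {\<phi>. wf_fm S \<phi>} \<union> D2 ` {(v, \<phi>). wf_fm S \<phi>} \<union> \<D>"
  have "{} \<notin> C" using C by blast
  have "countable ?\<D>" using \<open>countable \<D>\<close> by auto
  have dense': "\<exists>Y\<in>C. Y \<subseteq> X \<and> D Y" if "D \<in> ?\<D>" "X \<in> C" for D X
  proof -
    consider \<phi> where "wf_fm S \<phi>" "D = D1 \<phi>" | v \<phi> where "wf_fm S \<phi>" "D = D2 (v, \<phi>)" | "D \<in> \<D>"
      using \<open>D \<in> ?\<D>\<close> by auto
    then show ?thesis
    proof cases
      case 1
      from decide[OF \<open>X \<in> C\<close> 1(1)] obtain Y where "Y \<in> C" "Y \<subseteq> X" "D1 \<phi> Y"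
        unfolding D1_def by fast
      then show ?thesis using 1(2) by blast
    next
      case 2
      have "wf_fm S (Exists v \<phi>)" using 2 by simp
      from decide[OF \<open>X \<in> C\<close> this] consider "{e\<in>X. \<not> sat A e (Exists v \<phi>)} \<in> C" |
        "{e\<in>X. sat A e (Exists v \<phi>)} \<in> C" by blast
      then show ?thesis
      proof cases
        case 1
        then show ?thesis using 2 by (intro bexI) (auto simp: D2_def)
      next
        case X: 2
        obtain w where "{e\<in>{e\<in>X. sat A e (Exists v \<phi>)}. sat A (e(v := e w)) \<phi>} \<in> C"
          using wit[OF X 2(1), of v] by auto
        then show ?thesis using 2 by (intro bexI) (auto simp: D2_def)
      qed
    next
      case 3
      then show ?thesis using dense \<open>X \<in> C\<close> by blast
    qed
  qed
  have "\<exists>F. F \<noteq> bot \<and> (\<forall>P. eventually P F \<longrightarrow> (\<exists>X\<in>C. \<forall>x\<in>X. P x)) \<and>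
    (\<forall>D\<in>?\<D>. \<exists>X\<in>C. D X \<and> eventually (\<lambda>x. x \<in> X) F)"
    by (rule filter_meeting_dense_sets[OF \<open>X0 \<in> C\<close> \<open>{} \<notin> C\<close> \<open>countable ?\<D>\<close> dense'])
  then obtain F where F: "F \<noteq> bot" "\<forall>P. eventually P F \<longrightarrow> (\<exists>X\<in>C. \<forall>x\<in>X. P x)"
    "\<forall>D\<in>?\<D>. \<exists>X\<in>C. D X \<and> eventually (\<lambda>x. x \<in> X) F" by (elim exE conjE)
  have "generic_filter S A F"
  proof
    show "eventually (\<lambda>e. e \<in> assignments A) F"
    proof -
      have "D1 truth \<in> ?\<D>" by simp
      then obtain X where "X \<in> C" "eventually (\<lambda>x. x \<in> X) F" using F(3) by metis
      then show ?thesis using C by (auto elim!: eventually_mono)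
    qed
    show "eventually (\<lambda>e. sat A e \<phi>) F \<or> eventually (\<lambda>e. \<not> sat A e \<phi>) F" if "wf_fm S \<phi>" for \<phi>
    proof -
      have "D1 \<phi> \<in> ?\<D>" using that by simp
      then obtain X where "D1 \<phi> X" "eventually (\<lambda>x. x \<in> X) F" using F(3) by metis
      then show ?thesis
        using eventually_mono[of "\<lambda>x. x \<in> X" F "\<lambda>e. sat A e \<phi>"]
          eventually_mono[of "\<lambda>x. x \<in> X" F "\<lambda>e. \<not> sat A e \<phi>"] unfolding D1_def by blast
    qed
    show "\<exists>w. eventually (\<lambda>e. sat A (e(v := e w)) \<phi>) F"
      if "wf_fm S \<phi>" "eventually (\<lambda>e. sat A e (Exists v \<phi>)) F" for \<phi> v
    proof -
      have "D2 (v, \<phi>) \<in> ?\<D>" using that(1) by simp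
      then obtain X where X: "D2 (v, \<phi>) X" "eventually (\<lambda>x. x \<in> X) F" using F(3) by metis
      have "\<not> (\<forall>e\<in>X. \<not> sat A e (Exists v \<phi>))"
      proof
        assume none: "\<forall>e\<in>X. \<not> sat A e (Exists v \<phi>)"
        have "eventually (\<lambda>e. False) F"
          using that(2) X(2) by eventually_elim (use none in blast)
        then show False using F(1) by simp
      qed
      then obtain w where "\<forall>e\<in>X. sat A (e(v := e w)) \<phi>" using X(1) by (auto simp: D2_def)
      with X(2) have "eventually (\<lambda>e. sat A (e(v := e w)) \<phi>) F"
        using eventually_mono[of "\<lambda>x. x \<in> X" F "\<lambda>e. sat A (e(v := e w)) \<phi>"] by blast
      then show ?thesis by blast
    qed
  qed (fact assms(1) F(1))+
  then show ?thesis using F(2,3) by (intro exI[of _ F] conjI) simp_all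
qed

section \<open>Omega-categorical structures have finitely many types\<close>

text \<open>The complete type of the first \<open>n\<close> values of an assignment.\<close>
definition tuple_type :: "('f, 'r) signature \<Rightarrow> ('f, 'r, 'x) fo_struct \<Rightarrow> nat \<Rightarrow> (nat \<Rightarrow> 'x) \<Rightarrow> ('f, 'r) fm set"
  where "tuple_type S A n e = {\<phi>. wf_fm S \<phi> \<and> free_vars \<phi> \<subseteq> {..<n} \<and> sat A e \<phi>}"

lemma tuple_type_cong:
  assumes "\<And>i. i < n \<Longrightarrow> e i = e' i"
  shows "tuple_type S A n e = tuple_type S A n e'"
proof -
  have "sat A e \<phi> \<longleftrightarrow> sat A e' \<phi>" if "free_vars \<phi> \<subseteq> {..<n}" for \<phi>
    using that assms by (intro sat_cong) auto
  then show ?thesis by (auto simp: tuple_type_def)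
qed

text \<open>Types are closed under taking one of \<open>\<phi>\<close> and \<open>\<not> \<phi>\<close>, so none is properly contained in another.\<close>
lemma tuple_type_separate:
  assumes "tuple_type S A n e \<noteq> tuple_type S A n e'"
  obtains \<eta> where "\<eta> \<in> tuple_type S A n e" "\<eta> \<notin> tuple_type S A n e'"
proof -
  consider "\<not> tuple_type S A n e \<subseteq> tuple_type S A n e'" | \<eta> where "\<eta> \<in> tuple_type S A n e'" "\<eta> \<notin> tuple_type S A n e"
    using assms by blast
  then show thesis
  proof cases
    case 1
    then show thesis using that by blast
  next
    case 2
    then have "Neg \<eta> \<in> tuple_type S A n e" "Neg \<eta> \<notin> tuple_type S A n e'" by (auto simp: tuple_type_def)
    then show thesis using that by blast
  qed
qed

definition definable_sets :: "('f, 'r) signature \<Rightarrow> ('f, 'r, 'x) fo_struct \<Rightarrow> (nat \<Rightarrow> 'x) set set"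
  where "definable_sets S A = {{e\<in>assignments A. sat A e \<phi>} | \<phi>. wf_fm S \<phi>}"

lemma definable_sets_subset: "X \<in> definable_sets S A \<Longrightarrow> X \<subseteq> assignments A"
  by (auto simp: definable_sets_def)

lemma definable_sets_Int:
  assumes "X \<in> definable_sets S A" "wf_fm S \<phi>"
  shows "{e\<in>X. sat A e \<phi>} \<in> definable_sets S A"
proof -
  obtain \<psi> where "wf_fm S \<psi>" "X = {e\<in>assignments A. sat A e \<psi>}"
    using assms(1) by (auto simp: definable_sets_def)
  then have "wf_fm S (Conj \<psi> \<phi>)" "{e\<in>X. sat A e \<phi>} = {e\<in>assignments A. sat A e (Conj \<psi> \<phi>)}"
    using assms(2) by auto
  then show ?thesis unfolding definable_sets_def by blast
qed

lemma definable_sets_diff: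
  assumes "X \<in> definable_sets S A" "wf_fm S \<phi>"
  shows "{e\<in>X. \<not> sat A e \<phi>} \<in> definable_sets S A"
  using definable_sets_Int[OF assms(1), of "Neg \<phi>"] assms(2) by simp

lemma definable_sets_UNIV: "assignments A \<in> definable_sets S A"
proof -
  have "assignments A = {e\<in>assignments A. sat A e truth}" "wf_fm S truth" by auto
  then show ?thesis unfolding definable_sets_def by blast
qed

text \<open>
  The witness is stored in a variable \<open>w\<close> that is fresh for everything in sight, including the first
  \<open>n\<close> variables. Therefore the restriction to assignments with \<open>e w\<close> as a witness loses no type of an
  \<open>n\<close>-tuple.
\<close>
lemma definable_witness:
  fixes A :: "('f, 'r, 'x) fo_struct"
  assumes "X \<in> definable_sets S A" "wf_fm S \<phi>" "\<forall>e\<in>X. sat A e (Exists v \<phi>)"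
  obtains w where "{e\<in>X. sat A (e(v := e w)) \<phi>} \<in> definable_sets S A"
    "tuple_type S A n ` X \<subseteq> tuple_type S A n ` {e\<in>X. sat A (e(v := e w)) \<phi>}"
proof -
  obtain \<psi> where \<psi>: "wf_fm S \<psi>" "X = {e\<in>assignments A. sat A e \<psi>}"
    using assms(1) by (auto simp: definable_sets_def)
  have "finite (free_vars \<psi> \<union> free_vars \<phi> \<union> {v} \<union> {..<n})" by (simp add: finite_free_vars)
  then obtain w where w: "w \<notin> free_vars \<psi>" "w \<notin> free_vars \<phi>" "w \<noteq> v" "w \<ge> n"
    by (metis UnI1 UnI2 ex_new_if_finite infinite_UNIV_nat insertI1 lessThan_iff not_less)
  have upd: "e \<circ> id(v := w) = e(v := e w)" for e :: "nat \<Rightarrow> 'x" by auto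
  \<comment> \<open>The assignments with \<open>e w\<close> as a witness are definable by a renamed formula.\<close>
  have "{e\<in>X. sat A (e(v := e w)) \<phi>} = {e\<in>X. sat A e (rename \<phi> (id(v := w)))}"
    by (simp only: sat_rename upd)
  then have "{e\<in>X. sat A (e(v := e w)) \<phi>} \<in> definable_sets S A"
    using definable_sets_Int[OF assms(1) wf_rename[OF assms(2)]] by simp
  moreover have "tuple_type S A n e \<in> tuple_type S A n ` {e\<in>X. sat A (e(v := e w)) \<phi>}" if "e \<in> X" for e
  proof -
    from assms(3) that obtain a where a: "a \<in> Dom A" "sat A (e(v := a)) \<phi>" by auto
    have "sat A (e(w := a)) \<psi> \<longleftrightarrow> sat A e \<psi>" using w by (intro sat_cong) auto
    moreover have "sat A ((e(w := a))(v := (e(w := a)) w)) \<phi> \<longleftrightarrow> sat A (e(v := a)) \<phi>"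
      using w by (intro sat_cong) auto
    ultimately have "e(w := a) \<in> {e\<in>X. sat A (e(v := e w)) \<phi>}"
      using a that \<psi>(2) by auto
    moreover have "tuple_type S A n (e(w := a)) = tuple_type S A n e" using w by (intro tuple_type_cong) auto
    ultimately show ?thesis by (metis (no_types, lifting) image_eqI)
  qed
  ultimately show thesis using that by blast
qed

text \<open>
  Projection of a definable set to the coordinates \<open>s 0, \<dots>, s (n - 1)\<close>, which need not be
  distinct. All variables of \<open>\<phi>\<close> are shifted by \<open>n\<close> to make room for the result, then
  identified with the result as prescribed by \<open>s\<close>, and finally quantified away.
\<close>
lemma tuple_projection:
  fixes A :: "('f, 'r, 'x) fo_struct" and s :: "nat \<Rightarrow> nat"
  assumes "wf_fm S \<phi>"
  obtains \<psi> where "wf_fm S \<psi>" "free_vars \<psi> \<subseteq> {..<n}"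
    "\<And>b. b \<in> assignments A \<Longrightarrow>
      sat A b \<psi> \<longleftrightarrow> (\<exists>e\<in>assignments A. sat A e \<phi> \<and> (\<forall>j<n. e (s j) = b j))"
proof -
  define N where "N = Suc (Max (free_vars \<phi> \<union> s ` {..<n} \<union> {0}))"
  have N: "k < N" if "k \<in> free_vars \<phi> \<union> s ` {..<n}" for k
    using that unfolding N_def less_Suc_eq_le
    by (intro Max_ge) (auto simp: finite_free_vars)
  define \<theta> where "\<theta> = conjs (rename \<phi> ((+) n) # map (\<lambda>j. Eq (Var j) (Var (n + s j))) [0..<n])"
  define \<psi> where "\<psi> = exs [n..<n + N] \<theta>"
  have \<theta>: "sat A e \<theta> \<longleftrightarrow> sat A (\<lambda>k. e (n + k)) \<phi> \<and> (\<forall>j<n. e j = e (n + s j))" for e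
    by (auto simp: \<theta>_def sat_rename o_def)
  show thesis
  proof
    show "wf_fm S \<psi>" using assms by (auto simp: \<psi>_def \<theta>_def wf_rename)
    have "free_vars \<theta> \<subseteq> (+) n ` free_vars \<phi> \<union> {..<n} \<union> (\<lambda>j. n + s j) ` {..<n}"
      using free_vars_rename[of \<phi> "(+) n"] by (auto simp: \<theta>_def)
    then show "free_vars \<psi> \<subseteq> {..<n}"
      using N by (force simp: \<psi>_def)
    fix b assume b: "b \<in> assignments A"
    show "sat A b \<psi> \<longleftrightarrow> (\<exists>e\<in>assignments A. sat A e \<phi> \<and> (\<forall>j<n. e (s j) = b j))"
    proof
      assume "sat A b \<psi>"
      then obtain e where e: "e \<in> assignments A" "\<forall>v. v \<notin> {n..<n+N} \<longrightarrow> e v = b v" "sat A e \<theta>"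
        using b by (auto simp: \<psi>_def sat_exs)
      then have "(\<lambda>k. e (n + k)) \<in> assignments A" "\<forall>j<n. e (n + s j) = b j" by (auto simp: \<theta>)
      then show "\<exists>e\<in>assignments A. sat A e \<phi> \<and> (\<forall>j<n. e (s j) = b j)"
        using e(3) by (intro bexI[of _ "\<lambda>k. e (n + k)"]) (auto simp: \<theta>)
    next
      assume "\<exists>e\<in>assignments A. sat A e \<phi> \<and> (\<forall>j<n. e (s j) = b j)"
      then obtain e where e: "e \<in> assignments A" "sat A e \<phi>" "\<forall>j<n. e (s j) = b j" by blast
      define e' where "e' v = (if v \<in> {n..<n+N} then e (v - n) else b v)" for v
      have "e' \<in> assignments A" using e(1) b by (auto simp: e'_def)
      moreover have "sat A (\<lambda>k. e' (n + k)) \<phi> \<longleftrightarrow> sat A e \<phi>"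
        using N by (intro sat_cong) (auto simp: e'_def)
      moreover have "e' j = e' (n + s j)" if "j < n" for j
        using N that e(3) by (auto simp: e'_def)
      moreover have "\<forall>v. v \<notin> set [n..<n + N] \<longrightarrow> e' v = b v" by (simp add: e'_def)
      ultimately show "sat A b \<psi>"
        using e(2) unfolding \<psi>_def sat_exs[OF b] \<theta> by blast
    qed
  qed
qed

lemma omega_categorical_iso:
  fixes A B :: "(nat, nat, nat) fo_struct"
  assumes "countable_structure S A" "omega_categorical S A"
    and "is_struct S B" "infinite (Dom B)" "is_model S (Th S A) B"
  shows "\<exists>h. struct_iso S A B h" "\<exists>h. struct_iso S B A h"
proof -
  have "countable_structure S B"
    using assms(3,4) by (simp add: countable_structure_def denumerable_def)
  moreover have "is_model S (Th S A) A"
    using assms(1) by (auto simp: is_model_def Th_def countable_structure_def)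
  ultimately show "\<exists>h. struct_iso S A B h" "\<exists>h. struct_iso S B A h"
    using assms(1,2,5) unfolding omega_categorical_def by blast+
qed

text \<open>
  Omitting types. Suppose that no formula isolates the type of \<open>a\<close>. A condition \<open>X\<close> and a choice \<open>s\<close> of
  \<open>n\<close> coordinates project to a definable set of \<open>n\<close>-tuples; unless it excludes \<open>a\<close>, it
  contains some \<open>b\<close> of another type, and \<open>X\<close> can be shrunk so that its \<open>s\<close>-coordinates violate a formula
  true of \<open>a\<close>. In the resulting model no tuple has the type of \<open>a\<close>, so it is not isomorphic to \<open>A\<close>.
\<close>
lemma types_isolated:
  assumes "countable_structure S A" "omega_categorical S A" "a \<in> assignments A"
  obtains \<phi> where "\<phi> \<in> tuple_type S A n a"
    "\<And>b. b \<in> assignments A \<Longrightarrow> \<phi> \<in> tuple_type S A n b \<Longrightarrow> tuple_type S A n b = tuple_type S A n a"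
proof (rule ccontr)
  assume "\<not> thesis"
  with that have not_isolated: "\<exists>b\<in>assignments A. \<phi> \<in> tuple_type S A n b \<and> tuple_type S A n b \<noteq> tuple_type S A n a"
    if "\<phi> \<in> tuple_type S A n a" for \<phi>
    using \<open>\<phi> \<in> tuple_type S A n a\<close> by blast
  have A: "is_struct S A" "infinite (Dom A)"
    using assms(1) by (auto simp: countable_structure_def denumerable_def)
  define C where "C = definable_sets S A - {{}}"
  \<comment> \<open>Only the values of \<open>s\<close> below \<open>n\<close> matter; coding them by lists leaves countably many requirements.\<close>
  define s where "s xs j = (if j < n then xs ! j else 0)" for xs :: "nat list" and j
  define D where "D xs X \<longleftrightarrow> (\<exists>\<eta>\<in>tuple_type S A n a. \<forall>e\<in>X. \<not> sat A (e \<circ> s xs) \<eta>)" for xs X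
  have dense: "\<exists>Y\<in>C. Y \<subseteq> X \<and> D xs Y" if "X \<in> C" for xs X
  proof -
    have X: "X \<in> definable_sets S A" "X \<noteq> {}" using that by (auto simp: C_def)
    then obtain \<phi> where \<phi>: "wf_fm S \<phi>" "X = {e\<in>assignments A. sat A e \<phi>}"
      by (auto simp: definable_sets_def)
    obtain \<psi> where \<psi>: "wf_fm S \<psi>" "free_vars \<psi> \<subseteq> {..<n}"
      "\<And>b. b \<in> assignments A \<Longrightarrow> sat A b \<psi> \<longleftrightarrow> (\<exists>e\<in>X. \<forall>j<n. e (s xs j) = b j)"
      using tuple_projection[OF \<phi>(1), of n A "s xs"] \<phi>(2)
      by (smt (verit, del_insts) mem_Collect_eq)
    show ?thesis
    proof (cases "sat A a \<psi>")
      case False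
      have "sat A (e \<circ> s xs) \<psi>" if "e \<in> X" for e
      proof -
        have "e \<circ> s xs \<in> assignments A" using that \<phi>(2) by auto
        with that \<psi>(3) show ?thesis by auto
      qed
      moreover have "Neg \<psi> \<in> tuple_type S A n a" using False \<psi> by (simp add: tuple_type_def)
      ultimately have "D xs X" unfolding D_def by (intro bexI) auto
      then show ?thesis using that by blast
    next
      case True
      then have "\<psi> \<in> tuple_type S A n a" using \<psi> by (simp add: tuple_type_def)
      then obtain b where b: "b \<in> assignments A" "\<psi> \<in> tuple_type S A n b" "tuple_type S A n a \<noteq> tuple_type S A n b"
        using not_isolated by metis
      obtain \<eta> where \<eta>: "\<eta> \<in> tuple_type S A n a" "\<eta> \<notin> tuple_type S A n b" by (rule tuple_type_separate[OF b(3)])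
      then have wf: "wf_fm S \<eta>" "free_vars \<eta> \<subseteq> {..<n}" "\<not> sat A b \<eta>" by (auto simp: tuple_type_def)
      obtain e where e: "e \<in> X" "\<forall>j<n. e (s xs j) = b j"
        using b(1,2) \<psi>(3)[of b] by (auto simp: tuple_type_def)
      have "sat A (e \<circ> s xs) \<eta> \<longleftrightarrow> sat A b \<eta>" using e(2) wf(2) by (intro sat_cong) auto
      then have "e \<in> {e\<in>X. \<not> sat A e (rename \<eta> (s xs))}" (is "_ \<in> ?Y")
        using wf e(1) by (simp only: sat_rename) blast
      moreover have "?Y \<in> definable_sets S A"
        by (intro definable_sets_diff X(1) wf_rename wf(1))
      moreover have "D xs ?Y"
        unfolding D_def using \<eta>(1) by (intro bexI[of _ \<eta>]) (auto simp only: sat_rename)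
      ultimately show ?thesis unfolding C_def by (intro bexI[of _ ?Y]) auto
    qed
  qed
  have "assignments A \<in> C" using definable_sets_UNIV assms(3) unfolding C_def by fast
  moreover have "X \<noteq> {} \<and> X \<subseteq> assignments A" if "X \<in> C" for X
    using that definable_sets_subset unfolding C_def by fast
  moreover have "{e\<in>X. sat A e \<phi>} \<in> C \<or> {e\<in>X. \<not> sat A e \<phi>} \<in> C" if "X \<in> C" "wf_fm S \<phi>" for X \<phi>
    using that definable_sets_Int[of X S A \<phi>] definable_sets_diff[of X S A \<phi>]
    by (auto simp: C_def)
  moreover have "\<exists>w. {e\<in>X. sat A (e(v := e w)) \<phi>} \<in> C"
    if "X \<in> C" and wf: "wf_fm S \<phi>" "\<forall>e\<in>X. sat A e (Exists v \<phi>)" for X \<phi> v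
  proof -
    have X: "X \<in> definable_sets S A" using that(1) by (simp add: C_def)
    obtain w where "{e\<in>X. sat A (e(v := e w)) \<phi>} \<in> definable_sets S A" (is "?Y w \<in> _")
      and "tuple_type S A n ` X \<subseteq> tuple_type S A n ` {e\<in>X. sat A (e(v := e w)) \<phi>}"
      by (rule definable_witness[OF X wf, of n])
    then have "?Y w \<in> C" using \<open>X \<in> C\<close> unfolding C_def by blast
    then show ?thesis by blast
  qed
  moreover have "countable (range D)" by simp
  moreover have "\<exists>Y\<in>C. Y \<subseteq> X \<and> E Y" if "E \<in> range D" "X \<in> C" for E X
    using dense that by blast
  ultimately have "\<exists>F. generic_filter S A F \<and> (\<forall>P. eventually P F \<longrightarrow> (\<exists>X\<in>C. \<forall>e\<in>X. P e)) \<and>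
    (\<forall>E\<in>range D. \<exists>X\<in>C. E X \<and> eventually (\<lambda>e. e \<in> X) F)"
    by (rule generic_filter_exists[OF A(1)])
  then obtain F where gen: "generic_filter S A F"
    and F': "\<forall>E\<in>range D. \<exists>X\<in>C. E X \<and> eventually (\<lambda>e. e \<in> X) F"
    by (elim exE conjE)
  then have F: "\<exists>X\<in>C. D xs X \<and> eventually (\<lambda>e. e \<in> X) F" for xs by (simp add: image_iff)
  interpret generic_filter S A F by (fact gen)
  obtain h where h: "struct_iso S A gen_model h"
    using omega_categorical_iso[OF assms(1,2) is_struct_gen_model infinite_gen_model[OF A(2)]
        is_model_gen_model] by blast
  define xs where "xs = map (h \<circ> a) [0..<n]"
  obtain X where X: "D xs X" "eventually (\<lambda>e. e \<in> X) F" using F[of xs] by blast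
  then obtain \<eta> where \<eta>: "\<eta> \<in> tuple_type S A n a" "\<forall>e\<in>X. \<not> sat A (e \<circ> s xs) \<eta>" by (auto simp: D_def)
  then have wf: "wf_fm S \<eta>" "free_vars \<eta> \<subseteq> {..<n}" "sat A a \<eta>" by (auto simp: tuple_type_def)
  have "h (a j) \<in> range rep" for j
    using struct_homD(3)[OF struct_isoD(1)[OF h], of "[]" "a j"] assms(3)
    by (auto simp: Dom_gen_model)
  then have "rep (h (a j)) = h (a j)" for j by (metis rangeE rep_rep)
  then have "sat gen_model (rep \<circ> s xs) \<eta> \<longleftrightarrow> sat gen_model (h \<circ> a) \<eta>"
    using wf(2) by (intro sat_cong) (auto simp: s_def xs_def)
  then have "eventually (\<lambda>e. sat A (e \<circ> s xs) \<eta>) F"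
    using sat_iso[OF A(1) h wf(1) assms(3)] wf(3) sat_gen_model[OF wf(1)] by blast
  then have "eventually (\<lambda>e. False) F" using X(2) by eventually_elim (use \<eta>(2) in blast)
  then show False using nontrivial by simp
qed

text \<open>
  Compactness. If there are infinitely many types, then one of \<open>\<phi>\<close> and \<open>\<not> \<phi>\<close> belongs to infinitely
  many of them. So definable sets with infinitely many types form a rich enough system of
  conditions. In the model obtained from them, every formula that is true of the first \<open>n\<close>
  variables is true in tuples of \<open>A\<close> of infinitely many types, hence it does not isolate anything.
  But the model is isomorphic to \<open>A\<close>, where all types are isolated.
\<close>
theorem finitely_many_types:
  assumes "countable_structure S A" "omega_categorical S A"
  shows "finite (tuple_type S A n ` assignments A)"
proof (rule ccontr)
  assume inf: "infinite (tuple_type S A n ` assignments A)"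
  have A: "is_struct S A" "infinite (Dom A)"
    using assms(1) by (auto simp: countable_structure_def denumerable_def)
  define C where "C = {X \<in> definable_sets S A. infinite (tuple_type S A n ` X)}"
  have "assignments A \<in> C" using definable_sets_UNIV inf unfolding C_def by fast
  moreover have "X \<noteq> {} \<and> X \<subseteq> assignments A" if "X \<in> C" for X
    using that definable_sets_subset unfolding C_def by fast
  moreover have "{e\<in>X. sat A e \<phi>} \<in> C \<or> {e\<in>X. \<not> sat A e \<phi>} \<in> C" if "X \<in> C" "wf_fm S \<phi>" for X \<phi>
  proof -
    have "tuple_type S A n ` X = tuple_type S A n ` {e\<in>X. sat A e \<phi>} \<union> tuple_type S A n ` {e\<in>X. \<not> sat A e \<phi>}" by blast
    then have "infinite (tuple_type S A n ` {e\<in>X. sat A e \<phi>}) \<or> infinite (tuple_type S A n ` {e\<in>X. \<not> sat A e \<phi>})"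
      using that(1) unfolding C_def by (metis (lifting) finite_Un mem_Collect_eq)
    then show ?thesis
      using that definable_sets_Int[of X S A \<phi>] definable_sets_diff[of X S A \<phi>]
      by (auto simp: C_def)
  qed
  moreover have "\<exists>w. {e\<in>X. sat A (e(v := e w)) \<phi>} \<in> C"
    if "X \<in> C" and wf: "wf_fm S \<phi>" "\<forall>e\<in>X. sat A e (Exists v \<phi>)" for X \<phi> v
  proof -
    have X: "X \<in> definable_sets S A" and inf_X: "infinite (tuple_type S A n ` X)"
      using that(1) by (auto simp: C_def)
    obtain w where "{e\<in>X. sat A (e(v := e w)) \<phi>} \<in> definable_sets S A" (is "?Y w \<in> _")
      and "tuple_type S A n ` X \<subseteq> tuple_type S A n ` {e\<in>X. sat A (e(v := e w)) \<phi>}"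
      by (rule definable_witness[OF X wf, of n])
    then have "?Y w \<in> C"
      using inf_X finite_subset unfolding C_def by blast
    then show ?thesis by blast
  qed
  moreover have "countable ({} :: ((nat \<Rightarrow> nat) set \<Rightarrow> bool) set)" by simp
  moreover have "\<exists>Y\<in>C. Y \<subseteq> X \<and> E Y" if "E \<in> {}" for E X using that by blast
  ultimately have "\<exists>F. generic_filter S A F \<and> (\<forall>P. eventually P F \<longrightarrow> (\<exists>X\<in>C. \<forall>e\<in>X. P e)) \<and>
    (\<forall>E\<in>{}. \<exists>X\<in>C. E X \<and> eventually (\<lambda>e. e \<in> X) F)"
    by (rule generic_filter_exists[OF A(1)])
  then obtain F where "generic_filter S A F"
    and F: "\<forall>P. eventually P F \<longrightarrow> (\<exists>X\<in>C. \<forall>e\<in>X. P e)"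
    by (elim exE conjE)
  then interpret generic_filter S A F by simp
  obtain h where h: "struct_iso S gen_model A h"
    using omega_categorical_iso[OF assms is_struct_gen_model infinite_gen_model[OF A(2)]
        is_model_gen_model] by blast
  have rep: "rep \<in> assignments gen_model" by (simp add: Dom_gen_model)
  have b: "h \<circ> rep \<in> assignments A"
    using struct_homD(3)[OF struct_isoD(1)[OF h], of "[]"] by (auto simp: Dom_gen_model)
  obtain \<phi> where \<phi>: "\<phi> \<in> tuple_type S A n (h \<circ> rep)"
    "\<And>b. b \<in> assignments A \<Longrightarrow> \<phi> \<in> tuple_type S A n b \<Longrightarrow> tuple_type S A n b = tuple_type S A n (h \<circ> rep)"
    using types_isolated[OF assms b, of n] by blast
  then have wf: "wf_fm S \<phi>" "free_vars \<phi> \<subseteq> {..<n}" "sat A (h \<circ> rep) \<phi>" by (auto simp: tuple_type_def)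
  have "sat gen_model (rep \<circ> id) \<phi>"
    using sat_iso[OF is_struct_gen_model h wf(1) rep] wf(3) by simp
  then have "eventually (\<lambda>e. sat A (e \<circ> id) \<phi>) F" using sat_gen_model[OF wf(1)] by blast
  then obtain X where X: "X \<in> C" "\<forall>e\<in>X. sat A (e \<circ> id) \<phi>"
    using F[rule_format, of "\<lambda>e. sat A (e \<circ> id) \<phi>"] by blast
  have "tuple_type S A n e = tuple_type S A n (h \<circ> rep)" if "e \<in> X" for e
  proof (rule \<phi>(2))
    show "e \<in> assignments A" using that X(1) definable_sets_subset unfolding C_def by fast
    show "\<phi> \<in> tuple_type S A n e" using that X(2) wf by (simp add: tuple_type_def)
  qed
  then have "tuple_type S A n ` X \<subseteq> {tuple_type S A n (h \<circ> rep)}" by blast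
  then show False using X(1) finite_subset by (auto simp: C_def)
qed

section \<open>Back and forth\<close>

text \<open>
  Among finitely many types, each is isolated by the conjunction of formulas that separate it from
  the others. The conclusion avoids types, so that it can be transferred to other models.
\<close>
lemma isolating_formulas:
  assumes "finite (tuple_type S A n ` assignments A)"
  shows "\<exists>\<Phi>. finite \<Phi> \<and> (\<forall>\<phi>\<in>\<Phi>. wf_fm S \<phi> \<and> free_vars \<phi> \<subseteq> {..<n}) \<and>
    (\<forall>e\<in>assignments A. \<exists>\<phi>\<in>\<Phi>. sat A e \<phi>) \<and>
    (\<forall>\<phi>\<in>\<Phi>. \<forall>e\<in>assignments A. \<forall>e'\<in>assignments A. sat A e \<phi> \<longrightarrow> sat A e' \<phi> \<longrightarrow>
      tuple_type S A n e = tuple_type S A n e')"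
proof -
  define P where "P = tuple_type S A n ` assignments A"
  have "\<exists>\<phi>. \<phi> \<in> p \<and> (\<forall>q\<in>P. \<phi> \<in> q \<longrightarrow> q = p)" if "p \<in> P" for p
  proof -
    have "\<exists>\<eta>. \<eta> \<in> p \<and> \<eta> \<notin> q" if "q \<in> P - {p}" for q
    proof -
      obtain e where "p = tuple_type S A n e" using \<open>p \<in> P\<close> by (auto simp: P_def)
      moreover from that obtain e' where "q = tuple_type S A n e'" by (auto simp: P_def)
      ultimately show ?thesis using that tuple_type_separate[of S A n e e'] by blast
    qed
    then obtain \<eta> where \<eta>: "\<And>q. q \<in> P - {p} \<Longrightarrow> \<eta> q \<in> p \<and> \<eta> q \<notin> q" by metis
    obtain qs where qs: "set qs = P - {p}" using finite_list assms by (metis P_def finite_Diff)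
    define \<phi> where "\<phi> = conjs (map \<eta> qs)"
    have "\<phi> \<in> p"
    proof -
      obtain e where e: "p = tuple_type S A n e" using \<open>p \<in> P\<close> by (auto simp: P_def)
      have "\<eta> q \<in> tuple_type S A n e" if "q \<in> set qs" for q using \<eta>[of q] that by (simp add: qs e)
      then show ?thesis unfolding \<phi>_def e by (auto simp: tuple_type_def)
    qed
    moreover have "q = p" if "q \<in> P" "\<phi> \<in> q" for q
    proof (rule ccontr)
      assume "q \<noteq> p"
      then have "\<eta> q \<in> p" "\<eta> q \<notin> q" "q \<in> set qs" using \<eta>[of q] that(1) qs by auto
      moreover from that(1) obtain e where e: "q = tuple_type S A n e" by (auto simp: P_def)
      moreover have "sat A e (\<eta> q)" using that(2) \<open>q \<in> set qs\<close> by (auto simp: e tuple_type_def \<phi>_def)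
      moreover have "wf_fm S (\<eta> q)" "free_vars (\<eta> q) \<subseteq> {..<n}"
        using \<open>\<eta> q \<in> p\<close> \<open>p \<in> P\<close> by (auto simp: P_def tuple_type_def)
      ultimately show False by (simp add: tuple_type_def)
    qed
    ultimately show ?thesis by blast
  qed
  then obtain \<theta> where \<theta>: "\<And>p. p \<in> P \<Longrightarrow> \<theta> p \<in> p \<and> (\<forall>q\<in>P. \<theta> p \<in> q \<longrightarrow> q = p)" by metis
  show ?thesis
  proof (intro exI[of _ "\<theta> ` P"] conjI[OF _ conjI[OF _ conjI]] ballI impI)
    show "finite (\<theta> ` P)" using assms by (simp add: P_def)
    show wf: "wf_fm S \<phi> \<and> free_vars \<phi> \<subseteq> {..<n}" if "\<phi> \<in> \<theta> ` P" for \<phi>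
    proof -
      from that obtain e where "\<phi> = \<theta> (tuple_type S A n e)" "tuple_type S A n e \<in> P" by (auto simp: P_def)
      then have "\<phi> \<in> tuple_type S A n e" using \<theta> by blast
      then show ?thesis by (simp add: tuple_type_def)
    qed
    show "\<exists>\<phi>\<in>\<theta> ` P. sat A e \<phi>" if "e \<in> assignments A" for e
    proof -
      have p: "tuple_type S A n e \<in> P" using that by (auto simp: P_def)
      then have "\<theta> (tuple_type S A n e) \<in> tuple_type S A n e" using \<theta> by blast
      then have "sat A e (\<theta> (tuple_type S A n e))" by (simp add: tuple_type_def)
      with p show ?thesis by blast
    qed
    show "tuple_type S A n e = tuple_type S A n e'" if "\<phi> \<in> \<theta> ` P" "e \<in> assignments A" "e' \<in> assignments A"
      "sat A e \<phi>" "sat A e' \<phi>" for \<phi> e e'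
    proof -
      from that(1) obtain p where p: "p \<in> P" "\<phi> = \<theta> p" by blast
      have "\<phi> \<in> tuple_type S A n e" "\<phi> \<in> tuple_type S A n e'" using wf[OF that(1)] that by (auto simp: tuple_type_def)
      moreover have "tuple_type S A n e \<in> P" "tuple_type S A n e' \<in> P" using that by (auto simp: P_def)
      ultimately show ?thesis using \<theta>[OF p(1)] p(2) by metis
    qed
  qed
qed

text \<open>
  A finite partial elementary map, given by its graph. Quantifying over all pairs of assignments with
  values in the graph makes the notion independent of any enumeration of \<open>Z\<close>.
\<close>
definition partial_elementary ::
  "('f, 'r) signature \<Rightarrow> ('f, 'r, 'x) fo_struct \<Rightarrow> ('f, 'r, 'y) fo_struct \<Rightarrow> ('x \<times> 'y) set \<Rightarrow> bool" where
  "partial_elementary S B C Z \<longleftrightarrow> (\<forall>\<phi> e e'. wf_fm S \<phi> \<longrightarrow> e \<in> assignments B \<longrightarrow> e' \<in> assignments C \<longrightarrow>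
     (\<forall>v\<in>free_vars \<phi>. (e v, e' v) \<in> Z) \<longrightarrow> sat B e \<phi> = sat C e' \<phi>)"

lemma partial_elementary_converse:
  "partial_elementary S B C Z \<Longrightarrow> partial_elementary S C B (Z\<inverse>)"
  unfolding partial_elementary_def by (metis converse_iff)

lemma partial_elementary_empty:
  assumes "is_struct S A" "is_model S (Th S A) B" "is_model S (Th S A) C"
  shows "partial_elementary S B C {}"
  unfolding partial_elementary_def
proof safe
  fix \<phi> :: "('a, 'b) fm" and e e'
  assume wf: "wf_fm S \<phi>" and fv: "\<forall>v\<in>free_vars \<phi>. (e v, e' v) \<in> {}"
    and e: "range e \<subseteq> Dom B" "range e' \<subseteq> Dom C"
  have "holds_in A \<phi> \<or> holds_in A (Neg \<phi>)"
    using sat_cong[of \<phi> _ _ A] fv by (auto simp: holds_in_def)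
  then have "holds_in B \<phi> \<and> holds_in C \<phi> \<or> holds_in B (Neg \<phi>) \<and> holds_in C (Neg \<phi>)"
    using theorem_transfer[OF assms(2)] theorem_transfer[OF assms(3)] wf by fastforce
  then have "sat B e \<phi> \<longleftrightarrow> sat C e' \<phi>" using e by (auto simp: holds_in_def)
  then show "sat B e \<phi> \<Longrightarrow> sat C e' \<phi>" "sat C e' \<phi> \<Longrightarrow> sat B e \<phi>" by auto
qed

text \<open>
  Enumerate \<open>Z\<close> as pairs \<open>(b j, c j)\<close> with \<open>j < n\<close>. By transfer from \<open>A\<close>, some isolating formula \<open>\<phi>\<close> for
  \<open>(n + 1)\<close>-tuples is true of \<open>(b, x)\<close> in \<open>B\<close>. As \<open>\<exists>x. \<phi>\<close> is true of \<open>b\<close>, it is true of \<open>c\<close>, and this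
  provides \<open>y\<close>. That \<open>\<phi>\<close> decides all other formulas is again transferred from \<open>A\<close>.
\<close>
lemma partial_elementary_extend:
  assumes "\<And>n. finite (tuple_type S A n ` assignments A)"
    and "is_model S (Th S A) B" "is_model S (Th S A) C"
    and "finite Z" "Z \<subseteq> Dom B \<times> Dom C" "partial_elementary S B C Z" "x \<in> Dom B"
  shows "\<exists>y\<in>Dom C. partial_elementary S B C (insert (x, y) Z)"
proof -
  obtain zs where zs: "set zs = Z" using finite_list[OF assms(4)] by blast
  define n where "n = length zs"
  obtain c where c: "c \<in> Dom C" using assms(3) by (auto simp: is_model_def is_struct_def)
  \<comment> \<open>All indices from \<open>n\<close> on are filled with the new element \<open>x\<close>, so \<open>b0\<close> is the tuple \<open>(b, x)\<close>.\<close>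
  define b0 where "b0 j = (if j < n then fst (zs ! j) else x)" for j
  define c0 where "c0 j = (if j < n then snd (zs ! j) else c)" for j
  have zs_Dom: "zs ! j \<in> Dom B \<times> Dom C" if "j < n" for j
    using assms(5) zs that by (metis n_def nth_mem subsetD)
  have b0: "b0 \<in> assignments B" and c0: "c0 \<in> assignments C"
    using zs_Dom assms(7) c by (auto simp: b0_def c0_def mem_Times_iff)
  obtain \<Phi> where \<Phi>: "finite \<Phi>" "\<forall>\<phi>\<in>\<Phi>. wf_fm S \<phi> \<and> free_vars \<phi> \<subseteq> {..<Suc n}"
    "\<forall>e\<in>assignments A. \<exists>\<phi>\<in>\<Phi>. sat A e \<phi>"
    "\<forall>\<phi>\<in>\<Phi>. \<forall>e\<in>assignments A. \<forall>e'\<in>assignments A. sat A e \<phi> \<longrightarrow> sat A e' \<phi> \<longrightarrow>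
      tuple_type S A (Suc n) e = tuple_type S A (Suc n) e'"
    using isolating_formulas[OF assms(1)[of "Suc n"]] by (elim exE conjE)
  obtain \<phi>s where \<phi>s: "set \<phi>s = \<Phi>" using finite_list[OF \<Phi>(1)] by blast
  have "holds_in A (Neg (conjs (map Neg \<phi>s)))"
    using \<Phi>(3) \<phi>s by (auto simp: holds_in_def)
  then have "holds_in B (Neg (conjs (map Neg \<phi>s)))"
    using \<Phi>(2) \<phi>s by (intro theorem_transfer[OF assms(2)]) auto
  then have "sat B b0 (Neg (conjs (map Neg \<phi>s)))" using b0 by (simp add: holds_in_def)
  then obtain \<phi> where \<phi>: "\<phi> \<in> \<Phi>" "sat B b0 \<phi>" using \<phi>s by auto
  have wf: "wf_fm S \<phi>" "free_vars \<phi> \<subseteq> {..<Suc n}" using \<Phi>(2) \<phi>(1) by auto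
  have "b0(n := x) = b0" by (auto simp: b0_def)
  then have "sat B (b0(n := x)) \<phi>" using \<phi>(2) by simp
  then have "sat B b0 (Exists n \<phi>)" using assms(7) by auto
  moreover have "(b0 v, c0 v) \<in> Z" if "v \<in> free_vars (Exists n \<phi>)" for v
  proof -
    have "v < n" using that wf(2) by (auto simp: less_Suc_eq)
    then show ?thesis using zs by (auto simp: b0_def c0_def n_def)
  qed
  moreover have "wf_fm S (Exists n \<phi>)" using wf by simp
  ultimately have "sat C c0 (Exists n \<phi>)"
    using assms(6)[unfolded partial_elementary_def, rule_format, of "Exists n \<phi>" b0 c0] b0 c0 by simp
  then obtain y where y: "y \<in> Dom C" "sat C (c0(n := y)) \<phi>" by auto
  define c1 where "c1 = c0(n := y)"
  have c1: "c1 \<in> assignments C" "sat C c1 \<phi>" using c0 y by (auto simp: c1_def)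
  have "partial_elementary S B C (insert (x, y) Z)"
    unfolding partial_elementary_def
  proof (intro allI impI)
    fix \<psi> e e'
    assume \<psi>: "wf_fm S \<psi>" and e: "e \<in> assignments B" "e' \<in> assignments C"
      and fv: "\<forall>v\<in>free_vars \<psi>. (e v, e' v) \<in> insert (x, y) Z"
    have "\<exists>k<Suc n. e v = b0 k \<and> e' v = c1 k" if "v \<in> free_vars \<psi>" for v
    proof (cases "(e v, e' v) = (x, y)")
      case True
      then show ?thesis by (intro exI[of _ n]) (auto simp: b0_def c1_def)
    next
      case False
      with fv that have "(e v, e' v) \<in> set zs" using zs by auto
      then obtain k where "k < n" "zs ! k = (e v, e' v)" by (metis in_set_conv_nth n_def)
      then show ?thesis by (intro exI[of _ k]) (auto simp: b0_def c0_def c1_def)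
    qed
    then obtain \<sigma> where \<sigma>: "\<And>v. v \<in> free_vars \<psi> \<Longrightarrow> \<sigma> v < Suc n \<and> e v = b0 (\<sigma> v) \<and> e' v = c1 (\<sigma> v)"
      by metis
    \<comment> \<open>Any formula with values in the extended graph is reduced to one about the first \<open>n + 1\<close> variables.\<close>
    define \<psi>' where "\<psi>' = rename \<psi> \<sigma>"
    have \<psi>': "wf_fm S \<psi>'" "free_vars \<psi>' \<subseteq> {..<Suc n}"
      using \<psi> wf_rename \<sigma> free_vars_rename[of \<psi> \<sigma>] by (auto simp: \<psi>'_def)
    have B: "sat B e \<psi> \<longleftrightarrow> sat B b0 \<psi>'" and C: "sat C e' \<psi> \<longleftrightarrow> sat C c1 \<psi>'"
      unfolding \<psi>'_def sat_rename using \<sigma> by (auto intro!: sat_cong)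
    have same: "sat A f \<psi>' \<longleftrightarrow> sat A f' \<psi>'"
      if "f \<in> assignments A" "f' \<in> assignments A" "sat A f \<phi>" "sat A f' \<phi>" for f f'
    proof -
      have "tuple_type S A (Suc n) f = tuple_type S A (Suc n) f'" using \<Phi>(4) \<phi>(1) that by blast
      then show ?thesis using \<psi>' unfolding tuple_type_def by blast
    qed
    have "holds_in A (Neg (Conj \<phi> (Neg \<psi>'))) \<or> holds_in A (Neg (Conj \<phi> \<psi>'))"
    proof (rule ccontr)
      assume "\<not> ?thesis"
      then obtain f f' where "f \<in> assignments A" "sat A f \<phi>" "\<not> sat A f \<psi>'"
        "f' \<in> assignments A" "sat A f' \<phi>" "sat A f' \<psi>'"
        by (auto simp: holds_in_def)
      then show False using same by blast
    qed
    then show "sat B e \<psi> = sat C e' \<psi>"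
    proof
      assume *: "holds_in A (Neg (Conj \<phi> (Neg \<psi>')))"
      have "holds_in B (Neg (Conj \<phi> (Neg \<psi>')))" "holds_in C (Neg (Conj \<phi> (Neg \<psi>')))"
        using wf \<psi>' by (auto intro!: theorem_transfer[OF assms(2) _ *] theorem_transfer[OF assms(3) _ *])
      then show ?thesis using B C b0 c1 \<phi>(2) by (auto simp: holds_in_def)
    next
      assume *: "holds_in A (Neg (Conj \<phi> \<psi>'))"
      have "holds_in B (Neg (Conj \<phi> \<psi>'))" "holds_in C (Neg (Conj \<phi> \<psi>'))"
        using wf \<psi>' by (auto intro!: theorem_transfer[OF assms(2) _ *] theorem_transfer[OF assms(3) _ *])
      then show ?thesis using B C b0 c1 \<phi>(2) by (auto simp: holds_in_def)
    qed
  qed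
  then show ?thesis using y(1) by blast
qed

lemma back_and_forth:
  assumes "countable X" "countable Y" "X \<noteq> {}" "Y \<noteq> {}" "R Z0"
    and left: "\<And>Z x. R Z \<Longrightarrow> x \<in> X \<Longrightarrow> \<exists>y. R (insert (x, y) Z)"
    and right: "\<And>Z y. R Z \<Longrightarrow> y \<in> Y \<Longrightarrow> \<exists>x. R (insert (x, y) Z)"
  shows "\<exists>H. Z0 \<subseteq> H \<and> (\<forall>x\<in>X. \<exists>y. (x, y) \<in> H) \<and> (\<forall>y\<in>Y. \<exists>x. (x, y) \<in> H) \<and>
    (\<forall>K. finite K \<longrightarrow> K \<subseteq> H \<longrightarrow> (\<exists>Z. K \<subseteq> Z \<and> R Z))"
proof -
  define Q where "Q k Z Z' \<longleftrightarrow> Z \<subseteq> Z' \<and> (\<exists>y. (from_nat_into X k, y) \<in> Z') \<and>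
    (\<exists>x. (x, from_nat_into Y k) \<in> Z')" for k Z Z'
  have step: "\<exists>Z'. R Z' \<and> Q k Z Z'" if "R Z" for Z k
  proof -
    from left[OF that from_nat_into[OF \<open>X \<noteq> {}\<close>]]
    obtain y where "R (insert (from_nat_into X k, y) Z)" by blast
    moreover from right[OF this from_nat_into[OF \<open>Y \<noteq> {}\<close>]]
    obtain x where "R (insert (x, from_nat_into Y k) (insert (from_nat_into X k, y) Z))" by blast
    ultimately show ?thesis unfolding Q_def by blast
  qed
  have "\<exists>f. \<forall>k. (R (f k) \<and> (k = 0 \<longrightarrow> f k = Z0)) \<and> Q k (f k) (f (Suc k))"
    using dependent_nat_choice[of "\<lambda>k Z. R Z \<and> (k = 0 \<longrightarrow> Z = Z0)" Q] step \<open>R Z0\<close> by force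
  then obtain f where "\<forall>k. (R (f k) \<and> (k = 0 \<longrightarrow> f k = Z0)) \<and> Q k (f k) (f (Suc k))" ..
  then have f: "R (f k)" "f 0 = Z0" "Q k (f k) (f (Suc k))" for k by blast+
  have mono: "f i \<subseteq> f j" if "i \<le> j" for i j
    using f(3) by (intro lift_Suc_mono_le[OF _ that]) (auto simp: Q_def)
  show ?thesis
  proof (rule exI[of _ "\<Union>k. f k"], intro conjI allI impI ballI)
    show "Z0 \<subseteq> (\<Union>k. f k)" using f(2) by blast
    show "\<exists>y. (x, y) \<in> (\<Union>k. f k)" if "x \<in> X" for x
      using f(3) from_nat_into_surj[OF \<open>countable X\<close> that] unfolding Q_def by (metis UN_I UNIV_I)
    show "\<exists>x. (x, y) \<in> (\<Union>k. f k)" if "y \<in> Y" for y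
      using f(3) from_nat_into_surj[OF \<open>countable Y\<close> that] unfolding Q_def by (metis UN_I UNIV_I)
    show "\<exists>Z. K \<subseteq> Z \<and> R Z" if "finite K" "K \<subseteq> (\<Union>k. f k)" for K
    proof -
      have "\<exists>k. K \<subseteq> f k" using that
      proof (induction K)
        case (insert z K)
        then obtain i j where "K \<subseteq> f i" "z \<in> f j" by auto
        then show ?case
          using mono[of i "max i j"] mono[of j "max i j"] by (intro exI[of _ "max i j"]) auto
      qed simp
      then show ?thesis using f(1) by blast
    qed
  qed
qed

lemma struct_iso_if_elementary:
  assumes "is_struct S B" "bij_betw h (Dom B) (Dom C)"
    and elem: "\<And>\<phi> e. wf_fm S \<phi> \<Longrightarrow> e \<in> assignments B \<Longrightarrow> sat B e \<phi> \<longleftrightarrow> sat C (h \<circ> e) \<phi>"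
  shows "struct_iso S B C h"
proof -
  obtain b0 where b0: "b0 \<in> Dom B" using assms(1) by (auto simp: is_struct_def)
  define env where "env xs y j = (if j < length xs then xs ! j else y)" for xs :: "'c list" and y j
  have env: "env xs y \<in> assignments B" if "set xs \<subseteq> Dom B" "y \<in> Dom B" for xs y
    using that by (auto simp: env_def)
  have vals: "map (tm_val A e) (map Var [0..<n]) = map e [0..<n]" for A :: "('a, 'b, 'z) fo_struct" and e n
    by simp
  have env_map: "map (env xs y) [0..<length xs] = xs" "map (h \<circ> env xs y) [0..<length xs] = map h xs" for xs y
    by (auto intro!: nth_equalityI simp: env_def)
  have f: "h (fun_int B (f, length xs) xs) = fun_int C (f, length xs) (map h xs)"
    if "(f, length xs) \<in> funs S" "set xs \<subseteq> Dom B" for f xs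
  proof -
    let ?e = "env xs (fun_int B (f, length xs) xs)"
    let ?\<phi> = "Eq (Var (length xs)) (Fun f (map Var [0..<length xs]))"
    have "wf_fm S ?\<phi>" using that by (auto simp: list_all_iff)
    moreover have "sat B ?e ?\<phi>"
      by (simp only: sat_simps tm_val_simps vals env_map length_map length_upt) (simp add: env_def)
    ultimately have "sat C (h \<circ> ?e) ?\<phi>"
      using elem env that is_structD[OF assms(1) that] by blast
    then show ?thesis
      by (simp only: sat_simps tm_val_simps vals env_map length_map length_upt) (simp add: env_def)
  qed
  have r: "xs \<in> rel_int B (r, length xs) \<longleftrightarrow> map h xs \<in> rel_int C (r, length xs)"
    if "(r, length xs) \<in> rels S" "set xs \<subseteq> Dom B" for r xs
  proof -
    let ?e = "env xs b0"
    let ?\<phi> = "Rel r (map Var [0..<length xs])"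
    have "wf_fm S ?\<phi>" using that by (auto simp: list_all_iff)
    then have "sat B ?e ?\<phi> \<longleftrightarrow> sat C (h \<circ> ?e) ?\<phi>"
      using elem env that b0 by blast
    then show ?thesis
      by (simp only: sat_simps vals env_map length_map length_upt) simp
  qed
  show ?thesis
    unfolding struct_iso_def struct_hom_def
  proof (intro conjI)
    show "h \<in> Dom B \<rightarrow> Dom C" using assms(2) by (simp add: bij_betw_imp_funcset)
    show "\<forall>(f, n)\<in>funs S. \<forall>xs\<in>nlists n (Dom B). h (fun_int B (f, n) xs) = fun_int C (f, n) (map h xs)"
      using f nlistsE_length nlistsE_set by fast
    show "\<forall>(r, n)\<in>rels S. \<forall>xs\<in>nlists n (Dom B). xs \<in> rel_int B (r, n) \<longrightarrow> map h xs \<in> rel_int C (r, n)"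
      "\<forall>(r, n)\<in>rels S. \<forall>xs\<in>nlists n (Dom B). map h xs \<in> rel_int C (r, n) \<longrightarrow> xs \<in> rel_int B (r, n)"
      using r nlistsE_length nlistsE_set by fast+
  qed (fact assms(2))
qed

text \<open>
  With \<open>Z = {}\<close> this shows \<open>\<omega>\<close>-categoricity. With \<open>B = C = A\<close> and the graph of a map between tuples as
  \<open>Z\<close>, it shows that tuples of the same type are conjugate under automorphisms.
\<close>
theorem iso_extending:
  assumes types: "\<And>n. finite (tuple_type S A n ` assignments A)"
    and B: "is_model S (Th S A) B" "countable (Dom B)" and C: "is_model S (Th S A) C" "countable (Dom C)"
    and Z: "finite Z" "Z \<subseteq> Dom B \<times> Dom C" "partial_elementary S B C Z"
  shows "\<exists>h. struct_iso S B C h \<and> (\<forall>x y. (x, y) \<in> Z \<longrightarrow> h x = y)"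
proof -
  define R where "R Z \<longleftrightarrow> finite Z \<and> Z \<subseteq> Dom B \<times> Dom C \<and> partial_elementary S B C Z" for Z
  have "Dom B \<noteq> {}" "Dom C \<noteq> {}" using B(1) C(1) by (auto simp: is_model_def is_struct_def)
  moreover have "R Z" using Z by (simp add: R_def)
  moreover have "\<exists>y. R (insert (x, y) Z)" if "R Z" "x \<in> Dom B" for Z x
    using partial_elementary_extend[OF types B(1) C(1) _ _ _ that(2), of Z] that unfolding R_def by blast
  moreover have "\<exists>x. R (insert (x, y) Z)" if "R Z" "y \<in> Dom C" for Z y
  proof -
    note y = that(2)
    have "finite (Z\<inverse>)" "Z\<inverse> \<subseteq> Dom C \<times> Dom B" "partial_elementary S C B (Z\<inverse>)"
      using that(1) partial_elementary_converse by (auto simp: R_def)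
    then obtain x where "x \<in> Dom B" "partial_elementary S C B (insert (y, x) (Z\<inverse>))"
      using partial_elementary_extend[OF types C(1) B(1) _ _ _ y] by blast
    moreover have "(insert (y, x) (Z\<inverse>))\<inverse> = insert (x, y) Z" by auto
    ultimately have "partial_elementary S B C (insert (x, y) Z)"
      using partial_elementary_converse[of S C B "insert (y, x) (Z\<inverse>)"] by simp
    with that \<open>x \<in> Dom B\<close> show ?thesis unfolding R_def by blast
  qed
  ultimately have "\<exists>H. Z \<subseteq> H \<and> (\<forall>x\<in>Dom B. \<exists>y. (x, y) \<in> H) \<and> (\<forall>y\<in>Dom C. \<exists>x. (x, y) \<in> H) \<and>
    (\<forall>K. finite K \<longrightarrow> K \<subseteq> H \<longrightarrow> (\<exists>Z. K \<subseteq> Z \<and> R Z))"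
    by (rule back_and_forth[OF B(2) C(2)])
  then obtain H where H: "Z \<subseteq> H" "\<forall>x\<in>Dom B. \<exists>y. (x, y) \<in> H"
    "\<forall>y\<in>Dom C. \<exists>x. (x, y) \<in> H" "\<forall>K. finite K \<longrightarrow> K \<subseteq> H \<longrightarrow> (\<exists>Z. K \<subseteq> Z \<and> R Z)"
    by (elim exE conjE)
  have H_Dom: "x \<in> Dom B" "y \<in> Dom C" if "(x, y) \<in> H" for x y
    using H(4)[rule_format, of "{(x, y)}"] that by (auto simp: R_def)
  have elem: "sat B e \<phi> \<longleftrightarrow> sat C e' \<phi>" if "wf_fm S \<phi>" "e \<in> assignments B" "e' \<in> assignments C"
    "\<forall>v\<in>free_vars \<phi>. (e v, e' v) \<in> H" for \<phi> e e'
  proof -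
    have "finite ((\<lambda>v. (e v, e' v)) ` free_vars \<phi>)" by (intro finite_imageI finite_free_vars)
    moreover have "(\<lambda>v. (e v, e' v)) ` free_vars \<phi> \<subseteq> H" using that(4) by auto
    ultimately have "finite ((\<lambda>v. (e v, e' v)) ` free_vars \<phi>)" "(\<lambda>v. (e v, e' v)) ` free_vars \<phi> \<subseteq> H"
      by auto
    from H(4)[rule_format, OF this] obtain K
      where "(\<lambda>v. (e v, e' v)) ` free_vars \<phi> \<subseteq> K" "partial_elementary S B C K"
      unfolding R_def by blast
    then show ?thesis
      using that(1-3) unfolding partial_elementary_def by (simp add: image_subset_iff)
  qed
  have same: "x = x' \<longleftrightarrow> y = y'" if "(x, y) \<in> H" "(x', y') \<in> H" for x y x' y'
    using elem[of "Eq (Var 0) (Var 1)" "\<lambda>j. if j = 0 then x else x'" "\<lambda>j. if j = 0 then y else y'"]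
      that H_Dom by (auto split: if_splits)
  obtain h where h: "\<And>x. x \<in> Dom B \<Longrightarrow> (x, h x) \<in> H" using H(2) by metis
  have "bij_betw h (Dom B) (Dom C)"
  proof (rule bij_betw_imageI)
    show "inj_on h (Dom B)" using same h by (metis inj_onI)
    show "h ` Dom B = Dom C" using H(3) H_Dom same h by (metis (no_types, opaque_lifting) image_iff subsetI subset_antisym image_subsetI)
  qed
  moreover have "sat B e \<phi> \<longleftrightarrow> sat C (h \<circ> e) \<phi>" if "wf_fm S \<phi>" "e \<in> assignments B" for \<phi> e
  proof (rule elem[OF that])
    show "h \<circ> e \<in> assignments C" using that(2) h H_Dom by fastforce
    show "\<forall>v\<in>free_vars \<phi>. (e v, (h \<circ> e) v) \<in> H" using that(2) h by auto
  qed
  ultimately have "struct_iso S B C h"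
    using B(1) by (intro struct_iso_if_elementary) (auto simp: is_model_def)
  moreover have "h x = y" if "(x, y) \<in> Z" for x y
    using same[of x y x "h x"] that H(1) h H_Dom by blast
  ultimately show ?thesis by blast
qed

section \<open>Representations of topological monoids by transformations\<close>

text \<open>
  The open sets of the initial topology on \<open>A\<close> with respect to \<open>\<xi>\<close>, where transformations carry the
  topology of pointwise convergence.
\<close>
definition finitely_determined :: "'x set \<Rightarrow> 'a set \<Rightarrow> ('a \<Rightarrow> 'x \<Rightarrow> 'x) \<Rightarrow> 'a set \<Rightarrow> bool" where
  "finitely_determined X A \<xi> W \<longleftrightarrow> W \<subseteq> A \<and>
     (\<forall>x\<in>W. \<exists>K. finite K \<and> K \<subseteq> X \<and> (\<forall>y\<in>A. (\<forall>k\<in>K. \<xi> y k = \<xi> x k) \<longrightarrow> y \<in> W))"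

lemma finitely_determinedD:
  assumes "finitely_determined X A \<xi> W" "x \<in> W"
  obtains K where "finite K" "K \<subseteq> X" "\<And>y. y \<in> A \<Longrightarrow> (\<And>k. k \<in> K \<Longrightarrow> \<xi> y k = \<xi> x k) \<Longrightarrow> y \<in> W"
  using assms unfolding finitely_determined_def by (metis (no_types, lifting))

lemma finitely_determined_transfer:
  assumes "finitely_determined X A \<xi> W"
    and "\<And>K. finite K \<Longrightarrow> K \<subseteq> X \<Longrightarrow> \<exists>K'. finite K' \<and> K' \<subseteq> Y \<and>
      (\<forall>x\<in>A. \<forall>y\<in>A. (\<forall>k\<in>K'. \<zeta> y k = \<zeta> x k) \<longrightarrow> (\<forall>k\<in>K. \<xi> y k = \<xi> x k))"
  shows "finitely_determined Y A \<zeta> W"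
  unfolding finitely_determined_def
proof (intro conjI ballI)
  show "W \<subseteq> A" using assms(1) by (simp add: finitely_determined_def)
  fix x assume "x \<in> W"
  with assms(1) obtain K where K: "finite K" "K \<subseteq> X" "\<forall>y\<in>A. (\<forall>k\<in>K. \<xi> y k = \<xi> x k) \<longrightarrow> y \<in> W"
    unfolding finitely_determined_def by blast
  from assms(2)[OF K(1,2)] obtain K' where K': "finite K'" "K' \<subseteq> Y"
    "\<forall>x\<in>A. \<forall>y\<in>A. (\<forall>k\<in>K'. \<zeta> y k = \<zeta> x k) \<longrightarrow> (\<forall>k\<in>K. \<xi> y k = \<xi> x k)"
    by (elim exE conjE)
  have "x \<in> A" using \<open>x \<in> W\<close> \<open>W \<subseteq> A\<close> by blast
  with K(3) K'(3) have "\<forall>y\<in>A. (\<forall>k\<in>K'. \<zeta> y k = \<zeta> x k) \<longrightarrow> y \<in> W" by blast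
  with K'(1,2) show "\<exists>K. finite K \<and> K \<subseteq> Y \<and> (\<forall>y\<in>A. (\<forall>k\<in>K. \<zeta> y k = \<zeta> x k) \<longrightarrow> y \<in> W)" by blast
qed

lemma topspace_pointwise_topology [simp]: "topspace (pointwise_topology X) = X \<rightarrow>\<^sub>E X"
  by (simp add: pointwise_topology_def)

lemma openin_pointwise_topology:
  "openin (pointwise_topology X) W \<longleftrightarrow> finitely_determined X (X \<rightarrow>\<^sub>E X) (\<lambda>f. f) W"
proof
  assume W: "openin (pointwise_topology X) W"
  have "\<exists>K. finite K \<and> K \<subseteq> X \<and> (\<forall>f'\<in>X \<rightarrow>\<^sub>E X. (\<forall>k\<in>K. f' k = f k) \<longrightarrow> f' \<in> W)" if "f \<in> W" for f
  proof -
    from W that obtain U where U: "finite {i\<in>X. U i \<noteq> X}" "f \<in> Pi\<^sub>E X U" "Pi\<^sub>E X U \<subseteq> W"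
      by (auto simp: pointwise_topology_def openin_product_topology_alt)
    have "f' \<in> W" if "f' \<in> X \<rightarrow>\<^sub>E X" "\<forall>k\<in>{i\<in>X. U i \<noteq> X}. f' k = f k" for f'
    proof -
      have "f' k \<in> U k" if "k \<in> X" for k
        using U(2) \<open>f' \<in> X \<rightarrow>\<^sub>E X\<close> \<open>\<forall>k\<in>_. f' k = f k\<close> that by (cases "U k = X") (auto simp: PiE_iff)
      then have "f' \<in> Pi\<^sub>E X U" using \<open>f' \<in> X \<rightarrow>\<^sub>E X\<close> by (auto simp: PiE_iff)
      then show ?thesis using U(3) by blast
    qed
    then show ?thesis using U(1) by (intro exI[of _ "{i\<in>X. U i \<noteq> X}"]) auto
  qed
  then show "finitely_determined X (X \<rightarrow>\<^sub>E X) (\<lambda>f. f) W"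
    using openin_subset[OF W] by (auto simp: finitely_determined_def)
next
  assume W: "finitely_determined X (X \<rightarrow>\<^sub>E X) (\<lambda>f. f) W"
  show "openin (pointwise_topology X) W"
    unfolding pointwise_topology_def openin_product_topology_alt
  proof
    fix f assume "f \<in> W"
    from W this obtain K where K: "finite K" "K \<subseteq> X"
      "\<And>f'. f' \<in> X \<rightarrow>\<^sub>E X \<Longrightarrow> (\<And>k. k \<in> K \<Longrightarrow> f' k = f k) \<Longrightarrow> f' \<in> W"
      by (rule finitely_determinedD) blast
    have f: "f \<in> X \<rightarrow>\<^sub>E X" using W \<open>f \<in> W\<close> by (auto simp: finitely_determined_def)
    define U where "U k = (if k \<in> K then {f k} else X)" for k
    have "finite {i\<in>X. U i \<noteq> X}" using K(1) by (rule rev_finite_subset) (auto simp: U_def)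
    moreover have "Pi\<^sub>E X U \<subseteq> W"
    proof
      fix f' assume f': "f' \<in> Pi\<^sub>E X U"
      have U: "U k \<subseteq> X" if "k \<in> X" for k using f that by (auto simp: U_def)
      show "f' \<in> W"
      proof (rule K(3))
        show "f' \<in> X \<rightarrow>\<^sub>E X" using PiE_mono[OF U, of X "\<lambda>k. k"] f' by blast
        show "f' k = f k" if "k \<in> K" for k using f' that K(2) by (force simp: U_def PiE_iff)
      qed
    qed
    moreover have "f \<in> Pi\<^sub>E X U" "\<forall>k\<in>X. U k \<subseteq> X" using f by (auto simp: U_def)
    ultimately show "\<exists>U. finite {i \<in> X. U i \<noteq> topspace (discrete_topology X)} \<and>
      (\<forall>i\<in>X. openin (discrete_topology X) (U i)) \<and> f \<in> Pi\<^sub>E X U \<and> Pi\<^sub>E X U \<subseteq> W"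
      by (intro exI[of _ U]) simp
  qed
qed

lemma openin_subtopology_pointwise:
  assumes "N \<subseteq> X \<rightarrow>\<^sub>E X"
  shows "openin (subtopology (pointwise_topology X) N) W \<longleftrightarrow> finitely_determined X N (\<lambda>f. f) W"
proof
  assume "openin (subtopology (pointwise_topology X) N) W"
  then obtain U where U: "finitely_determined X (X \<rightarrow>\<^sub>E X) (\<lambda>f. f) U" "W = U \<inter> N"
    by (auto simp: openin_subtopology openin_pointwise_topology)
  show "finitely_determined X N (\<lambda>f. f) W"
    unfolding finitely_determined_def
  proof (intro conjI ballI)
    show "W \<subseteq> N" using U by blast
    fix f assume "f \<in> W"
    then have "f \<in> U" using U by blast
    with U(1) obtain K where "finite K" "K \<subseteq> X" "\<forall>f'\<in>X \<rightarrow>\<^sub>E X. (\<forall>k\<in>K. f' k = f k) \<longrightarrow> f' \<in> U"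
      unfolding finitely_determined_def by blast
    moreover from this have "\<forall>f'\<in>N. (\<forall>k\<in>K. f' k = f k) \<longrightarrow> f' \<in> W"
      using U(2) assms by (simp add: subset_iff)
    ultimately show "\<exists>K. finite K \<and> K \<subseteq> X \<and> (\<forall>f'\<in>N. (\<forall>k\<in>K. f' k = f k) \<longrightarrow> f' \<in> W)"
      by blast
  qed
next
  assume W: "finitely_determined X N (\<lambda>f. f) W"
  define \<U> where "\<U> = {U. openin (pointwise_topology X) U \<and> U \<inter> N \<subseteq> W}"
  have "f \<in> \<Union>\<U>" if "f \<in> W" for f
  proof -
    from W that obtain K where K: "finite K" "K \<subseteq> X" "\<forall>f'\<in>N. (\<forall>k\<in>K. f' k = f k) \<longrightarrow> f' \<in> W"
      unfolding finitely_determined_def by blast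
    let ?U = "{f'\<in>X \<rightarrow>\<^sub>E X. \<forall>k\<in>K. f' k = f k}"
    have "finitely_determined X (X \<rightarrow>\<^sub>E X) (\<lambda>f. f) ?U"
      unfolding finitely_determined_def using K(1,2) by (intro conjI ballI exI[of _ K]) auto
    then have "?U \<in> \<U>" using K(3) by (auto simp: \<U>_def openin_pointwise_topology)
    moreover have "f \<in> ?U" using that W assms by (auto simp: finitely_determined_def)
    ultimately show ?thesis by blast
  qed
  moreover have "W \<subseteq> N" using W by (simp add: finitely_determined_def)
  ultimately have "W = \<Union>\<U> \<inter> N" by (auto simp: \<U>_def)
  moreover have "openin (pointwise_topology X) (\<Union>\<U>)" by (auto simp: \<U>_def)
  ultimately show "openin (subtopology (pointwise_topology X) N) W"
    by (auto simp: openin_subtopology)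
qed

lemma closedin_pointwise_topology:
  assumes "N \<subseteq> X \<rightarrow>\<^sub>E X"
  shows "closedin (pointwise_topology X) N \<longleftrightarrow>
    (\<forall>f\<in>X \<rightarrow>\<^sub>E X. (\<forall>K. finite K \<and> K \<subseteq> X \<longrightarrow> (\<exists>f'\<in>N. \<forall>k\<in>K. f' k = f k)) \<longrightarrow> f \<in> N)"
proof -
  have eq: "(\<forall>f'\<in>X \<rightarrow>\<^sub>E X. (\<forall>k\<in>K. f' k = f k) \<longrightarrow> f' \<in> (X \<rightarrow>\<^sub>E X) - N) \<longleftrightarrow>
      \<not> (\<exists>f'\<in>N. \<forall>k\<in>K. f' k = f k)" for f K
    using assms by fast
  have "closedin (pointwise_topology X) N \<longleftrightarrow> (\<forall>f\<in>(X \<rightarrow>\<^sub>E X) - N.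
      \<exists>K. finite K \<and> K \<subseteq> X \<and> \<not> (\<exists>f'\<in>N. \<forall>k\<in>K. f' k = f k))"
    unfolding closedin_def openin_pointwise_topology finitely_determined_def
      topspace_pointwise_topology eq
    using assms by simp
  also have "\<dots> \<longleftrightarrow> (\<forall>f\<in>X \<rightarrow>\<^sub>E X. f \<notin> N \<longrightarrow>
      \<not> (\<forall>K. finite K \<and> K \<subseteq> X \<longrightarrow> (\<exists>f'\<in>N. \<forall>k\<in>K. f' k = f k)))"
    by (simp only: Diff_iff Ball_def not_all not_imp conj_assoc imp_conjL)
  also have "\<dots> \<longleftrightarrow> (\<forall>f\<in>X \<rightarrow>\<^sub>E X. (\<forall>K. finite K \<and> K \<subseteq> X \<longrightarrow> (\<exists>f'\<in>N. \<forall>k\<in>K. f' k = f k)) \<longrightarrow> f \<in> N)"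
    by (intro ball_cong refl) argo
  finally show ?thesis .
qed

text \<open>
  Compared with isomorphisms onto submonoids, this form of the data does not mention
  the image and its subspace topology, and it is easy to move from \<open>X\<close> to another set.
\<close>
locale faithful_representation = topological_monoid M T for M (structure) and T +
  fixes X :: "'x set" and \<xi> :: "'a \<Rightarrow> 'x \<Rightarrow> 'x"
  assumes maps: "x \<in> carrier M \<Longrightarrow> \<xi> x \<in> X \<rightarrow>\<^sub>E X"
    and mult: "x \<in> carrier M \<Longrightarrow> y \<in> carrier M \<Longrightarrow> k \<in> X \<Longrightarrow> \<xi> (x \<otimes> y) k = \<xi> x (\<xi> y k)"
    and one: "k \<in> X \<Longrightarrow> \<xi> \<one> k = k"
    and inj: "inj_on \<xi> (carrier M)"
    and open_iff: "openin T W \<longleftrightarrow> finitely_determined X (carrier M) \<xi> W"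

lemma finitely_determined_image:
  assumes "inj_on \<xi> A" "W \<subseteq> A"
  shows "finitely_determined X (\<xi> ` A) (\<lambda>f. f) (\<xi> ` W) \<longleftrightarrow> finitely_determined X A \<xi> W"
proof -
  have "\<xi> y \<in> \<xi> ` W \<longleftrightarrow> y \<in> W" if "y \<in> A" for y
    using assms that by (simp add: inj_on_image_mem_iff)
  moreover have "\<xi> ` W \<subseteq> \<xi> ` A" using assms(2) by blast
  ultimately show ?thesis
    using assms(2) by (simp add: finitely_determined_def cong: conj_cong)
qed

lemma (in topological_monoid) topological_iso_iff_representation:
  assumes N: "N \<subseteq> X \<rightarrow>\<^sub>E X" and id: "(\<lambda>k\<in>X. k) \<in> N"
  shows "topological_iso M T (transformation_monoid X\<lparr>carrier := N\<rparr>)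
      (subtopology (pointwise_topology X) N) \<xi> \<longleftrightarrow>
    faithful_representation M T X \<xi> \<and> \<xi> ` carrier M = N" (is "topological_iso _ _ ?N ?S _ \<longleftrightarrow> _")
proof
  have topspace: "topspace ?S = N" using N by auto
  {
    assume *: "topological_iso M T ?N ?S \<xi>"
    then have bij: "bij_betw \<xi> (carrier M) N" and homeo: "homeomorphic_map T ?S \<xi>"
      and hom: "\<And>x y. x \<in> carrier M \<Longrightarrow> y \<in> carrier M \<Longrightarrow> \<xi> (x \<otimes> y) = compose X (\<xi> x) (\<xi> y)"
      by (auto simp: topological_iso_def iso_def hom_def transformation_monoid_def)
    then have image: "\<xi> ` carrier M = N" and inj: "inj_on \<xi> (carrier M)"
      by (auto simp: bij_betw_def)
    show "faithful_representation M T X \<xi> \<and> \<xi> ` carrier M = N"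
    proof
      show "faithful_representation M T X \<xi>"
      proof
        show maps: "\<xi> x \<in> X \<rightarrow>\<^sub>E X" if "x \<in> carrier M" for x using that image N by blast
        show "\<xi> (x \<otimes> y) k = \<xi> x (\<xi> y k)" if "x \<in> carrier M" "y \<in> carrier M" "k \<in> X" for x y k
          using hom that by (simp add: compose_def)
        show "\<xi> \<one> k = k" if "k \<in> X" for k
        proof -
          from id image obtain i where i: "i \<in> carrier M" "\<xi> i = (\<lambda>k\<in>X. k)" by (metis imageE)
          have "\<xi> (i \<otimes> \<one>) k = \<xi> \<one> k"
            using hom[OF i(1) one_closed] i that maps[OF one_closed] by (auto simp: compose_def)
          then show ?thesis using i that by simp
        qed
        show "openin T W \<longleftrightarrow> finitely_determined X (carrier M) \<xi> W" for W
        proof (cases "W \<subseteq> carrier M")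
          case True
          have "openin T W \<longleftrightarrow> openin ?S (\<xi> ` W)"
            using homeomorphic_map_openness_eq[OF homeo, of W] True topspace_eq by auto
          then show ?thesis
            using openin_subtopology_pointwise[OF N] finitely_determined_image[OF inj True] image
            by metis
        next
          case False
          then show ?thesis using openin_subset topspace_eq by (auto simp: finitely_determined_def)
        qed
      qed (fact inj)
    qed (fact image)
  next
    assume *: "faithful_representation M T X \<xi> \<and> \<xi> ` carrier M = N"
    then interpret faithful_representation M T X \<xi> by simp
    have image: "\<xi> ` carrier M = N" using * by simp
    have "\<xi> (x \<otimes> y) = compose X (\<xi> x) (\<xi> y)" if "x \<in> carrier M" "y \<in> carrier M" for x y
      using maps[of "x \<otimes> y"] that mult
      by (intro extensionalityI[of _ X]) (auto simp: compose_def PiE_iff)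
    then have "\<xi> \<in> iso M ?N"
      using image inj by (auto simp: iso_def hom_def transformation_monoid_def bij_betw_def)
    moreover have "homeomorphic_map T ?S \<xi>"
    proof (rule bijective_open_imp_homeomorphic_map)
      have open_image: "openin ?S (\<xi> ` W) \<longleftrightarrow> openin T W" if "W \<subseteq> carrier M" for W
        using openin_subtopology_pointwise[OF N] finitely_determined_image[OF inj that] image
          open_iff[of W] by metis
      show "open_map T ?S \<xi>"
        using open_image openin_subset topspace_eq unfolding open_map_def by metis
      show "continuous_map T ?S \<xi>"
        unfolding continuous_map_def
      proof safe
        show "\<xi> x \<in> topspace ?S" if "x \<in> topspace T" for x
          using that image topspace topspace_eq by auto
        fix W assume W: "openin ?S W"
        let ?V = "{x \<in> topspace T. \<xi> x \<in> W}"
        have "\<xi> ` ?V = W" using openin_subset[OF W] image topspace topspace_eq by auto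
        then show "openin T ?V" using open_image[of ?V] W topspace_eq by auto
      qed
    qed (use image inj topspace topspace_eq in auto)
    ultimately show "topological_iso M T ?N ?S \<xi>" by (simp add: topological_iso_def)
  }
qed

context faithful_representation
begin

lemma maps_in: "x \<in> carrier M \<Longrightarrow> k \<in> X \<Longrightarrow> \<xi> x k \<in> X"
  using maps by blast

lemma eqI:
  assumes "x \<in> carrier M" "y \<in> carrier M" "\<And>k. k \<in> X \<Longrightarrow> \<xi> x k = \<xi> y k"
  shows "x = y"
  using assms maps inj by (meson PiE_ext inj_on_eq_iff)

lemma units_inverse:
  assumes "g \<in> Units M" "k \<in> X"
  shows "\<xi> g (\<xi> (inv g) k) = k" "\<xi> (inv g) (\<xi> g k) = k"
  using assms mult[of g "inv g" k] mult[of "inv g" g k] one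
  by (simp_all add: Units_closed Units_inv_closed)

lemma units_Bij: "g \<in> Units M \<Longrightarrow> \<xi> g \<in> Bij X"
  using maps[of g] maps_in[of g] maps_in[of "inv g"] units_inverse[of g]
  unfolding Bij_def
  by (auto simp: PiE_iff Units_closed intro!: bij_betw_byWitness[where f' = "\<xi> (inv g)"])

lemma subgroup_units: "subgroup (\<xi> ` Units M) (BijGroup X)"
proof -
  have mult_eq: "\<xi> g \<otimes>\<^bsub>BijGroup X\<^esub> \<xi> h = \<xi> (g \<otimes> h)" if "g \<in> Units M" "h \<in> Units M" for g h
    using that units_Bij maps[of "g \<otimes> h"] mult
    by (auto simp: BijGroup_def Units_closed compose_def PiE_iff intro!: extensionalityI[of _ X])
  have one_eq: "\<one>\<^bsub>BijGroup X\<^esub> = \<xi> \<one>"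
    using maps[OF one_closed] one by (auto simp: BijGroup_def PiE_iff intro!: extensionalityI[of _ X])
  interpret B: group "BijGroup X" by (rule group_BijGroup)
  show ?thesis
  proof (rule B.subgroupI)
    show "\<xi> ` Units M \<subseteq> carrier (BijGroup X)" using units_Bij by (auto simp: BijGroup_def)
    show "\<xi> ` Units M \<noteq> {}" by blast
    show "inv\<^bsub>BijGroup X\<^esub> f \<in> \<xi> ` Units M" if "f \<in> \<xi> ` Units M" for f
    proof -
      from that obtain g where g: "g \<in> Units M" "f = \<xi> g" by blast
      have "\<xi> (inv g) \<otimes>\<^bsub>BijGroup X\<^esub> \<xi> g = \<one>\<^bsub>BijGroup X\<^esub>"
        using g by (simp add: mult_eq one_eq)
      then have "inv\<^bsub>BijGroup X\<^esub> \<xi> g = \<xi> (inv g)"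
        using g units_Bij by (intro B.inv_equality) (auto simp: BijGroup_def)
      then show ?thesis using g by auto
    qed
    show "f \<otimes>\<^bsub>BijGroup X\<^esub> f' \<in> \<xi> ` Units M" if "f \<in> \<xi> ` Units M" "f' \<in> \<xi> ` Units M" for f f'
      using that mult_eq by auto
  qed
qed

text \<open>If \<open>h\<close> runs through all units, then so do \<open>h \<otimes> g\<close> and \<open>h \<otimes> inv g\<close>.\<close>
lemma orbit_map_unit:
  assumes g: "g \<in> Units M" and ks: "set ks \<subseteq> X"
  shows "{map (\<xi> h) (map (\<xi> g) ks) | h. h \<in> Units M} = {map (\<xi> h) ks | h. h \<in> Units M}"
    (is "?L = ?R")
proof
  show "?L \<subseteq> ?R"
  proof
    fix l assume "l \<in> ?L"
    then obtain h where h: "h \<in> Units M" "l = map (\<xi> h) (map (\<xi> g) ks)" by blast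
    then have "l = map (\<xi> (h \<otimes> g)) ks" using g ks mult by (auto simp: Units_closed)
    moreover have "h \<otimes> g \<in> Units M" using h g by simp
    ultimately show "l \<in> ?R" by blast
  qed
  show "?R \<subseteq> ?L"
  proof
    fix l assume "l \<in> ?R"
    then obtain h where h: "h \<in> Units M" "l = map (\<xi> h) ks" by blast
    have "\<xi> (h \<otimes> inv g) (\<xi> g k) = \<xi> h k" if "k \<in> X" for k
      using that g h(1) mult maps_in[of g k] units_inverse(2)[OF g that]
      by (simp add: Units_closed Units_inv_closed)
    then have "l = map (\<xi> (h \<otimes> inv g)) (map (\<xi> g) ks)" using h(2) ks by auto
    moreover have "h \<otimes> inv g \<in> Units M" using h g by simp
    ultimately show "l \<in> ?L" by blast
  qed
qed

lemma oligomorphic_iff: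
  "oligomorphic X (\<xi> ` Units M) \<longleftrightarrow>
    (\<forall>n\<ge>1. finite ((\<lambda>xs. {map (\<xi> g) xs | g. g \<in> Units M}) ` nlists n X))"
proof -
  have "orbits (BijGroup X\<lparr>carrier := \<xi> ` Units M\<rparr>) (nlists n X) map =
      (\<lambda>xs. {map (\<xi> g) xs | g. g \<in> Units M}) ` nlists n X" for n
    unfolding orbits_def orbit_def by auto
  then show ?thesis using subgroup_units by (simp add: oligomorphic_def)
qed

end

text \<open>Used to choose representatives of finitely many orbits or types.\<close>
lemma finite_image_representatives:
  assumes "finite (f ` A)"
  obtains P where "finite P" "P \<subseteq> A" "\<And>x. x \<in> A \<Longrightarrow> \<exists>y\<in>P. f y = f x"
  using finite_subset_image[OF assms subset_refl] by (metis imageE image_eqI)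

section \<open>An ultrametric from an oligomorphic representation\<close>

text \<open>The segment \<open>{..<r}\<close> meets every orbit of the units; it exists if there are finitely many orbits.\<close>
locale transversal_representation = faithful_representation M T "UNIV :: nat set" \<xi>
  for M :: "('a, 'm) monoid_scheme" (structure) and T and \<xi> +
  fixes r :: nat
  assumes transversal: "\<exists>g\<in>Units M. \<exists>p<r. \<xi> g p = k"
begin

text \<open>
  Truncated subtraction gives the maximal distance to all pairs that differ somewhere on the
  transversal, so that \<open>d x y < 1/2\<close> implies that \<open>x\<close> and \<open>y\<close> agree there.
\<close>
definition d :: "'a \<Rightarrow> 'a \<Rightarrow> real" where
  "d x y = (if \<xi> x = \<xi> y then 0 else 1 / real (Suc ((LEAST k. \<xi> x k \<noteq> \<xi> y k) - r)))"

lemma eq_iff: "x \<in> carrier M \<Longrightarrow> y \<in> carrier M \<Longrightarrow> \<xi> x = \<xi> y \<longleftrightarrow> x = y"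
  using inj by (simp add: inj_on_eq_iff)

lemma d_nonneg: "0 \<le> d x y"
  by (simp add: d_def)

lemma d_sym: "d x y = d y x"
proof -
  have "(\<lambda>k. \<xi> x k \<noteq> \<xi> y k) = (\<lambda>k. \<xi> y k \<noteq> \<xi> x k)" by auto
  then show ?thesis by (auto simp: d_def)
qed

text \<open>
  All properties of \<open>d\<close> are derived from this description of the balls of radius \<open>1 / (m + 1)\<close>.
\<close>
lemma d_less_iff: "d x y < 1 / real (Suc m) \<longleftrightarrow> (\<forall>k\<le>r + m. \<xi> x k = \<xi> y k)"
proof (cases "\<xi> x = \<xi> y")
  case False
  define j where "j = (LEAST k. \<xi> x k \<noteq> \<xi> y k)"
  from False have "\<exists>k. \<xi> x k \<noteq> \<xi> y k" by auto
  then have j: "\<xi> x j \<noteq> \<xi> y j" unfolding j_def by (rule LeastI_ex)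
  have below: "\<xi> x k = \<xi> y k" if "k < j" for k using not_less_Least that unfolding j_def by blast
  have "d x y < 1 / real (Suc m) \<longleftrightarrow> m < j - r"
    using False by (simp add: d_def j_def field_simps)
  also have "\<dots> \<longleftrightarrow> r + m < j" by auto
  also have "\<dots> \<longleftrightarrow> (\<forall>k\<le>r + m. \<xi> x k = \<xi> y k)"
    using j below by (meson le_less_trans not_le)
  finally show ?thesis .
qed (simp add: d_def)

lemma d_cases:
  obtains "\<xi> x = \<xi> y" "d x y = 0" | m where "d x y = 1 / real (Suc m)"
  by (cases "\<xi> x = \<xi> y") (auto simp: d_def)

lemma d_le_if_agree:
  assumes "\<And>m. d a b < 1 / real (Suc m) \<Longrightarrow> d c e < 1 / real (Suc m) \<Longrightarrow> d x y < 1 / real (Suc m)"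
  shows "d x y \<le> max (d a b) (d c e)"
proof (rule ccontr)
  assume less: "\<not> d x y \<le> max (d a b) (d c e)"
  then have "d x y \<noteq> 0" using d_nonneg[of a b] by auto
  then obtain m where "d x y = 1 / real (Suc m)" by (rule_tac d_cases[of x y]) auto
  with assms[of m] less show False by (simp only: not_le max_less_iff_conj less_irrefl) blast
qed

lemma d_ultrametric: "d x z \<le> max (d x y) (d y z)"
proof (rule d_le_if_agree)
  show "d x z < 1 / real (Suc m)" if "d x y < 1 / real (Suc m)" "d y z < 1 / real (Suc m)" for m
    using that unfolding d_less_iff by simp
qed

lemma d_zero: "x \<in> carrier M \<Longrightarrow> y \<in> carrier M \<Longrightarrow> d x y = 0 \<longleftrightarrow> x = y"
  by (simp add: d_def eq_iff)

sublocale Metric_space "carrier M" d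
proof
  show "d x z \<le> d x y + d y z" for x y z
    using d_ultrametric[of x z y] d_nonneg[of x y] d_nonneg[of y z] by linarith
qed (use d_nonneg d_sym d_zero in auto)

lemma ultrametric_on_d: "ultrametric_on (carrier M) d"
  using d_ultrametric Metric_space_axioms by (auto simp: ultrametric_on_def)

lemma small_radius:
  assumes "\<epsilon> > 0"
  obtains m where "1 / real (Suc m) < \<epsilon>"
  using reals_Archimedean[OF assms] by (auto simp: inverse_eq_divide)

lemma compatible_metric_d: "compatible_metric T d"
proof -
  have "openin mtopology W \<longleftrightarrow> openin T W" for W
  proof
    assume W: "openin mtopology W"
    show "openin T W"
      unfolding open_iff finitely_determined_def
    proof (intro conjI ballI)
      show "W \<subseteq> carrier M" using openin_subset[OF W] by simp
      fix x assume "x \<in> W"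
      then obtain \<epsilon> where \<epsilon>: "\<epsilon> > 0" "mball x \<epsilon> \<subseteq> W" using W by (auto simp: openin_mtopology)
      obtain m where m: "1 / real (Suc m) < \<epsilon>" by (rule small_radius[OF \<epsilon>(1)])
      have "y \<in> W" if "y \<in> carrier M" "\<forall>k\<in>{..r + m}. \<xi> y k = \<xi> x k" for y
      proof -
        have "d x y < 1 / real (Suc m)" using that(2) by (simp only: d_less_iff) auto
        then have "y \<in> mball x \<epsilon>" using m that(1) \<open>x \<in> W\<close> \<open>W \<subseteq> carrier M\<close> by auto
        then show ?thesis using \<epsilon>(2) by blast
      qed
      then show "\<exists>K. finite K \<and> K \<subseteq> UNIV \<and> (\<forall>y\<in>carrier M. (\<forall>k\<in>K. \<xi> y k = \<xi> x k) \<longrightarrow> y \<in> W)"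
        by (intro exI[of _ "{..r + m}"]) auto
    qed
  next
    assume "openin T W"
    then have W: "finitely_determined UNIV (carrier M) \<xi> W" by (simp add: open_iff)
    show "openin mtopology W"
      unfolding openin_mtopology
    proof (intro conjI allI impI)
      show "W \<subseteq> carrier M" using W by (simp add: finitely_determined_def)
      fix x assume "x \<in> W"
      with W obtain K where K: "finite K" "\<forall>y\<in>carrier M. (\<forall>k\<in>K. \<xi> y k = \<xi> x k) \<longrightarrow> y \<in> W"
        unfolding finitely_determined_def by blast
      obtain m where m: "\<forall>k\<in>K. k \<le> m" using K(1) finite_nat_set_iff_bounded_le by auto
      have "mball x (1 / real (Suc m)) \<subseteq> W"
      proof
        fix y assume y: "y \<in> mball x (1 / real (Suc m))"
        then have "\<forall>k\<le>r + m. \<xi> x k = \<xi> y k" by (simp only: in_mball flip: d_less_iff)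
        then have "\<forall>k\<in>K. \<xi> y k = \<xi> x k" using m by (metis trans_le_add2)
        then show "y \<in> W" using K(2) y by auto
      qed
      then show "\<exists>\<epsilon>>0. mball x \<epsilon> \<subseteq> W" by (intro exI[of _ "1 / real (Suc m)"]) auto
    qed
  qed
  then have "mtopology = T" by (simp add: topology_eq)
  then show ?thesis using topspace_eq Metric_space_axioms by (simp add: compatible_metric_def)
qed

lemma left_nonexpansive_d: "left_nonexpansive M d"
  unfolding left_nonexpansive_def
proof (intro ballI)
  fix g f f' assume "g \<in> carrier M" "f \<in> carrier M" "f' \<in> carrier M"
  then have "d (g \<otimes> f) (g \<otimes> f') \<le> max (d f f') (d f f')"
    by (intro d_le_if_agree) (simp add: d_less_iff mult del: of_nat_Suc)
  then show "d (g \<otimes> f) (g \<otimes> f') \<le> d f f'" by simp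
qed

text \<open>
  If \<open>k = g\<^sub>k p\<^sub>k\<close> with \<open>p\<^sub>k < r\<close>, then \<open>x k = (x g\<^sub>k) p\<^sub>k\<close>. So \<open>x\<close> and \<open>y\<close> agree at \<open>k\<close> as soon as \<open>x g\<^sub>k\<close> and
  \<open>y g\<^sub>k\<close> are closer than \<open>1/2\<close>.
\<close>
lemma finitely_generated_d: "finitely_generated_metric M (Units M) d"
  unfolding finitely_generated_metric_def
proof (intro allI impI)
  fix \<epsilon> :: real assume "\<epsilon> > 0"
  then obtain m where m: "1 / real (Suc m) < \<epsilon>" by (rule small_radius)
  obtain g p where gp: "\<And>k. g k \<in> Units M \<and> p k < r \<and> \<xi> (g k) (p k) = k"
    using transversal by metis
  have "d x y < \<epsilon>" if "x \<in> carrier M" "y \<in> carrier M"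
    "\<forall>h\<in>g ` {..r + m}. d (x \<otimes> h) (y \<otimes> h) < 1/2" for x y
  proof -
    have "\<xi> x k = \<xi> y k" if "k \<le> r + m" for k
    proof -
      have "d (x \<otimes> g k) (y \<otimes> g k) < 1 / real (Suc 1)"
        using \<open>\<forall>h\<in>_. _\<close> that by simp
      then have "\<xi> (x \<otimes> g k) (p k) = \<xi> (y \<otimes> g k) (p k)"
        using gp[of k] by (simp only: d_less_iff) (meson le_add1 less_imp_le order_trans)
      then show ?thesis
        using gp[of k] mult \<open>x \<in> carrier M\<close> \<open>y \<in> carrier M\<close> by (simp add: Units_closed)
    qed
    then have "d x y < 1 / real (Suc m)" by (simp only: d_less_iff) blast
    then show ?thesis using m by simp
  qed
  then show "\<exists>F. finite F \<and> F \<subseteq> Units M \<and> (\<forall>x\<in>carrier M. \<forall>y\<in>carrier M.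
      (\<forall>g\<in>F. d (x \<otimes> g) (y \<otimes> g) < 1/2) \<longrightarrow> d x y < \<epsilon>)"
    using gp by (intro exI[of _ "g ` {..r + m}"]) auto
qed

text \<open>A Cauchy sequence is eventually constant at each number; its pointwise limit is in the closed image.\<close>
lemma mcomplete_d:
  assumes "closedin (pointwise_topology UNIV) (\<xi> ` carrier M)"
  shows mcomplete
  unfolding mcomplete_def
proof (intro allI impI)
  fix s assume s: "MCauchy s"
  then have s_in: "s n \<in> carrier M" for n by (auto simp: MCauchy_def)
  have "\<exists>N. \<forall>n\<ge>N. \<forall>k\<le>r + m. \<xi> (s n) k = \<xi> (s N) k" for m
  proof -
    have "(0::real) < 1 / real (Suc m)" by simp
    with s obtain N where "\<forall>n n'. N \<le> n \<longrightarrow> N \<le> n' \<longrightarrow> d (s n) (s n') < 1 / real (Suc m)"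
      unfolding MCauchy_def by blast
    then show ?thesis by (simp only: d_less_iff) (metis order_refl)
  qed
  then obtain N where N: "\<And>m n k. n \<ge> N m \<Longrightarrow> k \<le> r + m \<Longrightarrow> \<xi> (s n) k = \<xi> (s (N m)) k" by metis
  define f where "f k = \<xi> (s (N k)) k" for k
  have limit: "\<xi> (s n) k = f k" if "n \<ge> N m" "k \<le> r + m" for m n k
    using N[of m n k] N[of m "max (N m) (N k)" k] N[of k "max (N m) (N k)" k] that by (simp add: f_def)
  have "\<exists>f'\<in>\<xi> ` carrier M. \<forall>k\<in>K. f' k = f k" if "finite K" for K
  proof -
    from that obtain m where "\<forall>k\<in>K. k \<le> m" using finite_nat_set_iff_bounded_le by auto
    then have "\<forall>k\<in>K. \<xi> (s (N m)) k = f k" using limit[of m "N m"] by (metis order_refl trans_le_add2)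
    then show ?thesis using s_in by blast
  qed
  then have "f \<in> \<xi> ` carrier M"
    using assms maps closedin_pointwise_topology[of "\<xi> ` carrier M" UNIV] by blast
  then obtain x where x: "x \<in> carrier M" "\<xi> x = f" by blast
  have "\<exists>N. \<forall>n\<ge>N. s n \<in> carrier M \<and> d (s n) x < \<epsilon>" if "\<epsilon> > 0" for \<epsilon>
  proof -
    from that obtain m where m: "1 / real (Suc m) < \<epsilon>" by (rule small_radius)
    have "d (s n) x < 1 / real (Suc m)" if "n \<ge> N m" for n
      using limit[OF that] x(2) by (simp only: d_less_iff) blast
    then show ?thesis using m s_in by (intro exI[of _ "N m"]) (meson less_trans)
  qed
  then show "\<exists>x. limitin mtopology s x sequentially"
    using x(1) by (auto simp: limit_metric_sequentially)
qed

text \<open>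
  Up to distance \<open>\<epsilon>\<close>, an \<open>n\<close>-tuple of elements of \<open>M\<close> is the \<open>n L\<close>-tuple of its values on \<open>{..<L}\<close>
  (\<open>code\<close>), and there are finitely many orbits of such tuples of numbers.
\<close>
lemma approximately_oligomorphic_d:
  assumes "oligomorphic UNIV (\<xi> ` Units M)"
  shows "approximately_oligomorphic (Units M) (\<otimes>) (carrier M) d"
  unfolding approximately_oligomorphic_def
proof (intro allI impI)
  fix n :: nat and \<epsilon> :: real assume "n \<ge> 1" "\<epsilon> > 0"
  obtain m where m: "1 / real (Suc m) < \<epsilon>" by (rule small_radius[OF \<open>\<epsilon> > 0\<close>])
  define L where "L = Suc (r + m)"
  define code where "code xs = concat (map (\<lambda>x. map (\<xi> x) [0..<L]) xs)" for xs
  define orb where "orb ks = {map (\<xi> g) ks | g. g \<in> Units M}" for ks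
  have "length (code xs) = length xs * L" for xs by (induction xs) (auto simp: code_def)
  then have code_in: "code xs \<in> nlists (n * L) UNIV" if "xs \<in> nlists n (carrier M)" for xs
    using nlistsE_length[OF that] by (simp add: in_nlists_UNIV)
  have "n * L \<ge> 1" using \<open>n \<ge> 1\<close> by (simp add: L_def)
  then have "finite (orb ` nlists (n * L) UNIV)"
    using assms unfolding oligomorphic_iff orb_def by blast
  then have "finite ((\<lambda>xs. orb (code xs)) ` nlists n (carrier M))"
    by (rule rev_finite_subset) (use code_in in auto)
  then obtain F where F: "finite F" "F \<subseteq> nlists n (carrier M)"
    "\<And>x. x \<in> nlists n (carrier M) \<Longrightarrow> \<exists>y\<in>F. orb (code y) = orb (code x)"
    by (rule finite_image_representatives) blast
  have "\<exists>y\<in>F. orbit_dist (Units M) (\<otimes>) d n x y < \<epsilon>" if x: "x \<in> nlists n (carrier M)" for x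
  proof -
    obtain y where y: "y \<in> F" "orb (code y) = orb (code x)" using F(3)[OF x] by blast
    have "code x = map (\<xi> \<one>) (code x)" using one by (simp add: map_idI)
    then have "code x \<in> orb (code x)" unfolding orb_def using Units_one_closed by blast
    with y(2) obtain g where g: "g \<in> Units M" "code x = map (\<xi> g) (code y)" unfolding orb_def by auto
    have len: "length x = n" "length y = n" and in_M: "set x \<subseteq> carrier M" "set y \<subseteq> carrier M"
      using x y(1) F(2) nlistsE_length nlistsE_set by blast+
    have blocks: "\<forall>i<length xs. \<forall>k<L. \<xi> (xs ! i) k = \<xi> g (\<xi> (ys ! i) k)"
      if "length xs = length ys" "code xs = map (\<xi> g) (code ys)" for xs ys
      using that
    proof (induction xs ys rule: list_induct2)
      case (Cons a xs b ys)
      then have "map (\<xi> a) [0..<L] = map (\<xi> g) (map (\<xi> b) [0..<L])" "code xs = map (\<xi> g) (code ys)"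
        by (auto simp: code_def)
      with Cons.IH show ?case by (auto simp: nth_Cons split: nat.split)
    qed simp
    have close: "d (x ! i) (g \<otimes> y ! i) < 1 / real (Suc m)" if "i < n" for i
    proof -
      have "y ! i \<in> carrier M" using that len in_M by auto
      then have "\<forall>k\<le>r + m. \<xi> (x ! i) k = \<xi> (g \<otimes> y ! i) k"
        using blocks[OF _ g(2)] len that mult[of g "y ! i"] g(1) by (simp add: L_def Units_closed)
      then show ?thesis by (simp only: d_less_iff)
    qed
    have "orbit_dist (Units M) (\<otimes>) d n x y \<le> Max ((\<lambda>i. d (x ! i) (g \<otimes> y ! i)) ` {..<n})"
      unfolding orbit_dist_def
    proof (rule cINF_lower[OF _ g(1)])
      have "0 \<le> Max ((\<lambda>i. d (x ! i) (h \<otimes> y ! i)) ` {..<n})" for h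
        using \<open>n \<ge> 1\<close>
        by (intro order_trans[OF d_nonneg Max_ge[OF _ imageI[of 0]]]) auto
      then show "bdd_below ((\<lambda>h. Max ((\<lambda>i. d (x ! i) (h \<otimes> y ! i)) ` {..<n})) ` Units M)"
        by (intro bdd_belowI2)
    qed
    also have "\<dots> < \<epsilon>"
    proof -
      have "(\<lambda>i. d (x ! i) (g \<otimes> y ! i)) ` {..<n} \<noteq> {}" using \<open>n \<ge> 1\<close> by (auto simp: lessThan_empty_iff)
      then show ?thesis using close m by (subst Max_less_iff) (auto intro: less_trans)
    qed
    finally show ?thesis using y(1) by blast
  qed
  then show "\<exists>F. finite F \<and> F \<subseteq> nlists n (carrier M) \<and>
      (\<forall>x\<in>nlists n (carrier M). \<exists>y\<in>F. orbit_dist (Units M) (\<otimes>) d n x y < \<epsilon>)"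
    using F(1,2) by blast
qed

lemma infinite_carrier: "infinite (carrier M)"
proof
  assume "finite (carrier M)"
  then have "finite (Units M)" by (rule rev_finite_subset) (auto simp: Units_def)
  then have "finite ((\<lambda>(g, p). \<xi> g p) ` (Units M \<times> {..<r}))" by simp
  moreover have "k \<in> (\<lambda>(g, p). \<xi> g p) ` (Units M \<times> {..<r})" for k
    using transversal[of k] by (force simp: image_iff)
  ultimately have "finite (UNIV :: nat set)" by (metis UNIV_eq_I)
  then show False by simp
qed

text \<open>
  The restriction of a transformation to \<open>{..<m}\<close> takes countably many values (\<open>code m\<close>), and the
  dense set contains one element for each of them and each \<open>m\<close>.
\<close>
lemma separable: "separable_space T"
proof -
  define code where "code m x = map (\<xi> x) [0..<m]" for m x
  have "\<exists>C. countable C \<and> C \<subseteq> carrier M \<and> code m ` C = code m ` carrier M" for m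
    using countable_subset_image[of "code m ` carrier M" "code m" "carrier M"] by (metis countableI_type subset_refl)
  then obtain C where C: "\<And>m. countable (C m) \<and> C m \<subseteq> carrier M \<and> code m ` C m = code m ` carrier M"
    by metis
  have "T closure_of (\<Union>m. C m) = topspace T"
  proof (rule subset_antisym[OF closure_of_subset_topspace] , rule subsetI)
    fix x assume x: "x \<in> topspace T"
    show "x \<in> T closure_of (\<Union>m. C m)"
      unfolding in_closure_of
    proof (intro conjI x allI impI)
      fix W assume W: "x \<in> W \<and> openin T W"
      then obtain K where K: "finite K" "\<forall>y\<in>carrier M. (\<forall>k\<in>K. \<xi> y k = \<xi> x k) \<longrightarrow> y \<in> W"
        unfolding open_iff finitely_determined_def by blast
      obtain m where m: "\<forall>k\<in>K. k < m" using K(1) finite_nat_set_iff_bounded by auto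
      have "code m x \<in> code m ` C m" using C x topspace_eq by auto
      then obtain y where y: "y \<in> C m" "code m y = code m x" by (metis imageE)
      then have "\<forall>k\<in>K. \<xi> y k = \<xi> x k" using m by (auto simp: code_def)
      then show "\<exists>y. y \<in> (\<Union>m. C m) \<and> y \<in> W" using K(2) y(1) C by blast
    qed
  qed
  moreover have "countable (\<Union>m. C m)" "(\<Union>m. C m) \<subseteq> topspace T" using C topspace_eq by auto
  ultimately show ?thesis unfolding separable_space_def by blast
qed

end

lemma transversal_exists:
  fixes M (structure)
  assumes "faithful_representation M T (UNIV :: nat set) \<xi>" "oligomorphic UNIV (\<xi> ` Units M)"
  obtains r where "transversal_representation M T \<xi> r"
proof -
  interpret faithful_representation M T "UNIV :: nat set" \<xi> by fact
  define orb where "orb ks = {map (\<xi> g) ks | g. g \<in> Units M}" for ks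
  have "finite (orb ` nlists 1 UNIV)"
    using assms(2) unfolding oligomorphic_iff orb_def by blast
  then obtain P where P: "finite P" "P \<subseteq> nlists 1 UNIV"
    "\<And>ks. ks \<in> nlists 1 UNIV \<Longrightarrow> \<exists>ps\<in>P. orb ps = orb ks"
    by (rule finite_image_representatives) blast
  have "finite (hd ` P)" using P(1) by simp
  then obtain r where r: "\<forall>p\<in>hd ` P. p < r" using finite_nat_set_iff_bounded by blast
  have "\<exists>g\<in>Units M. \<exists>p<r. \<xi> g p = k" for k
  proof -
    have "[k] \<in> nlists 1 UNIV" by (simp add: in_nlists_UNIV)
    then have "\<exists>ps\<in>P. orb ps = orb [k]" by (rule P(3))
    then obtain ps where ps: "ps \<in> P" "orb ps = orb [k]" ..
    have "[k] = map (\<xi> \<one>) [k]" using one by simp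
    then have "[k] \<in> orb [k]"
      unfolding orb_def using Units_one_closed by (intro CollectI exI[of _ "\<one>"] conjI)
    then have "[k] \<in> orb ps" by (simp only: ps(2))
    then obtain g where "g \<in> Units M" "[k] = map (\<xi> g) ps" unfolding orb_def by auto
    then show ?thesis using r ps(1) by (intro bexI[of _ g] exI[of _ "hd ps"]) auto
  qed
  then have "transversal_representation M T \<xi> r" by unfold_locales
  then show thesis by (rule that)
qed

section \<open>The uniformity generated by an equivalence relation\<close>

context topological_monoid
begin

lemma Units_cancel: "g \<in> Units M \<Longrightarrow> x \<in> carrier M \<Longrightarrow> inv g \<otimes> (g \<otimes> x) = x"
  by (simp add: Units_closed Units_inv_closed flip: m_assoc)

lemma continuous_right_mult:
  assumes "g \<in> carrier M"
  shows "continuous_map T T (\<lambda>x. x \<otimes> g)"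
proof -
  have "continuous_map T (prod_topology T T) (\<lambda>x. (x, g))"
    using assms topspace_eq by (intro continuous_map_pairedI) auto
  from continuous_map_compose[OF this continuous_mult] show ?thesis by (simp add: o_def)
qed

definition entourage :: "'a rel \<Rightarrow> 'a set \<Rightarrow> 'a rel" where
  "entourage V F = {(x, y). x \<in> carrier M \<and> y \<in> carrier M \<and> (\<forall>g\<in>F. (x \<otimes> g, y \<otimes> g) \<in> V)}"

definition generated_uniformity :: "'a rel \<Rightarrow> 'a rel set" where
  "generated_uniformity V =
     {U. U \<subseteq> carrier M \<times> carrier M \<and> (\<exists>F. finite F \<and> F \<subseteq> Units M \<and> entourage V F \<subseteq> U)}"

lemma is_uniformity_generated:
  assumes "equiv (carrier M) V"
  shows "is_uniformity (carrier M) (generated_uniformity V)"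
proof -
  have refl: "(x, x) \<in> V" if "x \<in> carrier M" for x using assms that by (auto simp: equiv_def refl_on_def)
  have sym: "(y, x) \<in> V" if "(x, y) \<in> V" for x y using assms that by (auto simp: equiv_def sym_def)
  have trans: "(x, z) \<in> V" if "(x, y) \<in> V" "(y, z) \<in> V" for x y z
    using assms that by (auto simp: equiv_def dest: transD)
  show ?thesis
    unfolding is_uniformity_def
  proof (intro conjI ballI allI impI)
    have "entourage V {} \<in> generated_uniformity V"
      by (auto simp: generated_uniformity_def entourage_def)
    then show "generated_uniformity V \<noteq> {}" by blast
    fix U assume U: "U \<in> generated_uniformity V"
    then obtain F where F: "finite F" "F \<subseteq> Units M" "entourage V F \<subseteq> U" "U \<subseteq> carrier M \<times> carrier M"
      by (auto simp: generated_uniformity_def)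
    show "U \<subseteq> carrier M \<times> carrier M" by (rule F(4))
    show "Id_on (carrier M) \<subseteq> U"
    proof
      fix p assume "p \<in> Id_on (carrier M)"
      then have "p \<in> entourage V F" using refl F(2) Units_closed by (auto simp: entourage_def)
      then show "p \<in> U" using F(3) by blast
    qed
    show "W \<in> generated_uniformity V" if "U \<subseteq> W \<and> W \<subseteq> carrier M \<times> carrier M" for W
      using that F(1-3) unfolding generated_uniformity_def by blast
    have "(entourage V F)\<inverse> = entourage V F" using sym by (auto simp: entourage_def)
    then have "entourage V F \<subseteq> U\<inverse>" using F(3) by (metis converse_mono)
    moreover have "U\<inverse> \<subseteq> carrier M \<times> carrier M" using F(4) by auto
    ultimately show "U\<inverse> \<in> generated_uniformity V"
      using F(1,2) unfolding generated_uniformity_def by simp blast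
    show "\<exists>W\<in>generated_uniformity V. W O W \<subseteq> U"
    proof
      show "entourage V F \<in> generated_uniformity V"
        using F(1,2) by (auto simp: generated_uniformity_def entourage_def)
      show "entourage V F O entourage V F \<subseteq> U" using F(3) trans by (fastforce simp: entourage_def)
    qed
    fix W assume "W \<in> generated_uniformity V"
    then obtain F' where F': "finite F'" "F' \<subseteq> Units M" "entourage V F' \<subseteq> W"
      by (auto simp: generated_uniformity_def)
    have "entourage V (F \<union> F') \<subseteq> U \<inter> W" using F(3) F'(3) by (auto simp: entourage_def)
    moreover have "finite (F \<union> F')" "F \<union> F' \<subseteq> Units M" using F F' by auto
    ultimately show "U \<inter> W \<in> generated_uniformity V"
      using F(4) unfolding generated_uniformity_def by blast
  qed
qed

lemma uniformity_base_generated: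
  "uniformity_base {entourage V F | F. finite F \<and> F \<subseteq> Units M} (generated_uniformity V)"
proof -
  have "entourage V F \<subseteq> carrier M \<times> carrier M" for F by (auto simp: entourage_def)
  then show ?thesis unfolding uniformity_base_def generated_uniformity_def by blast
qed

end

section \<open>A left invariant equivalence relation from a metric\<close>
locale metric_monoid = topological_monoid M T + Metric_space "carrier M" d
  for M :: "('a, 'm) monoid_scheme" (structure) and T and d +
  assumes mtopology: "mtopology = T"
    and generated: "finitely_generated_metric M (Units M) d"
    and complete: mcomplete
    and nonexpansive: "left_nonexpansive M d"
    and ultrametric: "ultrametric_on (carrier M) d"
    and approx_oligomorphic: "approximately_oligomorphic (Units M) (\<otimes>) (carrier M) d"
    and infinite_separable: "denumerably_separable T"
begin

definition V :: "'a rel" where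
  "V = {(x, y). x \<in> carrier M \<and> y \<in> carrier M \<and> d x y < 1/2}"

lemma equiv_V: "equiv (carrier M) V"
proof (rule equivI)
  show "V \<subseteq> carrier M \<times> carrier M" by (auto simp: V_def)
  show "refl_on (carrier M) V" by (auto simp: V_def refl_on_def)
  show "sym V" by (auto simp: V_def sym_def commute)
  show "trans V"
  proof (rule transI)
    fix x y z assume "(x, y) \<in> V" "(y, z) \<in> V"
    moreover from this have "d x z \<le> max (d x y) (d y z)"
      using ultrametric by (auto simp: ultrametric_on_def V_def)
    ultimately show "(x, z) \<in> V" by (auto simp: V_def)
  qed
qed

lemma left_invariant_V: "left_invariant M V"
  unfolding left_invariant_def
proof (intro ballI impI)
  fix x y z assume xyz: "x \<in> carrier M" "y \<in> carrier M" "z \<in> carrier M" "(y, z) \<in> V"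
  then have "d (x \<otimes> y) (x \<otimes> z) \<le> d y z"
    using nonexpansive unfolding left_nonexpansive_def by blast
  with xyz show "(x \<otimes> y, x \<otimes> z) \<in> V" by (simp add: V_def)
qed

lemma openin_ball: "x \<in> carrier M \<Longrightarrow> openin T (mball x \<epsilon>)"
  using mtopology openin_mball by metis

text \<open>
  The metric is generated by the relation \<open>V\<close> and right translations by units.
\<close>
lemma separated:
  assumes "x \<in> carrier M" "y \<in> carrier M" "\<forall>g\<in>Units M. (x \<otimes> g, y \<otimes> g) \<in> V"
  shows "x = y"
proof (rule ccontr)
  assume "x \<noteq> y"
  with assms have "d x y > 0" by simp
  with generated obtain F where F: "F \<subseteq> Units M" "\<forall>x'\<in>carrier M. \<forall>y'\<in>carrier M.
      (\<forall>g\<in>F. d (x' \<otimes> g) (y' \<otimes> g) < 1/2) \<longrightarrow> d x' y' < d x y"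
    unfolding finitely_generated_metric_def by meson
  have "\<forall>g\<in>F. d (x \<otimes> g) (y \<otimes> g) < 1/2" using assms(3) F(1) by (auto simp: V_def)
  then have "d x y < d x y" using F(2) assms(1,2) by blast
  then show False by simp
qed

text \<open>The classes are balls of radius \<open>1/2\<close>, and each of them meets a countable dense set.\<close>
lemma countable_quotient: "countable (carrier M // V)"
proof -
  obtain D where D: "countable D" "D \<subseteq> carrier M" "T closure_of D = carrier M"
    using infinite_separable topspace_eq by (auto simp: denumerably_separable_def denumerable_def)
  have "\<exists>z\<in>D. V `` {x} = V `` {z}" if x: "x \<in> carrier M" for x
  proof -
    have "x \<in> T closure_of D" using x D(3) by simp
    moreover have "x \<in> mball x (1/2)" using x by simp
    ultimately obtain z where "z \<in> D" "z \<in> mball x (1/2)"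
      using openin_ball[OF x, of "1/2"] unfolding in_closure_of by blast
    then have "(x, z) \<in> V" by (simp add: V_def)
    then show ?thesis using \<open>z \<in> D\<close> equiv_class_eq[OF equiv_V] by blast
  qed
  then have "carrier M // V \<subseteq> (\<lambda>z. V `` {z}) ` D" by (auto elim!: quotientE)
  then show ?thesis by (rule countable_subset) (simp add: D(1))
qed

text \<open>
  Left multiplication is an action on the set of classes because \<open>V\<close> is left invariant, and it is
  faithful because \<open>x\<close> is determined by the classes of \<open>x \<otimes> g\<close> for units \<open>g\<close>. A finite set of classes
  would have finitely many self-maps only, and \<open>M\<close> would be finite.
\<close>
lemma infinite_quotient: "infinite (carrier M // V)"
proof
  assume fin: "finite (carrier M // V)"
  define rep where "rep C = (SOME z. z \<in> C)" for C :: "'a set"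
  have rep: "rep C \<in> carrier M" "(z, rep C) \<in> V" if "z \<in> carrier M" "C = V `` {z}" for z C
  proof -
    have "z \<in> C" using that by (simp add: V_def)
    then have "rep C \<in> C" unfolding rep_def by (rule someI)
    then show "rep C \<in> carrier M" "(z, rep C) \<in> V" using that by (auto simp: V_def)
  qed
  define act where "act x = (\<lambda>C\<in>carrier M // V. V `` {x \<otimes> rep C})" for x
  have "act x \<in> carrier M // V \<rightarrow>\<^sub>E carrier M // V" if "x \<in> carrier M" for x
    using that rep by (auto simp: act_def elim!: quotientE intro!: quotientI)
  then have "act ` carrier M \<subseteq> carrier M // V \<rightarrow>\<^sub>E carrier M // V" by blast
  then have "finite (act ` carrier M)" using fin finite_PiE finite_subset by metis
  moreover have "inj_on act (carrier M)"
  proof (rule inj_onI)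
    fix x y assume xy: "x \<in> carrier M" "y \<in> carrier M" "act x = act y"
    show "x = y"
    proof (rule separated[OF xy(1,2)], rule ballI)
      fix g assume "g \<in> Units M"
      then have g: "g \<in> carrier M" by (rule Units_closed)
      define C where "C = V `` {g}"
      have C: "C \<in> carrier M // V" unfolding C_def using g by (rule quotientI)
      note r = rep[OF g C_def]
      have "(x \<otimes> g, x \<otimes> rep C) \<in> V" "(y \<otimes> g, y \<otimes> rep C) \<in> V"
        using left_invariant_V xy(1,2) g r unfolding left_invariant_def by blast+
      moreover have "V `` {x \<otimes> rep C} = V `` {y \<otimes> rep C}"
        using fun_cong[OF xy(3), of C] C by (simp add: act_def)
      ultimately show "(x \<otimes> g, y \<otimes> g) \<in> V"
        using equiv_class_eq[OF equiv_V] eq_equiv_class[OF _ equiv_V] xy(1,2) g by (metis m_closed)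
    qed
  qed
  ultimately have "finite (carrier M)" by (rule finite_imageD)
  then show False using infinite_separable topspace_eq by (simp add: denumerably_separable_iff)
qed

lemma small_entourage:
  assumes "\<epsilon> > 0"
  obtains F where "finite F" "F \<subseteq> Units M" "\<And>x y. (x, y) \<in> entourage V F \<Longrightarrow> d x y < \<epsilon>"
proof -
  from generated assms obtain F where F: "finite F" "F \<subseteq> Units M" "\<forall>x\<in>carrier M. \<forall>y\<in>carrier M.
      (\<forall>g\<in>F. d (x \<otimes> g) (y \<otimes> g) < 1/2) \<longrightarrow> d x y < \<epsilon>"
    unfolding finitely_generated_metric_def by meson
  then have "d x y < \<epsilon>" if "(x, y) \<in> entourage V F" for x y
    using that by (auto simp: entourage_def V_def)
  with F show thesis by (intro that)
qed

text \<open>Right translations are continuous, and the section of the entourage at \<open>x\<close> is an intersection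
  of finitely many preimages of balls.\<close>
lemma openin_entourage:
  assumes x: "x \<in> carrier M" and "finite F" "F \<subseteq> Units M"
  shows "openin T (entourage V F `` {x})"
  using assms(2,3)
proof (induction F)
  case empty
  have "entourage V {} `` {x} = topspace T" using x topspace_eq by (auto simp: entourage_def)
  then show ?case by simp
next
  case (insert g F)
  have g: "g \<in> carrier M" using insert.prems by (auto intro: Units_closed)
  have "entourage V (insert g F) `` {x} =
      {y \<in> topspace T. y \<otimes> g \<in> mball (x \<otimes> g) (1/2)} \<inter> entourage V F `` {x}"
    using x g topspace_eq by (auto simp: entourage_def V_def)
  moreover have "openin T {y \<in> topspace T. y \<otimes> g \<in> mball (x \<otimes> g) (1/2)}"
    using continuous_right_mult[OF g] openin_ball[of "x \<otimes> g"] x g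
    by (intro openin_continuous_map_preimage) auto
  ultimately show ?case using insert by auto
qed

lemma compatible: "compatible_uniformity T (generated_uniformity V)"
  unfolding compatible_uniformity_def
proof (intro allI iffI conjI ballI)
  fix W assume W: "openin T W"
  then show "W \<subseteq> topspace T" by (rule openin_subset)
  fix x assume "x \<in> W"
  with W obtain \<epsilon> where \<epsilon>: "\<epsilon> > 0" "mball x \<epsilon> \<subseteq> W" using openin_mtopology mtopology by metis
  obtain F where F: "finite F" "F \<subseteq> Units M" "\<And>x y. (x, y) \<in> entourage V F \<Longrightarrow> d x y < \<epsilon>"
    by (rule small_entourage[OF \<epsilon>(1)]) blast
  have "entourage V F `` {x} \<subseteq> mball x \<epsilon>" using F(3) by (auto simp: entourage_def)
  moreover have "entourage V F \<in> generated_uniformity V"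
    using F(1,2) by (auto simp: generated_uniformity_def entourage_def)
  ultimately show "\<exists>U\<in>generated_uniformity V. U `` {x} \<subseteq> W" using \<epsilon>(2) by blast
next
  fix W assume W: "W \<subseteq> topspace T \<and> (\<forall>x\<in>W. \<exists>U\<in>generated_uniformity V. U `` {x} \<subseteq> W)"
  show "openin T W"
  proof (subst openin_subopen, intro ballI)
    fix x assume "x \<in> W"
    with W obtain U where "U \<in> generated_uniformity V" "U `` {x} \<subseteq> W" by blast
    then obtain F where F: "finite F" "F \<subseteq> Units M" "entourage V F `` {x} \<subseteq> W"
      unfolding generated_uniformity_def by blast
    have x: "x \<in> carrier M" using \<open>x \<in> W\<close> W topspace_eq by blast
    then have "x \<in> entourage V F `` {x}"
      using F(2) Units_closed by (auto simp: entourage_def V_def)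
    then show "\<exists>W'. openin T W' \<and> x \<in> W' \<and> W' \<subseteq> W" using openin_entourage[OF x F(1,2)] F(3) by blast
  qed
qed

text \<open>
  The uniformity refines that of the metric, so a Cauchy filter contains sets \<open>A n\<close> of diameter less
  than \<open>1 / (n + 1)\<close>. Points \<open>s n\<close> of the intersection of the first \<open>n + 1\<close> of these sets form a Cauchy
  sequence, and its limit is a limit of the filter. The passage back from the metric to the
  uniformity is made at one point only, where continuity of right translations suffices.
\<close>
lemma complete_uniformity: "complete_uniformity (carrier M) (generated_uniformity V)"
  unfolding complete_uniformity_def
proof (intro allI impI, elim conjE)
  fix \<F> :: "'a filter"
  assume F: "\<F> \<noteq> bot" "\<F> \<le> principal (carrier M)"
    and cauchy: "\<forall>U\<in>generated_uniformity V. \<exists>A. eventually (\<lambda>x. x \<in> A) \<F> \<and> A \<times> A \<subseteq> U"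
  have "\<exists>A. eventually (\<lambda>x. x \<in> A) \<F> \<and> (\<forall>x\<in>A. \<forall>y\<in>A. d x y < 1 / real (Suc n))" for n
  proof -
    have "1 / real (Suc n) > 0" by simp
    then obtain F where F: "finite F" "F \<subseteq> Units M"
      "\<And>x y. (x, y) \<in> entourage V F \<Longrightarrow> d x y < 1 / real (Suc n)"
      by (rule small_entourage) blast
    have "entourage V F \<in> generated_uniformity V"
      using F(1,2) by (auto simp: generated_uniformity_def entourage_def)
    with cauchy obtain A where "eventually (\<lambda>x. x \<in> A) \<F>" "A \<times> A \<subseteq> entourage V F" by blast
    then show ?thesis using F(3) by blast
  qed
  then obtain A where A: "\<And>n. eventually (\<lambda>x. x \<in> A n) \<F>"
    "\<And>n x y. x \<in> A n \<Longrightarrow> y \<in> A n \<Longrightarrow> d x y < 1 / real (Suc n)" by metis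
  have "\<exists>x. x \<in> carrier M \<and> (\<forall>m\<le>n. x \<in> A m)" for n
  proof -
    have "eventually (\<lambda>x. x \<in> carrier M) \<F>" using F(2) by (simp add: le_principal)
    moreover have "eventually (\<lambda>x. \<forall>m\<in>{..n}. x \<in> A m) \<F>"
      using A(1) by (intro eventually_ball_finite) auto
    ultimately have "eventually (\<lambda>x. x \<in> carrier M \<and> (\<forall>m\<in>{..n}. x \<in> A m)) \<F>"
      by (rule eventually_conj)
    then show ?thesis using F(1) eventually_happens by fastforce
  qed
  then obtain s where s: "\<And>n. s n \<in> carrier M" "\<And>n m. m \<le> n \<Longrightarrow> s n \<in> A m" by metis
  have "MCauchy s"
    unfolding MCauchy_def
  proof (intro conjI allI impI)
    show "range s \<subseteq> carrier M" using s(1) by blast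
    fix \<epsilon> :: real assume "\<epsilon> > 0"
    then obtain m where "1 / real (Suc m) < \<epsilon>" using reals_Archimedean by (auto simp: inverse_eq_divide)
    then show "\<exists>N. \<forall>n n'. N \<le> n \<longrightarrow> N \<le> n' \<longrightarrow> d (s n) (s n') < \<epsilon>"
      using A(2) s(2) by (meson less_trans)
  qed
  then obtain x where "limitin mtopology s x sequentially" using complete by (auto simp: mcomplete_def)
  then have x: "x \<in> carrier M" "\<And>\<epsilon>. \<epsilon> > 0 \<Longrightarrow> \<exists>N. \<forall>n\<ge>N. d (s n) x < \<epsilon>"
    unfolding limit_metric_sequentially by blast+
  have "eventually (\<lambda>y. (x, y) \<in> U) \<F>" if "U \<in> generated_uniformity V" for U
  proof -
    from that obtain F where F': "finite F" "F \<subseteq> Units M" "entourage V F \<subseteq> U"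
      unfolding generated_uniformity_def by blast
    have "x \<in> entourage V F `` {x}"
      using x(1) F'(2) Units_closed by (auto simp: entourage_def V_def)
    then obtain \<epsilon> where \<epsilon>: "\<epsilon> > 0" "mball x \<epsilon> \<subseteq> entourage V F `` {x}"
      using openin_entourage[OF x(1) F'(1,2)] openin_mtopology mtopology by metis
    from \<epsilon>(1) obtain m where m: "1 / real (Suc m) < \<epsilon>"
      using reals_Archimedean by (auto simp: inverse_eq_divide)
    from x(2)[OF \<epsilon>(1)] obtain N where N: "\<forall>n\<ge>N. d (s n) x < \<epsilon>" ..
    define n where "n = max m N"
    have "eventually (\<lambda>y. y \<in> carrier M) \<F>" using F(2) by (simp add: le_principal)
    then show ?thesis using A(1)[of m]
    proof eventually_elim
      case (elim y)
      have "d (s n) x < \<epsilon>" using N by (simp add: n_def)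
      moreover have "d (s n) y < \<epsilon>"
        using A(2)[OF s(2)[of m n] elim(2)] m by (simp add: n_def)
      moreover have "d x y \<le> max (d x (s n)) (d (s n) y)"
        using ultrametric s(1) x(1) elim(1) by (auto simp: ultrametric_on_def)
      ultimately have "d x y < \<epsilon>" using commute by (metis max_less_iff_conj order_le_less_trans)
      then have "y \<in> mball x \<epsilon>" using x(1) elim(1) by simp
      then show "(x, y) \<in> U" using \<epsilon>(2) F'(3) by blast
    qed
  qed
  then show "\<exists>x\<in>carrier M. \<forall>U\<in>generated_uniformity V. eventually (\<lambda>y. (x, y) \<in> U) \<F>"
    using x(1) by blast
qed

definition Vn :: "nat \<Rightarrow> 'a list rel" where
  "Vn n = {(x, y). x \<in> nlists n (carrier M) \<and> y \<in> nlists n (carrier M) \<and>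
    (\<exists>g\<in>Units M. \<forall>i<n. (x ! i, g \<otimes> y ! i) \<in> V)}"

lemma Vn_sym: "sym (Vn n)"
proof (rule symI)
  fix x y assume "(x, y) \<in> Vn n"
  then obtain g where xy: "x \<in> nlists n (carrier M)" "y \<in> nlists n (carrier M)"
    and g: "g \<in> Units M" "\<forall>i<n. (x ! i, g \<otimes> y ! i) \<in> V" by (auto simp: Vn_def)
  have "(y ! i, inv g \<otimes> x ! i) \<in> V" if "i < n" for i
  proof -
    have in_M: "x ! i \<in> carrier M" "y ! i \<in> carrier M" using xy nlistsE_nth_in that by blast+
    have "(inv g \<otimes> x ! i, inv g \<otimes> (g \<otimes> y ! i)) \<in> V"
      using left_invariant_V g that in_M unfolding left_invariant_def
      by (meson Units_closed Units_inv_closed m_closed)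
    then have "(inv g \<otimes> x ! i, y ! i) \<in> V" using Units_cancel[OF g(1) in_M(2)] by simp
    then show ?thesis using equiv_V by (meson equivE symE)
  qed
  then show "(y, x) \<in> Vn n" using xy g(1) Units_inv_Units unfolding Vn_def by blast
qed

lemma Vn_trans: "trans (Vn n)"
proof (rule transI)
  fix x y z assume "(x, y) \<in> Vn n" "(y, z) \<in> Vn n"
  then obtain g h where xyz: "x \<in> nlists n (carrier M)" "y \<in> nlists n (carrier M)" "z \<in> nlists n (carrier M)"
    and gh: "g \<in> Units M" "\<forall>i<n. (x ! i, g \<otimes> y ! i) \<in> V" "h \<in> Units M" "\<forall>i<n. (y ! i, h \<otimes> z ! i) \<in> V"
    by (auto simp: Vn_def)
  have "(x ! i, (g \<otimes> h) \<otimes> z ! i) \<in> V" if "i < n" for i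
  proof -
    have in_M: "y ! i \<in> carrier M" "z ! i \<in> carrier M" "g \<in> carrier M" "h \<in> carrier M"
      using xyz gh nlistsE_nth_in that Units_closed by blast+
    have "(g \<otimes> y ! i, g \<otimes> (h \<otimes> z ! i)) \<in> V"
      using left_invariant_V gh that in_M unfolding left_invariant_def by (meson m_closed)
    then show ?thesis
      using gh(2) that equiv_V in_M by (metis equivE m_assoc transD)
  qed
  then show "(x, z) \<in> Vn n" using xyz gh Units_m_closed unfolding Vn_def by blast
qed

text \<open>Orbit distance below \<open>1/2\<close> means that some unit brings all components into the same classes.\<close>
lemma finite_index_Vn:
  assumes "n \<ge> 1"
  shows "finite (nlists n (carrier M) // Vn n)"
proof -
  have "(1/2 :: real) > 0" by simp
  with approx_oligomorphic assms obtain F where F: "finite F" "F \<subseteq> nlists n (carrier M)"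
    "\<forall>x\<in>nlists n (carrier M). \<exists>y\<in>F. orbit_dist (Units M) (\<otimes>) d n x y < 1/2"
    unfolding approximately_oligomorphic_def by meson
  have "\<exists>y\<in>F. Vn n `` {x} = Vn n `` {y}" if x: "x \<in> nlists n (carrier M)" for x
  proof -
    from x F(3) obtain y where y: "y \<in> F" "orbit_dist (Units M) (\<otimes>) d n x y < 1/2" by blast
    have "0 \<le> Max ((\<lambda>i. d (x ! i) (h \<otimes> y ! i)) ` {..<n})" for h
      using assms by (intro order_trans[OF nonneg Max_ge[OF _ imageI[of 0]]]) auto
    then have "bdd_below ((\<lambda>h. Max ((\<lambda>i. d (x ! i) (h \<otimes> y ! i)) ` {..<n})) ` Units M)"
      by (intro bdd_belowI2)
    moreover have "Units M \<noteq> {}" by blast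
    ultimately obtain g where g: "g \<in> Units M" "Max ((\<lambda>i. d (x ! i) (g \<otimes> y ! i)) ` {..<n}) < 1/2"
      using y(2) unfolding orbit_dist_def by (subst (asm) cINF_less_iff) auto
    have "(x ! i, g \<otimes> y ! i) \<in> V" if "i < n" for i
    proof -
      have "d (x ! i) (g \<otimes> y ! i) \<le> Max ((\<lambda>i. d (x ! i) (g \<otimes> y ! i)) ` {..<n})"
        using that by (intro Max_ge) auto
      moreover have "x ! i \<in> carrier M" "y ! i \<in> carrier M" using x y(1) F(2) that nlistsE_nth_in by blast+
      ultimately show ?thesis using g by (simp add: V_def Units_closed)
    qed
    then have xy: "(x, y) \<in> Vn n" using x y(1) F(2) g(1) by (auto simp: Vn_def)
    then have "Vn n `` {x} = Vn n `` {y}" using Vn_sym Vn_trans by (auto dest: symD transD)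
    then show ?thesis using y(1) by blast
  qed
  then have "nlists n (carrier M) // Vn n \<subseteq> (\<lambda>y. Vn n `` {y}) ` F" by (auto elim!: quotientE)
  then show ?thesis using F(1) finite_subset by blast
qed

end

section \<open>A representation from a left invariant equivalence relation\<close>
locale uniform_monoid = topological_monoid M T
  for M :: "('a, 'm) monoid_scheme" (structure) and T +
  fixes V :: "'a rel" and \<U> :: "'a rel set"
  assumes Hausdorff: "Hausdorff_space T"
    and equiv_V: "equiv (carrier M) V"
    and left_invariant: "left_invariant M V"
    and denumerable_quotient: "denumerable (carrier M // V)"
    and base: "uniformity_base {entourage V F | F. finite F \<and> F \<subseteq> Units M} \<U>"
    and compatible: "compatible_uniformity T \<U>"
    and complete: "complete_uniformity (carrier M) \<U>"
begin

text \<open>The classes are numbered, and \<open>M\<close> acts on the numbers by left multiplication of classes.\<close>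
definition class_no :: "'a \<Rightarrow> nat" where
  "class_no x = to_nat_on (carrier M // V) (V `` {x})"

definition action :: "'a \<Rightarrow> nat \<Rightarrow> nat" where
  "action x k = class_no (x \<otimes> (SOME y. y \<in> carrier M \<and> class_no y = k))"

lemma entourage_below:
  assumes "U \<in> \<U>"
  obtains F where "finite F" "F \<subseteq> Units M" "entourage V F \<subseteq> U"
proof -
  from base assms have "\<exists>B\<in>{entourage V F | F. finite F \<and> F \<subseteq> Units M}. B \<subseteq> U"
    unfolding uniformity_base_def by (elim conjE bspec)
  then obtain B where "B \<in> {entourage V F | F. finite F \<and> F \<subseteq> Units M}" "B \<subseteq> U" ..
  then show thesis using that by auto
qed

lemma class_no_eq_iff:
  assumes "x \<in> carrier M" "y \<in> carrier M"
  shows "class_no x = class_no y \<longleftrightarrow> (x, y) \<in> V"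
proof -
  have "class_no x = class_no y \<longleftrightarrow> V `` {x} = V `` {y}"
    using denumerable_quotient assms by (simp add: class_no_def denumerable_def quotientI)
  then show ?thesis using eq_equiv_class_iff[OF equiv_V assms] by simp
qed

lemma class_no_surj: "\<exists>y\<in>carrier M. class_no y = k"
proof -
  have "bij_betw (to_nat_on (carrier M // V)) (carrier M // V) UNIV"
    using denumerable_quotient unfolding denumerable_def by (blast intro: to_nat_on_infinite)
  then obtain C where "C \<in> carrier M // V" "to_nat_on (carrier M // V) C = k"
    by (metis UNIV_I bij_betw_imp_surj_on imageE)
  then show ?thesis by (auto simp: class_no_def elim!: quotientE)
qed

lemma action_class_no:
  assumes "x \<in> carrier M" "y \<in> carrier M"
  shows "action x (class_no y) = class_no (x \<otimes> y)"
proof -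
  define z where "z = (SOME z. z \<in> carrier M \<and> class_no z = class_no y)"
  have z: "z \<in> carrier M \<and> class_no z = class_no y" unfolding z_def by (rule someI) (use assms in blast)
  then have "(z, y) \<in> V" using class_no_eq_iff assms by blast
  then have "(x \<otimes> z, x \<otimes> y) \<in> V"
    using left_invariant assms z unfolding left_invariant_def by blast
  then show ?thesis using class_no_eq_iff assms z by (simp add: action_def flip: z_def)
qed

text \<open>
  If \<open>k\<close> is the number of the class of \<open>y\<close>, then \<open>action x k\<close> is that of \<open>x \<otimes> y\<close>. Right
  multiplication by \<open>y\<close> is continuous also if \<open>y\<close> is not a unit, and classes are open. This is how the uniformity, which
  speaks about translations by units, controls the action on all classes.
\<close>
lemma openin_action_fibre:
  assumes "k = class_no y" "y \<in> carrier M"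
  shows "openin T {x \<in> topspace T. action x k = l}"
proof -
  have "openin T {z \<in> carrier M. class_no z = l}" (is "openin T ?C")
  proof -
    have "entourage V {\<one>} \<in> {entourage V F | F. finite F \<and> F \<subseteq> Units M}" by blast
    then have "entourage V {\<one>} \<in> \<U>" using base unfolding uniformity_base_def by (elim conjE subsetD)
    moreover have "entourage V {\<one>} `` {z} \<subseteq> ?C" if "z \<in> ?C" for z
    proof safe
      fix x assume "(z, x) \<in> entourage V {\<one>}"
      then have "z \<in> carrier M" "x \<in> carrier M" "(z, x) \<in> V" by (auto simp: entourage_def)
      then show "x \<in> carrier M" "class_no x = l" using class_no_eq_iff[of z x] that by auto
    qed
    ultimately show ?thesis
      using compatible topspace_eq unfolding compatible_uniformity_def by blast
  qed
  then have "openin T {x \<in> topspace T. x \<otimes> y \<in> ?C}"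
    by (rule openin_continuous_map_preimage[OF continuous_right_mult[OF assms(2)]])
  moreover have "{x \<in> topspace T. x \<otimes> y \<in> ?C} = {x \<in> topspace T. action x k = l}"
    using assms action_class_no topspace_eq by auto
  ultimately show ?thesis by simp
qed

sublocale faithful_representation M T "UNIV :: nat set" action
proof
  show "action x \<in> UNIV \<rightarrow>\<^sub>E UNIV" for x by simp
  show "action (x \<otimes> y) k = action x (action y k)" if "x \<in> carrier M" "y \<in> carrier M" for x y k
  proof -
    obtain z where "z \<in> carrier M" "class_no z = k" using class_no_surj by blast
    then show ?thesis using that action_class_no[of "x \<otimes> y" z] action_class_no[of y z]
        action_class_no[of x "y \<otimes> z"] by (simp add: m_assoc)
  qed
  show "action \<one> k = k" for k
  proof -
    obtain z where "z \<in> carrier M" "class_no z = k" using class_no_surj by blast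
    then show ?thesis using action_class_no[of \<one> z] by simp
  qed
  show open_iff: "openin T W \<longleftrightarrow> finitely_determined UNIV (carrier M) action W" for W
  proof
    assume W: "openin T W"
    show "finitely_determined UNIV (carrier M) action W"
      unfolding finitely_determined_def
    proof (intro conjI ballI)
      show "W \<subseteq> carrier M" using openin_subset[OF W] topspace_eq by simp
      fix x assume x: "x \<in> W"
      then obtain U where "U \<in> \<U>" "U `` {x} \<subseteq> W"
        using compatible W unfolding compatible_uniformity_def by blast
      obtain F where F: "finite F" "F \<subseteq> Units M" "entourage V F \<subseteq> U"
        by (rule entourage_below[OF \<open>U \<in> \<U>\<close>])
      have "y \<in> W" if y: "y \<in> carrier M" "\<forall>k\<in>class_no ` F. action y k = action x k" for y
      proof -
        have "(x \<otimes> g, y \<otimes> g) \<in> V" if "g \<in> F" for g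
        proof -
          have g: "g \<in> carrier M" "x \<in> carrier M" using that F(2) Units_closed x \<open>W \<subseteq> carrier M\<close> by blast+
          then have "class_no (x \<otimes> g) = class_no (y \<otimes> g)"
            using y that action_class_no[of x g] action_class_no[of y g] by simp
          then show ?thesis using class_no_eq_iff g y(1) by simp
        qed
        then have "(x, y) \<in> entourage V F" using y(1) x \<open>W \<subseteq> carrier M\<close> by (auto simp: entourage_def)
        then show ?thesis using F(3) \<open>U `` {x} \<subseteq> W\<close> by blast
      qed
      then show "\<exists>K. finite K \<and> K \<subseteq> UNIV \<and> (\<forall>y\<in>carrier M. (\<forall>k\<in>K. action y k = action x k) \<longrightarrow> y \<in> W)"
        using F(1) by (intro exI[of _ "class_no ` F"]) auto
    qed
  next
    assume W: "finitely_determined UNIV (carrier M) action W"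
    show "openin T W"
    proof (subst openin_subopen, intro ballI)
      fix x assume "x \<in> W"
      with W obtain K where K: "finite K" "\<forall>y\<in>carrier M. (\<forall>k\<in>K. action y k = action x k) \<longrightarrow> y \<in> W"
        unfolding finitely_determined_def by blast
      have "openin T {y \<in> topspace T. \<forall>k\<in>K. action y k = action x k}"
        using K(1)
      proof (induction K)
        case (insert k K)
        obtain z where "z \<in> carrier M" "k = class_no z" using class_no_surj by metis
        then have "openin T {y \<in> topspace T. action y k = action x k}" using openin_action_fibre by blast
        moreover have "{y \<in> topspace T. \<forall>k\<in>insert k K. action y k = action x k} =
            {y \<in> topspace T. action y k = action x k} \<inter> {y \<in> topspace T. \<forall>k\<in>K. action y k = action x k}"
          by auto
        ultimately show ?case using insert.IH by (simp only: openin_Int)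
      qed simp
      moreover have "x \<in> topspace T" using W \<open>x \<in> W\<close> topspace_eq by (auto simp: finitely_determined_def)
      ultimately show "\<exists>W'. openin T W' \<and> x \<in> W' \<and> W' \<subseteq> W"
        using K(2) topspace_eq by (intro exI[of _ "{y \<in> topspace T. \<forall>k\<in>K. action y k = action x k}"]) auto
    qed
  qed
  show "inj_on action (carrier M)"
  proof (rule inj_onI, rule ccontr)
    fix x y assume xy: "x \<in> carrier M" "y \<in> carrier M" "action x = action y" "x \<noteq> y"
    then obtain W where W: "openin T W" "x \<in> W" "y \<notin> W"
      using Hausdorff topspace_eq unfolding Hausdorff_space_def by (metis disjnt_iff)
    then have "finitely_determined UNIV (carrier M) action W" using open_iff by simp
    then show False using xy W unfolding finitely_determined_def by metis
  qed
qed

text \<open>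
  If \<open>f\<close> is a pointwise limit of the action, then the elements that agree with \<open>f\<close> on finite sets form
  a filter base. The filter is Cauchy, and the action of its limit is \<open>f\<close>.
\<close>
lemma closedin_action: "closedin (pointwise_topology UNIV) (action ` carrier M)"
proof (subst closedin_pointwise_topology, simp, intro ballI impI)
  fix f :: "nat \<Rightarrow> nat"
  assume f: "\<forall>K. finite K \<and> K \<subseteq> UNIV \<longrightarrow> (\<exists>f'\<in>action ` carrier M. \<forall>k\<in>K. f' k = f k)"
  define A where "A K = {x \<in> carrier M. \<forall>k\<in>K. action x k = f k}" for K
  have A_nonempty: "A K \<noteq> {}" if "finite K" for K using f that by (auto simp: A_def)
  define \<F> where "\<F> = (INF K\<in>{K. finite K}. principal (A K))"
  have ev: "eventually P \<F> \<longleftrightarrow> (\<exists>K. finite K \<and> (\<forall>x\<in>A K. P x))" for P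
  proof -
    have "\<exists>K''\<in>{K. finite K}. principal (A K'') \<le> inf (principal (A K)) (principal (A K'))"
      if "finite K" "finite K'" for K K'
      using that by (intro bexI[of _ "K \<union> K'"]) (auto simp: A_def)
    then show ?thesis
      unfolding \<F>_def by (subst eventually_INF_base) (auto simp: eventually_principal)
  qed
  have "\<F> \<noteq> bot"
  proof
    assume "\<F> = bot"
    then obtain K where "finite K" "A K = {}" using ev[of "\<lambda>_. False"] by auto
    then show False using A_nonempty by blast
  qed
  moreover have "\<F> \<le> principal (carrier M)"
    unfolding le_principal ev by (intro exI[of _ "{}"]) (auto simp: A_def)
  moreover have "\<exists>B. eventually (\<lambda>x. x \<in> B) \<F> \<and> B \<times> B \<subseteq> U" if U: "U \<in> \<U>" for U
  proof -
    obtain F where F: "finite F" "F \<subseteq> Units M" "entourage V F \<subseteq> U"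
      by (rule entourage_below[OF U])
    have "(x, y) \<in> entourage V F" if "x \<in> A (class_no ` F)" "y \<in> A (class_no ` F)" for x y
    proof -
      have xy: "x \<in> carrier M" "y \<in> carrier M" using that by (auto simp: A_def)
      have "(x \<otimes> g, y \<otimes> g) \<in> V" if "g \<in> F" for g
      proof -
        have g: "g \<in> carrier M" using that F(2) Units_closed by blast
        have "action x (class_no g) = action y (class_no g)"
          using \<open>x \<in> A _\<close> \<open>y \<in> A _\<close> that by (auto simp: A_def)
        then show ?thesis using g xy by (simp add: action_class_no class_no_eq_iff)
      qed
      then show ?thesis using xy by (auto simp: entourage_def)
    qed
    then have "A (class_no ` F) \<times> A (class_no ` F) \<subseteq> U" using F(3) by blast
    moreover have "eventually (\<lambda>x. x \<in> A (class_no ` F)) \<F>" unfolding ev using F(1) by blast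
    ultimately show ?thesis by blast
  qed
  ultimately obtain x where x: "x \<in> carrier M" "\<And>U. U \<in> \<U> \<Longrightarrow> eventually (\<lambda>y. (x, y) \<in> U) \<F>"
    using complete unfolding complete_uniformity_def by meson
  have "action x k = f k" for k
  proof -
    obtain z where z: "z \<in> carrier M" "k = class_no z" using class_no_surj by metis
    have "openin T {y \<in> topspace T. action y k = action x k}"
      by (rule openin_action_fibre[OF z(2,1)])
    moreover have "x \<in> {y \<in> topspace T. action y k = action x k}" using x(1) topspace_eq by simp
    ultimately obtain U where "U \<in> \<U>" "U `` {x} \<subseteq> {y \<in> topspace T. action y k = action x k}"
      using compatible unfolding compatible_uniformity_def by blast
    then have "eventually (\<lambda>y. action y k = action x k) \<F>"
      using x(2)[of U] by (auto elim: eventually_mono)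
    moreover have "eventually (\<lambda>y. action y k = f k) \<F>"
      unfolding ev by (intro exI[of _ "{k}"]) (simp add: A_def)
    ultimately have "eventually (\<lambda>y. action x k = f k) \<F>" by eventually_elim simp
    then show ?thesis using \<open>\<F> \<noteq> bot\<close> by simp
  qed
  then have "f = action x" by auto
  then show "f \<in> action ` carrier M" using x(1) by blast
qed

lemma oligomorphic_action:
  assumes "\<forall>n\<ge>1. finite (nlists n (carrier M) // {(x, y). x \<in> nlists n (carrier M) \<and>
    y \<in> nlists n (carrier M) \<and> (\<exists>g\<in>Units M. \<forall>i<n. (x ! i, g \<otimes> y ! i) \<in> V)})"
  shows "oligomorphic UNIV (action ` Units M)"
  unfolding oligomorphic_iff
proof (intro allI impI)
  fix n :: nat assume "n \<ge> 1"
  define E where "E = {(x, y). x \<in> nlists n (carrier M) \<and> y \<in> nlists n (carrier M) \<and>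
    (\<exists>g\<in>Units M. \<forall>i<n. (x ! i, g \<otimes> y ! i) \<in> V)}"
  define orb where "orb ks = {map (action g) ks | g. g \<in> Units M}" for ks
  have "finite ((\<lambda>x. E `` {x}) ` nlists n (carrier M))"
    using assms \<open>n \<ge> 1\<close> by (simp add: E_def quotient_def UNION_singleton_eq_range)
  then obtain P where P: "finite P" "P \<subseteq> nlists n (carrier M)"
    "\<And>x. x \<in> nlists n (carrier M) \<Longrightarrow> \<exists>y\<in>P. E `` {y} = E `` {x}"
    by (rule finite_image_representatives) blast
  have "\<exists>y\<in>P. orb ks = orb (map class_no y)" if ks: "ks \<in> nlists n UNIV" for ks
  proof -
    obtain c where c: "\<And>k. c k \<in> carrier M \<and> class_no (c k) = k" using class_no_surj by metis
    define x where "x = map c ks"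
    have len: "length ks = n" using nlistsE_length[OF ks] .
    have x: "x \<in> nlists n (carrier M)" using len c by (auto simp: x_def intro!: nlistsI)
    have ks_eq: "ks = map class_no x" using c by (simp add: x_def o_def)
    obtain y where y: "y \<in> P" "E `` {y} = E `` {x}" using P(3)[OF x] by blast
    have y_in: "y \<in> nlists n (carrier M)" using y(1) P(2) by blast
    have "(x ! i, \<one> \<otimes> x ! i) \<in> V" if "i < n" for i
    proof -
      have "x ! i \<in> carrier M" using nlistsE_nth_in[OF x that] .
      then show ?thesis using class_no_eq_iff[of "x ! i" "x ! i"] by simp
    qed
    then have "(x, x) \<in> E" using x unfolding E_def by (auto intro!: bexI[of _ \<one>])
    then have "(y, x) \<in> E" using y(2) by blast
    then obtain g where g: "g \<in> Units M" "\<forall>i<n. (y ! i, g \<otimes> x ! i) \<in> V" unfolding E_def by blast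
    have eq: "map class_no y = map (action g) (map class_no x)"
    proof (rule nth_equalityI)
      show "length (map class_no y) = length (map (action g) (map class_no x))"
        using nlistsE_length[OF x] nlistsE_length[OF y_in] by simp
      fix i assume "i < length (map class_no y)"
      then have i: "i < n" using nlistsE_length[OF y_in] by simp
      then have in_M: "x ! i \<in> carrier M" "y ! i \<in> carrier M"
        using nlistsE_nth_in[OF x] nlistsE_nth_in[OF y_in] by blast+
      have "class_no (y ! i) = class_no (g \<otimes> x ! i)"
        using g i in_M class_no_eq_iff by (simp add: Units_closed)
      then show "map class_no y ! i = map (action g) (map class_no x) ! i"
        using i nlistsE_length[OF x] nlistsE_length[OF y_in] in_M g(1)
        by (simp add: action_class_no Units_closed)
    qed
    have "orb (map (action g) ks) = orb ks" unfolding orb_def by (rule orbit_map_unit[OF g(1)]) simp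
    then show ?thesis using y(1) eq ks_eq by metis
  qed
  then have "orb ` nlists n UNIV \<subseteq> (\<lambda>y. orb (map class_no y)) ` P" by blast
  then show "finite ((\<lambda>xs. {map (action g) xs |g. g \<in> Units M}) ` nlists n UNIV)"
    using P(1) finite_subset unfolding orb_def by blast
qed

end

section \<open>Representations on the natural numbers\<close>
lemma (in topological_monoid) oligomorphic_iff_representation:
  "(\<exists>(N :: (nat \<Rightarrow> nat) set) \<xi>.
      submonoid N (transformation_monoid UNIV) \<and>
      closedin (pointwise_topology UNIV) N \<and>
      topological_iso M T
        (transformation_monoid UNIV\<lparr>carrier := N\<rparr>) (subtopology (pointwise_topology UNIV) N) \<xi> \<and>
      oligomorphic UNIV (\<xi> ` Units M)) \<longleftrightarrow>
   (\<exists>\<xi>. faithful_representation M T (UNIV :: nat set) \<xi> \<and>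
      closedin (pointwise_topology UNIV) (\<xi> ` carrier M) \<and> oligomorphic UNIV (\<xi> ` Units M))"
proof -
  note iso_iff = topological_iso_iff_representation[of _ "UNIV :: nat set"]
  have id: "(\<lambda>k\<in>UNIV. k) = \<one>\<^bsub>transformation_monoid (UNIV :: nat set)\<^esub>"
    by (simp add: transformation_monoid_def)
  have sub: "submonoid (\<xi> ` carrier M) (transformation_monoid UNIV)" if "faithful_representation M T (UNIV :: nat set) \<xi>" for \<xi>
  proof -
    interpret faithful_representation M T "UNIV :: nat set" \<xi> by fact
    have one_eq: "\<xi> \<one> = (\<lambda>k\<in>UNIV. k)" using one by auto
    have mult_eq: "compose UNIV (\<xi> x) (\<xi> y) = \<xi> (x \<otimes> y)" if "x \<in> carrier M" "y \<in> carrier M" for x y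
      using mult that by (auto simp: compose_def)
    show ?thesis
      by unfold_locales
        (auto simp: transformation_monoid_def mult_eq simp flip: one_eq)
  qed
  have id_in: "(\<lambda>k\<in>UNIV. k) \<in> N" if "submonoid N (transformation_monoid (UNIV :: nat set))" for N
    using submonoid.one_closed[OF that] by (simp only: id)
  show ?thesis (is "?L \<longleftrightarrow> ?R")
  proof (intro iffI)
    assume ?L
    then obtain N :: "(nat \<Rightarrow> nat) set" and \<xi> where N: "submonoid N (transformation_monoid UNIV)"
      "closedin (pointwise_topology UNIV) N" "oligomorphic UNIV (\<xi> ` Units M)"
      "topological_iso M T (transformation_monoid UNIV\<lparr>carrier := N\<rparr>)
        (subtopology (pointwise_topology UNIV) N) \<xi>"
      by blast
    have "faithful_representation M T (UNIV :: nat set) \<xi> \<and> \<xi> ` carrier M = N"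
      using N(4) by (subst (asm) iso_iff[OF _ id_in[OF N(1)]]) auto
    with N(2,3) show ?R by blast
  next
    assume ?R
    then obtain \<xi> where \<xi>: "faithful_representation M T (UNIV :: nat set) \<xi>"
      "closedin (pointwise_topology UNIV) (\<xi> ` carrier M)" "oligomorphic UNIV (\<xi> ` Units M)"
      by blast
    have "topological_iso M T (transformation_monoid UNIV\<lparr>carrier := \<xi> ` carrier M\<rparr>)
        (subtopology (pointwise_topology UNIV) (\<xi> ` carrier M)) \<xi>"
      using \<xi>(1) by (subst iso_iff[OF _ id_in[OF sub[OF \<xi>(1)]]]) auto
    with \<xi> sub[OF \<xi>(1)] show ?L by blast
  qed
qed

text \<open>
  The domain of a countable structure may be any infinite set of numbers; numbering its elements turns
  an action on it into one on all natural numbers.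
\<close>
lemma (in faithful_representation) transport:
  assumes "bij_betw \<beta> X UNIV"
  defines "\<zeta> \<equiv> \<lambda>x k. \<beta> (\<xi> x (inv_into X \<beta> k))"
  shows "faithful_representation M T UNIV \<zeta>"
    and "closedin (pointwise_topology X) (\<xi> ` carrier M) \<Longrightarrow>
      closedin (pointwise_topology UNIV) (\<zeta> ` carrier M)"
    and "oligomorphic X (\<xi> ` Units M) \<Longrightarrow> oligomorphic UNIV (\<zeta> ` Units M)"
proof -
  define \<gamma> where "\<gamma> = inv_into X \<beta>"
  have \<gamma>: "\<gamma> k \<in> X" "\<beta> (\<gamma> k) = k" for k
    using assms(1) unfolding \<gamma>_def by (simp_all add: bij_betw_def inv_into_into f_inv_into_f)
  have \<beta>: "\<gamma> (\<beta> a) = a" if "a \<in> X" for a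
    using assms(1) that unfolding \<gamma>_def by (simp add: bij_betw_def)
  have \<zeta>: "\<zeta> x k = \<beta> (\<xi> x (\<gamma> k))" for x k by (simp add: \<zeta>_def \<gamma>_def)
  have \<xi>: "\<xi> x a = \<gamma> (\<zeta> x (\<beta> a))" if "x \<in> carrier M" "a \<in> X" for x a
    using that maps_in by (simp add: \<zeta> \<beta>)
  have fd: "finitely_determined X (carrier M) \<xi> W \<longleftrightarrow> finitely_determined UNIV (carrier M) \<zeta> W" for W
  proof
    have "\<forall>x\<in>carrier M. \<forall>y\<in>carrier M. (\<forall>k\<in>\<beta> ` K. \<zeta> y k = \<zeta> x k) \<longrightarrow> (\<forall>a\<in>K. \<xi> y a = \<xi> x a)"
      if "K \<subseteq> X" for K
      using that by (simp add: \<xi> subset_iff)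
    then show "finitely_determined UNIV (carrier M) \<zeta> W" if "finitely_determined X (carrier M) \<xi> W"
      by (intro finitely_determined_transfer[OF that]) (meson finite_imageI subset_UNIV)
    have "\<forall>x\<in>carrier M. \<forall>y\<in>carrier M. (\<forall>a\<in>\<gamma> ` K. \<xi> y a = \<xi> x a) \<longrightarrow> (\<forall>k\<in>K. \<zeta> y k = \<zeta> x k)" for K
      by (simp add: \<zeta>)
    moreover have "\<gamma> ` K \<subseteq> X" for K using \<gamma> by blast
    ultimately show "finitely_determined X (carrier M) \<xi> W" if "finitely_determined UNIV (carrier M) \<zeta> W"
      by (intro finitely_determined_transfer[OF that]) (meson finite_imageI)
  qed
  show rep: "faithful_representation M T UNIV \<zeta>"
  proof
    show "\<zeta> x \<in> UNIV \<rightarrow>\<^sub>E UNIV" for x by simp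
    show "\<zeta> (x \<otimes> y) k = \<zeta> x (\<zeta> y k)" if "x \<in> carrier M" "y \<in> carrier M" for x y k
      using that mult[of x y "\<gamma> k"] \<gamma> maps_in[of y "\<gamma> k"] by (simp add: \<zeta> \<beta>)
    show "\<zeta> \<one> k = k" for k using one \<gamma> by (simp add: \<zeta>)
    show "inj_on \<zeta> (carrier M)" using \<xi> eqI by (metis inj_onI)
    show "openin T W \<longleftrightarrow> finitely_determined UNIV (carrier M) \<zeta> W" for W using open_iff fd by simp
  qed
  show "oligomorphic UNIV (\<zeta> ` Units M)" if olig: "oligomorphic X (\<xi> ` Units M)"
    unfolding faithful_representation.oligomorphic_iff[OF rep]
  proof (intro allI impI)
    fix n :: nat assume "n \<ge> 1"
    define orb where "orb as = {map (\<xi> g) as | g. g \<in> Units M}" for as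
    have "{map (\<zeta> g) ks | g. g \<in> Units M} = map \<beta> ` orb (map \<gamma> ks)" for ks
    proof -
      have "map (\<zeta> g) ks = map \<beta> (map (\<xi> g) (map \<gamma> ks))" for g by (simp add: \<zeta>)
      then show ?thesis unfolding orb_def by (auto simp del: map_map)
    qed
    then have "(\<lambda>ks. {map (\<zeta> g) ks | g. g \<in> Units M}) ` nlists n UNIV =
        (`) (map \<beta>) ` orb ` map \<gamma> ` nlists n UNIV"
      by (simp add: image_image)
    moreover have "map \<gamma> ` nlists n UNIV \<subseteq> nlists n X"
      using \<gamma> nlistsE_length by (auto intro!: nlistsI)
    moreover have "finite (orb ` nlists n X)"
      using olig[unfolded oligomorphic_iff, rule_format, OF \<open>n \<ge> 1\<close>] by (simp add: orb_def)
    ultimately show "finite ((\<lambda>ks. {map (\<zeta> g) ks | g. g \<in> Units M}) ` nlists n UNIV)"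
      using finite_subset[OF image_mono] by (metis finite_imageI)
  qed
  show "closedin (pointwise_topology UNIV) (\<zeta> ` carrier M)"
    if "closedin (pointwise_topology X) (\<xi> ` carrier M)"
  proof (subst closedin_pointwise_topology, simp, intro ballI impI)
    fix f assume f: "\<forall>K. finite K \<and> K \<subseteq> UNIV \<longrightarrow> (\<exists>f'\<in>\<zeta> ` carrier M. \<forall>k\<in>K. f' k = f k)"
    define f0 where "f0 = (\<lambda>a\<in>X. \<gamma> (f (\<beta> a)))"
    have "\<exists>f'\<in>\<xi> ` carrier M. \<forall>a\<in>K. f' a = f0 a" if K: "finite K" "K \<subseteq> X" for K
    proof -
      have "finite (\<beta> ` K) \<and> \<beta> ` K \<subseteq> UNIV" using K(1) by simp
      with f have "\<exists>f'\<in>\<zeta> ` carrier M. \<forall>k\<in>\<beta> ` K. f' k = f k" by blast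
      then obtain x where x: "x \<in> carrier M" "\<forall>k\<in>\<beta> ` K. \<zeta> x k = f k" by blast
      then have "\<forall>a\<in>K. \<xi> x a = f0 a" using K(2) \<xi> by (auto simp: f0_def)
      then show ?thesis using x(1) by blast
    qed
    moreover have "f0 \<in> X \<rightarrow>\<^sub>E X" using \<gamma> by (simp add: f0_def)
    moreover have "\<xi> ` carrier M \<subseteq> X \<rightarrow>\<^sub>E X" using maps by blast
    ultimately have "f0 \<in> \<xi> ` carrier M"
      using that closedin_pointwise_topology by metis
    then obtain x where x: "x \<in> carrier M" "\<xi> x = f0" by blast
    then have "\<zeta> x k = f k" for k using \<gamma> by (simp add: \<zeta> f0_def)
    then have "f = \<zeta> x" by auto
    then show "f \<in> \<zeta> ` carrier M" using x(1) by blast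
  qed
qed

section \<open>Endomorphism monoids of omega-categorical structures\<close>
lemma Endo_subset: "Endo S A \<subseteq> Dom A \<rightarrow>\<^sub>E Dom A"
  by (auto simp: Endo_def)

lemma Endo_iff:
  "h \<in> Endo S A \<longleftrightarrow> h \<in> Dom A \<rightarrow>\<^sub>E Dom A \<and>
     (\<forall>f xs. (f, length xs) \<in> funs S \<longrightarrow> set xs \<subseteq> Dom A \<longrightarrow>
        h (fun_int A (f, length xs) xs) = fun_int A (f, length xs) (map h xs)) \<and>
     (\<forall>r xs. (r, length xs) \<in> rels S \<longrightarrow> set xs \<subseteq> Dom A \<longrightarrow>
        xs \<in> rel_int A (r, length xs) \<longrightarrow> map h xs \<in> rel_int A (r, length xs))" (is "_ \<longleftrightarrow> ?R")
proof
  assume "h \<in> Endo S A"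
  then have "h \<in> Dom A \<rightarrow>\<^sub>E Dom A" "struct_hom S A A h" by (auto simp: Endo_def)
  then show ?R using struct_homD(1,2)[of S A A h] by simp
next
  assume R: ?R
  have "struct_hom S A A h"
    unfolding struct_hom_def
  proof (intro conjI)
    show "h \<in> Dom A \<rightarrow> Dom A" using R by blast
    show "\<forall>(f, n)\<in>funs S. \<forall>xs\<in>nlists n (Dom A). h (fun_int A (f, n) xs) = fun_int A (f, n) (map h xs)"
      using R nlistsE_length nlistsE_set by fast
    show "\<forall>(r, n)\<in>rels S. \<forall>xs\<in>nlists n (Dom A). xs \<in> rel_int A (r, n) \<longrightarrow> map h xs \<in> rel_int A (r, n)"
      using R nlistsE_length nlistsE_set by fast
  qed
  then show "h \<in> Endo S A" using R by (simp add: Endo_def)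
qed

lemma id_in_Endo: "is_struct S A \<Longrightarrow> (\<lambda>k\<in>Dom A. k) \<in> Endo S A"
proof -
  assume A: "is_struct S A"
  have "map (\<lambda>k\<in>Dom A. k) xs = xs" if "set xs \<subseteq> Dom A" for xs
    using that by (intro map_idI) auto
  then show ?thesis unfolding Endo_iff using is_structD[OF A] by auto
qed

text \<open>Each instance of the homomorphism conditions involves finitely many elements.\<close>
lemma closedin_Endo:
  assumes A: "is_struct S A"
  shows "closedin (pointwise_topology (Dom A)) (Endo S A)"
proof (subst closedin_pointwise_topology[OF Endo_subset], intro ballI impI)
  fix h assume h: "h \<in> Dom A \<rightarrow>\<^sub>E Dom A"
    and approx: "\<forall>K. finite K \<and> K \<subseteq> Dom A \<longrightarrow> (\<exists>h'\<in>Endo S A. \<forall>k\<in>K. h' k = h k)"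
  show "h \<in> Endo S A"
    unfolding Endo_iff
  proof (intro conjI allI impI)
    show "h \<in> Dom A \<rightarrow>\<^sub>E Dom A" by (fact h)
    show "h (fun_int A (f, length xs) xs) = fun_int A (f, length xs) (map h xs)"
      if "(f, length xs) \<in> funs S" "set xs \<subseteq> Dom A" for f xs
    proof -
      have "finite (insert (fun_int A (f, length xs) xs) (set xs))"
        "insert (fun_int A (f, length xs) xs) (set xs) \<subseteq> Dom A"
        using is_structD[OF A that] that(2) by auto
      then obtain h' where h': "h' \<in> Endo S A"
        "\<forall>k\<in>insert (fun_int A (f, length xs) xs) (set xs). h' k = h k" using approx by meson
      have map_eq: "map h xs = map h' xs" using h'(2) by simp
      have "h' (fun_int A (f, length xs) xs) = fun_int A (f, length xs) (map h' xs)"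
        using h'(1) that unfolding Endo_iff by blast
      then show ?thesis unfolding map_eq using h'(2) by simp
    qed
    show "map h xs \<in> rel_int A (r, length xs)"
      if "(r, length xs) \<in> rels S" "set xs \<subseteq> Dom A" "xs \<in> rel_int A (r, length xs)" for r xs
    proof -
      have "finite (set xs)" by simp
      with that(2) approx obtain h' where h': "h' \<in> Endo S A" "\<forall>k\<in>set xs. h' k = h k" by meson
      have map_eq: "map h xs = map h' xs" using h'(2) by simp
      show ?thesis unfolding map_eq using h'(1) that unfolding Endo_iff by blast
    qed
  qed
qed

lemma (in topological_monoid) endo_iso_iff_representation:
  assumes "is_struct S A"
  shows "topological_iso M T (endo_monoid S A) (endo_topology S A) \<xi> \<longleftrightarrow>
    faithful_representation M T (Dom A) \<xi> \<and> \<xi> ` carrier M = Endo S A"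
  unfolding endo_monoid_def endo_topology_def
  by (rule topological_iso_iff_representation[OF Endo_subset id_in_Endo[OF assms]])

lemma struct_iso_inverse:
  assumes "is_struct S A" "is_struct S B" "struct_iso S A B h"
  shows "struct_iso S B A (inv_into (Dom A) h)"
proof (rule struct_iso_if_elementary[OF assms(2)])
  have bij: "bij_betw h (Dom A) (Dom B)" by (rule struct_isoD[OF assms(3)])
  then show inv: "bij_betw (inv_into (Dom A) h) (Dom B) (Dom A)" by (rule bij_betw_inv_into)
  fix \<phi> and e :: "nat \<Rightarrow> 'd" assume \<phi>: "wf_fm S \<phi>" and e: "e \<in> assignments B"
  have "inv_into (Dom A) h \<circ> e \<in> assignments A" using inv e by (auto dest: bij_betwE)
  from sat_iso[OF assms(1,3) \<phi> this]
  have "sat B (h \<circ> (inv_into (Dom A) h \<circ> e)) \<phi> \<longleftrightarrow> sat A (inv_into (Dom A) h \<circ> e) \<phi>" .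
  moreover have "h \<circ> (inv_into (Dom A) h \<circ> e) = e"
  proof
    fix j
    have "e j \<in> h ` Dom A" using e bij by (auto simp: bij_betw_def)
    then show "(h \<circ> (inv_into (Dom A) h \<circ> e)) j = e j" by (simp add: f_inv_into_f)
  qed
  ultimately show "sat B e \<phi> \<longleftrightarrow> sat A (inv_into (Dom A) h \<circ> e) \<phi>" by simp
qed

lemma partial_elementary_same_type:
  assumes "tuple_type S A n a = tuple_type S A n b" "a \<in> assignments A" "b \<in> assignments A"
  shows "partial_elementary S A A ((\<lambda>j. (a j, b j)) ` {..<n})"
  unfolding partial_elementary_def
proof (intro allI impI)
  fix \<phi> e e'
  assume \<phi>: "wf_fm S \<phi>" and fv: "\<forall>v\<in>free_vars \<phi>. (e v, e' v) \<in> (\<lambda>j. (a j, b j)) ` {..<n}"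
  then have "\<forall>v\<in>free_vars \<phi>. \<exists>j<n. e v = a j \<and> e' v = b j" by auto
  then obtain \<sigma> where \<sigma>: "\<And>v. v \<in> free_vars \<phi> \<Longrightarrow> \<sigma> v < n \<and> e v = a (\<sigma> v) \<and> e' v = b (\<sigma> v)" by metis
  have "sat A e \<phi> \<longleftrightarrow> sat A a (rename \<phi> \<sigma>)" "sat A e' \<phi> \<longleftrightarrow> sat A b (rename \<phi> \<sigma>)"
    unfolding sat_rename using \<sigma> by (auto intro!: sat_cong)
  moreover have "wf_fm S (rename \<phi> \<sigma>)" "free_vars (rename \<phi> \<sigma>) \<subseteq> {..<n}"
    using \<phi> wf_rename \<sigma> free_vars_rename[of \<phi> \<sigma>] by auto
  then have "sat A a (rename \<phi> \<sigma>) \<longleftrightarrow> sat A b (rename \<phi> \<sigma>)" using assms(1) unfolding tuple_type_def by blast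
  ultimately show "sat A e \<phi> = sat A e' \<phi>" by simp
qed

text \<open>An automorphism and its inverse, made extensional, are endomorphisms.\<close>
lemma automorphism_unit:
  fixes M (structure)
  assumes "faithful_representation M T (Dom A) \<xi>" "\<xi> ` carrier M = Endo S A" "is_struct S A" "struct_iso S A A h"
  obtains g where "g \<in> Units M" "\<And>a. a \<in> Dom A \<Longrightarrow> \<xi> g a = h a"
proof -
  interpret faithful_representation M T "Dom A" \<xi> by fact
  define h' where "h' = inv_into (Dom A) h"
  have bij: "bij_betw h (Dom A) (Dom A)" by (rule struct_isoD[OF assms(4)])
  have endo: "restrict f (Dom A) \<in> \<xi> ` carrier M" if "struct_iso S A A f" for f
  proof -
    have f: "struct_hom S A A f" by (rule struct_isoD[OF that])
    have f_in: "f a \<in> Dom A" if "a \<in> Dom A" for a using struct_homD(3)[OF f, of "[]"] that by simp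
    have map_eq: "map (restrict f (Dom A)) xs = map f xs" if "set xs \<subseteq> Dom A" for xs
      using that by auto
    show ?thesis
      unfolding assms(2) Endo_iff
    proof (intro conjI allI impI)
      show "restrict f (Dom A) \<in> Dom A \<rightarrow>\<^sub>E Dom A" using f_in by simp
      show "restrict f (Dom A) (fun_int A (s, length xs) xs) =
          fun_int A (s, length xs) (map (restrict f (Dom A)) xs)"
        if "(s, length xs) \<in> funs S" "set xs \<subseteq> Dom A" for s xs
        unfolding map_eq[OF that(2)]
        using struct_homD(1)[OF f that(2,1)] is_structD[OF assms(3) that] by simp
      show "map (restrict f (Dom A)) xs \<in> rel_int A (r, length xs)"
        if "(r, length xs) \<in> rels S" "set xs \<subseteq> Dom A" "xs \<in> rel_int A (r, length xs)" for r xs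
        unfolding map_eq[OF that(2)] by (rule struct_homD(2)[OF f that(2,1,3)])
    qed
  qed
  obtain g where g: "g \<in> carrier M" "\<xi> g = restrict h (Dom A)" using endo[OF assms(4)] by auto
  obtain g' where g': "g' \<in> carrier M" "\<xi> g' = restrict h' (Dom A)"
    using endo[OF struct_iso_inverse[OF assms(3,3,4)]] by (auto simp: h'_def)
  have h': "h' a \<in> Dom A" "h (h' a) = a" "h' (h a) = a" "h a \<in> Dom A" if "a \<in> Dom A" for a
    using bij that unfolding h'_def
    by (auto simp: bij_betw_def inv_into_into f_inv_into_f)
  have "g \<otimes> g' = \<one>" "g' \<otimes> g = \<one>"
    using g g' h' by (auto intro!: eqI simp: mult one)
  then have "g \<in> Units M" using g(1) g'(1) by (auto simp: Units_def)
  then show thesis using g(2) by (intro that) auto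
qed

text \<open>
  The orbit of a tuple depends only on its type: the map between two tuples of the same type is
  partial elementary and extends to an automorphism.
\<close>
theorem omega_categorical_imp_oligomorphic:
  fixes M (structure) and A :: "(nat, nat, nat) fo_struct"
  assumes rep: "faithful_representation M T (Dom A) \<xi>" and endo: "\<xi> ` carrier M = Endo S A"
    and A: "countable_structure S A" "omega_categorical S A"
  shows "oligomorphic (Dom A) (\<xi> ` Units M)"
proof -
  interpret faithful_representation M T "Dom A" \<xi> by fact
  have struct: "is_struct S A" "countable (Dom A)"
    using A(1) by (auto simp: countable_structure_def denumerable_def)
  then obtain a0 where a0: "a0 \<in> Dom A" by (auto simp: is_struct_def)
  have model: "is_model S (Th S A) A" using struct(1) by (auto simp: is_model_def Th_def)
  show ?thesis
    unfolding oligomorphic_iff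
  proof (intro allI impI)
    fix n :: nat
    define e where "e xs j = (if j < n then xs ! j else a0)" for xs :: "nat list" and j
    have e: "e xs \<in> assignments A" if "xs \<in> nlists n (Dom A)" for xs
      using nlistsE_nth_in[OF that] a0 unfolding e_def by auto
    have "finite ((\<lambda>xs. tuple_type S A n (e xs)) ` nlists n (Dom A))"
      using finitely_many_types[OF A, of n] by (rule rev_finite_subset) (use e in auto)
    then obtain P where P: "finite P" "P \<subseteq> nlists n (Dom A)"
      "\<And>xs. xs \<in> nlists n (Dom A) \<Longrightarrow> \<exists>ys\<in>P. tuple_type S A n (e ys) = tuple_type S A n (e xs)"
      by (rule finite_image_representatives) blast
    define orb where "orb xs = {map (\<xi> g) xs | g. g \<in> Units M}" for xs
    have "\<exists>ys\<in>P. orb xs = orb ys" if xs: "xs \<in> nlists n (Dom A)" for xs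
    proof -
      have "\<exists>ys\<in>P. tuple_type S A n (e ys) = tuple_type S A n (e xs)" by (rule P(3)[OF xs])
      then obtain ys where ys: "ys \<in> P" "tuple_type S A n (e ys) = tuple_type S A n (e xs)" ..
      have ys_in: "ys \<in> nlists n (Dom A)" using ys(1) P(2) by blast
      define Z where "Z = (\<lambda>j. (e ys j, e xs j)) ` {..<n}"
      have "partial_elementary S A A Z"
        unfolding Z_def by (rule partial_elementary_same_type[OF ys(2) e[OF ys_in] e[OF xs]])
      moreover have "finite Z" "Z \<subseteq> Dom A \<times> Dom A" using e[OF ys_in] e[OF xs] by (auto simp: Z_def)
      ultimately have "\<exists>h. struct_iso S A A h \<and> (\<forall>a b. (a, b) \<in> Z \<longrightarrow> h a = b)"
        by (intro iso_extending[OF finitely_many_types[OF A] model struct(2) model struct(2)])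
      then obtain h where h: "struct_iso S A A h" "\<forall>a b. (a, b) \<in> Z \<longrightarrow> h a = b"
        by (elim exE conjE)
      obtain g where g: "g \<in> Units M" "\<And>a. a \<in> Dom A \<Longrightarrow> \<xi> g a = h a"
        using automorphism_unit[OF rep endo struct(1) h(1)] by metis
      have "\<xi> g (ys ! j) = xs ! j" if "j < n" for j
      proof -
        have "(ys ! j, xs ! j) \<in> Z" using that by (auto simp: Z_def e_def image_iff)
        then show ?thesis using g(2) h(2) nlistsE_nth_in[OF ys_in that] by simp
      qed
      then have "xs = map (\<xi> g) ys"
        using nlistsE_length[OF xs] nlistsE_length[OF ys_in] by (intro nth_equalityI) auto
      then have "orb xs = orb ys"
        using orbit_map_unit[OF g(1) nlistsE_set[OF ys_in]] by (simp add: orb_def)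
      then show ?thesis using ys(1) by blast
    qed
    then have "orb ` nlists n (Dom A) \<subseteq> orb ` P" by blast
    then show "finite ((\<lambda>xs. {map (\<xi> g) xs |g. g \<in> Units M}) ` nlists n (Dom A))"
      using P(1) finite_subset unfolding orb_def by blast
  qed
qed

section \<open>The structure of an oligomorphic representation\<close>

text \<open>One relation symbol for each finite tuple of natural numbers, its name being a code of the tuple.\<close>
definition tuple_signature :: "(nat, nat) signature" where
  "tuple_signature = \<lparr>funs = {}, rels = {(to_nat ks, length ks) | ks :: nat list. True}\<rparr>"

definition orbit_structure :: "(nat \<Rightarrow> nat) set \<Rightarrow> (nat, nat, nat) fo_struct" where
  "orbit_structure N = \<lparr>Dom = UNIV, fun_int = (\<lambda>_ _. 0),
     rel_int = (\<lambda>(r, n). {map f (from_nat r) | f. f \<in> N})\<rparr>"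

lemma countable_structure_orbit: "countable_structure tuple_signature (orbit_structure N)"
  by (auto simp: countable_structure_def is_struct_def denumerable_def tuple_signature_def orbit_structure_def)

text \<open>
  Since \<open>t\<close> itself belongs to \<open>R\<^sub>t\<close>, an endomorphism maps it into \<open>R\<^sub>t\<close>. So on every finite tuple it
  agrees with an element of \<open>M\<close>.
\<close>
lemma Endo_orbit_structure:
  fixes M (structure)
  assumes "faithful_representation M T (UNIV :: nat set) \<xi>"
    and closed: "closedin (pointwise_topology UNIV) (\<xi> ` carrier M)"
  shows "Endo tuple_signature (orbit_structure (\<xi> ` carrier M)) = \<xi> ` carrier M" (is "Endo ?S ?A = _")
proof -
  interpret faithful_representation M T "UNIV :: nat set" \<xi> by fact
  have Endo: "h \<in> Endo ?S ?A \<longleftrightarrow> (\<forall>ks. \<forall>x\<in>carrier M. \<exists>y\<in>carrier M. map h (map (\<xi> x) ks) = map (\<xi> y) ks)" for h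
  proof -
    have rels: "(r, length xs) \<in> rels ?S \<longleftrightarrow> (\<exists>ks :: nat list. r = to_nat ks \<and> length ks = length xs)"
      for r and xs :: "nat list"
      by (auto simp: tuple_signature_def)
    have rel: "xs \<in> rel_int ?A (to_nat ks, n) \<longleftrightarrow> (\<exists>x\<in>carrier M. xs = map (\<xi> x) ks)" for xs ks n
      by (auto simp: orbit_structure_def)
    have hom: "h \<in> Endo ?S ?A \<longleftrightarrow> (\<forall>r xs. (r, length xs) \<in> rels ?S \<longrightarrow>
        xs \<in> rel_int ?A (r, length xs) \<longrightarrow> map h xs \<in> rel_int ?A (r, length xs))"
      by (simp add: Endo_iff orbit_structure_def tuple_signature_def)
    show ?thesis
    proof (intro iffI allI ballI)
      fix ks x assume h: "h \<in> Endo ?S ?A" and x: "x \<in> carrier M"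
      have "(to_nat ks, length (map (\<xi> x) ks)) \<in> rels ?S" unfolding rels by auto
      moreover have "map (\<xi> x) ks \<in> rel_int ?A (to_nat ks, length (map (\<xi> x) ks))"
        unfolding rel using x by blast
      ultimately have "map h (map (\<xi> x) ks) \<in> rel_int ?A (to_nat ks, length (map (\<xi> x) ks))"
        using h unfolding hom by blast
      then show "\<exists>y\<in>carrier M. map h (map (\<xi> x) ks) = map (\<xi> y) ks" by (simp only: rel)
    next
      assume pres: "\<forall>ks. \<forall>x\<in>carrier M. \<exists>y\<in>carrier M. map h (map (\<xi> x) ks) = map (\<xi> y) ks"
      show "h \<in> Endo ?S ?A"
        unfolding hom
      proof (intro allI impI)
        fix r xs assume "(r, length xs) \<in> rels ?S" and xs: "xs \<in> rel_int ?A (r, length xs)"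
        then obtain ks :: "nat list" where r: "r = to_nat ks" unfolding rels by blast
        from xs obtain x where "x \<in> carrier M" "xs = map (\<xi> x) ks" unfolding r rel by blast
        with pres show "map h xs \<in> rel_int ?A (r, length xs)" unfolding r rel by blast
      qed
    qed
  qed
  show ?thesis
  proof (intro subset_antisym subsetI)
    fix h assume "h \<in> \<xi> ` carrier M"
    then obtain z where z: "z \<in> carrier M" "h = \<xi> z" by blast
    have "map h (map (\<xi> x) ks) = map (\<xi> (z \<otimes> x)) ks" if "x \<in> carrier M" for x ks
      using that z mult by simp
    then show "h \<in> Endo ?S ?A" unfolding Endo using z(1) by blast
  next
    fix h assume h: "h \<in> Endo ?S ?A"
    have "\<exists>f\<in>\<xi> ` carrier M. \<forall>k\<in>K. f k = h k" if "finite K" for K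
    proof -
      from that obtain ks where ks: "set ks = K" using finite_list by blast
      have "map (\<xi> \<one>) ks = ks" using one by (simp add: map_idI)
      then obtain y where "y \<in> carrier M" "map h ks = map (\<xi> y) ks"
        using h one_closed unfolding Endo by metis
      then show ?thesis using ks by auto
    qed
    then show "h \<in> \<xi> ` carrier M"
      using closed closedin_pointwise_topology[of "\<xi> ` carrier M" UNIV] by simp
  qed
qed

lemma unit_automorphism:
  fixes M (structure)
  assumes "faithful_representation M T (UNIV :: nat set) \<xi>" "g \<in> Units M"
  shows "struct_iso tuple_signature (orbit_structure (\<xi> ` carrier M)) (orbit_structure (\<xi> ` carrier M)) (\<xi> g)"
    (is "struct_iso ?S ?A ?A _")
proof -
  interpret faithful_representation M T "UNIV :: nat set" \<xi> by fact
  have g: "g \<in> carrier M" "inv g \<in> carrier M" using assms(2) by (auto simp: Units_closed)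
  have rel: "map (\<xi> g) xs \<in> rel_int ?A (r, n) \<longleftrightarrow> xs \<in> rel_int ?A (r, n)" for xs r n
  proof
    assume "xs \<in> rel_int ?A (r, n)"
    then obtain x where "x \<in> carrier M" "xs = map (\<xi> x) (from_nat r)" by (auto simp: orbit_structure_def)
    then have "map (\<xi> g) xs = map (\<xi> (g \<otimes> x)) (from_nat r)" "g \<otimes> x \<in> carrier M"
      using g mult by auto
    then show "map (\<xi> g) xs \<in> rel_int ?A (r, n)" by (auto simp: orbit_structure_def)
  next
    assume "map (\<xi> g) xs \<in> rel_int ?A (r, n)"
    then obtain x where x: "x \<in> carrier M" "map (\<xi> g) xs = map (\<xi> x) (from_nat r)"
      by (auto simp: orbit_structure_def)
    have "xs = map (\<xi> (inv g)) (map (\<xi> g) xs)" using units_inverse(2)[OF assms(2)] by (simp add: map_idI)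
    also have "\<dots> = map (\<xi> (inv g \<otimes> x)) (from_nat r)" unfolding x(2) using x(1) g mult by simp
    finally show "xs \<in> rel_int ?A (r, n)" using x(1) g by (auto simp: orbit_structure_def)
  qed
  have "bij (\<xi> g)" using units_Bij[OF assms(2)] by (simp add: Bij_def)
  then show ?thesis
    using rel by (auto simp: struct_iso_def struct_hom_def tuple_signature_def orbit_structure_def)
qed

lemma tuple_type_iso:
  assumes "is_struct S A" "struct_iso S A B h" "e \<in> assignments A"
  shows "tuple_type S B n (h \<circ> e) = tuple_type S A n e"
  using sat_iso[OF assms(1,2) _ assms(3)] by (auto simp: tuple_type_def)

text \<open>
  Units are automorphisms, so the type of a tuple depends only on its orbit, and there are finitely
  many types of \<open>n\<close>-tuples.
\<close>
theorem omega_categorical_orbit_structure: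
  fixes M (structure)
  assumes rep: "faithful_representation M T (UNIV :: nat set) \<xi>" and olig: "oligomorphic UNIV (\<xi> ` Units M)"
  shows "omega_categorical tuple_signature (orbit_structure (\<xi> ` carrier M))"
    (is "omega_categorical ?S ?A")
proof -
  interpret faithful_representation M T "UNIV :: nat set" \<xi> by fact
  have struct: "is_struct ?S ?A" using countable_structure_orbit by (auto simp: countable_structure_def)
  have Dom: "Dom ?A = UNIV" by (simp add: orbit_structure_def)
  define orb where "orb ks = {map (\<xi> g) ks | g. g \<in> Units M}" for ks
  have fin_Suc: "finite (tuple_type ?S ?A (Suc n) ` assignments ?A)" for n
  proof -
    have "finite (orb ` nlists (Suc n) UNIV)"
      using olig[unfolded oligomorphic_iff, rule_format, of "Suc n"] by (simp add: orb_def)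
    then have "finite ((\<lambda>e. orb (map e [0..<Suc n])) ` assignments ?A)"
      by (rule rev_finite_subset) (auto simp: in_nlists_UNIV simp del: upt_Suc)
    then obtain P where P: "finite P" "P \<subseteq> assignments ?A"
      "\<And>e. e \<in> assignments ?A \<Longrightarrow> \<exists>e'\<in>P. orb (map e' [0..<Suc n]) = orb (map e [0..<Suc n])"
      by (rule finite_image_representatives) blast
    have "\<exists>e'\<in>P. tuple_type ?S ?A (Suc n) e = tuple_type ?S ?A (Suc n) e'" if e: "e \<in> assignments ?A" for e
    proof -
      have "\<exists>e'\<in>P. orb (map e' [0..<Suc n]) = orb (map e [0..<Suc n])" by (rule P(3)[OF e])
      then obtain e' where e': "e' \<in> P" "orb (map e' [0..<Suc n]) = orb (map e [0..<Suc n])" ..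
      have "map e [0..<Suc n] = map (\<xi> \<one>) (map e [0..<Suc n])" using one by (simp add: map_idI)
      then have "map e [0..<Suc n] \<in> orb (map e [0..<Suc n])"
        unfolding orb_def using Units_one_closed by (intro CollectI exI[of _ \<one>] conjI)
      then have "map e [0..<Suc n] \<in> orb (map e' [0..<Suc n])" by (simp only: e'(2))
      then obtain g where g: "g \<in> Units M" "map e [0..<Suc n] = map (\<xi> g) (map e' [0..<Suc n])"
        unfolding orb_def by auto
      have "e j = \<xi> g (e' j)" if "j < Suc n" for j
        using arg_cong[OF g(2), of "\<lambda>l. l ! j"] that by (simp del: upt_Suc)
      then have "tuple_type ?S ?A (Suc n) e = tuple_type ?S ?A (Suc n) (\<xi> g \<circ> e')" by (intro tuple_type_cong) simp
      also have "\<dots> = tuple_type ?S ?A (Suc n) e'"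
        by (rule tuple_type_iso[OF struct unit_automorphism[OF rep g(1)]]) (simp add: Dom)
      finally show ?thesis using e'(1) by blast
    qed
    then have "tuple_type ?S ?A (Suc n) ` assignments ?A \<subseteq> tuple_type ?S ?A (Suc n) ` P" by blast
    then show ?thesis using P(1) finite_subset by blast
  qed
  \<comment> \<open>Oligomorphicity concerns nonempty tuples only; this includes \<open>n = 0\<close>.\<close>
  have fin: "finite (tuple_type ?S ?A n ` assignments ?A)" for n
  proof -
    have "tuple_type ?S ?A n e = {\<phi> \<in> tuple_type ?S ?A (Suc n) e. free_vars \<phi> \<subseteq> {..<n}}" for e
      by (auto simp: tuple_type_def)
    then have "tuple_type ?S ?A n ` assignments ?A =
        (\<lambda>p. {\<phi> \<in> p. free_vars \<phi> \<subseteq> {..<n}}) ` tuple_type ?S ?A (Suc n) ` assignments ?A"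
      by (simp add: image_image)
    then show ?thesis using fin_Suc[of n] by simp
  qed
  show ?thesis
    unfolding omega_categorical_def
  proof (intro allI impI, elim conjE)
    fix B C assume B: "countable_structure ?S B" "is_model ?S (Th ?S ?A) B"
      and C: "countable_structure ?S C" "is_model ?S (Th ?S ?A) C"
    have "countable (Dom B)" "countable (Dom C)"
      using B C by (auto simp: countable_structure_def denumerable_def)
    moreover have "partial_elementary ?S B C {}" by (rule partial_elementary_empty[OF struct B(2) C(2)])
    ultimately show "\<exists>h. struct_iso ?S B C h"
      using iso_extending[OF fin B(2) _ C(2), of "{}"] by simp
  qed
qed

section \<open>The equivalence\<close>
lemma all_equivalent_via:
  assumes "A \<longleftrightarrow> R" "B \<longleftrightarrow> R" "R \<Longrightarrow> C" "C \<Longrightarrow> D" "D \<Longrightarrow> R"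
  shows "all_equivalent [A, B, C, D]"
  using assms by (auto simp: all_equivalent_def)

lemma (in topological_monoid) oligomorphic_representation_of_omega_categorical:
  assumes A: "countable_structure S A" "omega_categorical S A"
    and iso: "topological_iso M T (endo_monoid S A) (endo_topology S A) \<xi>"
  shows "\<exists>\<zeta>. faithful_representation M T (UNIV :: nat set) \<zeta> \<and>
    closedin (pointwise_topology UNIV) (\<zeta> ` carrier M) \<and> oligomorphic UNIV (\<zeta> ` Units M)"
proof -
  have struct: "is_struct S A" using A(1) by (simp add: countable_structure_def)
  then have \<xi>: "faithful_representation M T (Dom A) \<xi>" "\<xi> ` carrier M = Endo S A"
    using iso by (simp_all add: endo_iso_iff_representation)
  interpret faithful_representation M T "Dom A" \<xi> by (rule \<xi>(1))
  have "bij_betw (to_nat_on (Dom A)) (Dom A) UNIV" (is "bij_betw ?\<beta> _ _")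
    using A(1) by (auto simp: countable_structure_def denumerable_def intro: to_nat_on_infinite)
  define \<zeta> where "\<zeta> x k = ?\<beta> (\<xi> x (inv_into (Dom A) ?\<beta> k))" for x k
  note transported = transport[OF \<open>bij_betw ?\<beta> _ _\<close>, folded \<zeta>_def]
  show ?thesis
    using transported closedin_Endo[OF struct] \<xi>(2)
      omega_categorical_imp_oligomorphic[OF \<xi> A] by (intro exI[of _ \<zeta>]) simp
qed

theorem theorem3:
  fixes M :: "('a, 'm) monoid_scheme" (structure) and T :: "'a topology"
  assumes "topological_monoid M T"
  shows "all_equivalent
   [\<exists>(S :: (nat, nat) signature) (A :: (nat, nat, nat) fo_struct).
      countable_structure S A \<and> omega_categorical S A \<and>
      (\<exists>\<xi>. topological_iso M T (endo_monoid S A) (endo_topology S A) \<xi>),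

    \<exists>(N :: (nat \<Rightarrow> nat) set) \<xi>.
      submonoid N (transformation_monoid UNIV) \<and>
      closedin (pointwise_topology UNIV) N \<and>
      topological_iso M T
        (transformation_monoid UNIV\<lparr>carrier := N\<rparr>) (subtopology (pointwise_topology UNIV) N) \<xi> \<and>
      oligomorphic UNIV (\<xi> ` Units M),

    denumerably_separable T \<and>
    (\<exists>d. compatible_metric T d \<and>
         finitely_generated_metric M (Units M) d \<and>
         Metric_space.mcomplete (carrier M) d \<and>
         left_nonexpansive M d \<and>
         ultrametric_on (carrier M) d \<and>
         approximately_oligomorphic (Units M) (\<lambda>g x. g \<otimes> x) (carrier M) d),

    Hausdorff_space T \<and>
    (\<exists>V. equiv (carrier M) V \<and> left_invariant M V \<and> denumerable (carrier M // V) \<and>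
         (\<exists>\<U>. is_uniformity (carrier M) \<U> \<and>
              uniformity_base
                {{(x, y). x \<in> carrier M \<and> y \<in> carrier M \<and> (\<forall>g\<in>F. (x \<otimes> g, y \<otimes> g) \<in> V)} | F.
                   finite F \<and> F \<subseteq> Units M} \<U> \<and>
              compatible_uniformity T \<U> \<and>
              complete_uniformity (carrier M) \<U>) \<and>
         (\<forall>n\<ge>1. finite (nlists n (carrier M) //
            {(x, y). x \<in> nlists n (carrier M) \<and> y \<in> nlists n (carrier M) \<and>
                     (\<exists>g\<in>Units M. \<forall>i<n. (x ! i, g \<otimes> y ! i) \<in> V)})))]"
proof (rule all_equivalent_via[where R = "\<exists>\<xi>. faithful_representation M T (UNIV :: nat set) \<xi> \<and>
    closedin (pointwise_topology UNIV) (\<xi> ` carrier M) \<and> oligomorphic UNIV (\<xi> ` Units M)"], goal_cases)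
  interpret topological_monoid M T by fact
  case 1
  show ?case
  proof (intro iffI, goal_cases)
    case 1
    then obtain S A \<xi> where A: "countable_structure S A" "omega_categorical S A"
      and iso: "topological_iso M T (endo_monoid S A) (endo_topology S A) \<xi>" by (elim exE conjE)
    show ?case by (rule oligomorphic_representation_of_omega_categorical[OF A iso])
  next
    case 2
    then obtain \<xi> where \<xi>: "faithful_representation M T (UNIV :: nat set) \<xi>"
      "closedin (pointwise_topology UNIV) (\<xi> ` carrier M)" "oligomorphic UNIV (\<xi> ` Units M)"
      by (elim exE conjE)
    let ?A = "orbit_structure (\<xi> ` carrier M)"
    have "countable_structure tuple_signature ?A" by (rule countable_structure_orbit)
    moreover have "topological_iso M T (endo_monoid tuple_signature ?A) (endo_topology tuple_signature ?A) \<xi>"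
      using endo_iso_iff_representation[of tuple_signature ?A \<xi>] Endo_orbit_structure[OF \<xi>(1,2)] \<xi>(1)
        countable_structure_orbit[of "\<xi> ` carrier M"]
      by (simp add: countable_structure_def orbit_structure_def)
    ultimately show ?case
      using omega_categorical_orbit_structure[OF \<xi>(1,3)] by blast
  qed
next
  case 2
  interpret topological_monoid M T by fact
  show ?case by (rule oligomorphic_iff_representation)
next
  case 3
  then obtain \<xi> where \<xi>: "faithful_representation M T (UNIV :: nat set) \<xi>"
    "closedin (pointwise_topology UNIV) (\<xi> ` carrier M)" "oligomorphic UNIV (\<xi> ` Units M)"
    by (elim exE conjE)
  obtain r where "transversal_representation M T \<xi> r" by (rule transversal_exists[OF \<xi>(1,3)])
  then interpret transversal_representation M T \<xi> r .
  show ?case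
  proof (intro conjI exI[of _ d])
    show "denumerably_separable T"
      using separable infinite_carrier topspace_eq by (simp add: denumerably_separable_iff)
  qed (fact compatible_metric_d finitely_generated_d mcomplete_d[OF \<xi>(2)] left_nonexpansive_d
      ultrametric_on_d approximately_oligomorphic_d[OF \<xi>(3)])+
next
  case 4
  then obtain d where d: "denumerably_separable T" "compatible_metric T d"
    "finitely_generated_metric M (Units M) d" "Metric_space.mcomplete (carrier M) d"
    "left_nonexpansive M d" "ultrametric_on (carrier M) d"
    "approximately_oligomorphic (Units M) (\<lambda>g x. g \<otimes> x) (carrier M) d"
    by (elim exE conjE)
  interpret topological_monoid M T by fact
  have "metric_monoid M T d"
    using d topspace_eq topological_monoid_axioms
    by (simp add: metric_monoid_def metric_monoid_axioms_def compatible_metric_def)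
  then interpret metric_monoid M T d .
  show ?case
  proof (intro conjI exI[of _ V] exI[of _ "generated_uniformity V"] allI impI)
    show "Hausdorff_space T" using Hausdorff_space_mtopology mtopology by simp
    show "denumerable (carrier M // V)"
      using countable_quotient infinite_quotient by (simp add: denumerable_def)
    show "uniformity_base {{(x, y). x \<in> carrier M \<and> y \<in> carrier M \<and> (\<forall>g\<in>F. (x \<otimes> g, y \<otimes> g) \<in> V)} | F.
        finite F \<and> F \<subseteq> Units M} (generated_uniformity V)"
      using uniformity_base_generated by (simp only: entourage_def)
    show "finite (nlists n (carrier M) // {(x, y). x \<in> nlists n (carrier M) \<and> y \<in> nlists n (carrier M) \<and>
        (\<exists>g\<in>Units M. \<forall>i<n. (x ! i, g \<otimes> y ! i) \<in> V)})" if "1 \<le> n" for n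
      using finite_index_Vn[OF that] by (simp only: Vn_def)
  qed (fact equiv_V left_invariant_V is_uniformity_generated[OF equiv_V] compatible complete_uniformity)+
next
  case 5
  then obtain V \<U> where V: "Hausdorff_space T" "equiv (carrier M) V" "left_invariant M V"
    "denumerable (carrier M // V)"
    "uniformity_base {{(x, y). x \<in> carrier M \<and> y \<in> carrier M \<and> (\<forall>g\<in>F. (x \<otimes> g, y \<otimes> g) \<in> V)} | F.
       finite F \<and> F \<subseteq> Units M} \<U>"
    "compatible_uniformity T \<U>" "complete_uniformity (carrier M) \<U>"
    and index: "\<forall>n\<ge>1. finite (nlists n (carrier M) // {(x, y). x \<in> nlists n (carrier M) \<and>
      y \<in> nlists n (carrier M) \<and> (\<exists>g\<in>Units M. \<forall>i<n. (x ! i, g \<otimes> y ! i) \<in> V)})"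
    by (elim exE conjE)
  interpret topological_monoid M T by fact
  have "uniform_monoid M T V \<U>"
    using V by unfold_locales (simp_all only: entourage_def)
  then interpret uniform_monoid M T V \<U> .
  show ?case
    using faithful_representation_axioms closedin_action oligomorphic_action[OF index] by blast
qed

end
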